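(* $\mathrm{SO}$ interprets $\mathrm{ZFC}$; that is, there is an $\mathrm{SO}$-definable $\{\in\}$-structure $\mathcal{A}$ such that $\mathrm{SO}\vdash\mathrm{ZFC}^{\mathcal{A}}$.
   Context: **The theory SO.** $L_{\mathrm{SO}}=\{\mathrm{Ord},\mathrm{SOrd},<,=,\in,\mathrm{G}\}$ is the first-order language with unary predicates $\mathrm{Ord}$ ("is an ordinal"), $\mathrm{SOrd}$ ("is a set of ordinals"), binary predicates $<,=,\in$ and a binary function symbol $\mathrm{G}$. Upper case letters $X,Y,P_i$ range over all objects, lower case Greek letters over objects satisfying $\mathrm{Ord}$, lower case Roman letters over objects satisfying $\mathrm{SOrd}$ (so $\forall\alpha\,\phi$ means $\forall\alpha(\mathrm{Ord}(\alpha)\to\phi)$, etc.). $\alpha\le\beta$ means $\alpha<\beta\lor\alpha=\beta$; $\exists^{=1}$ means "there is exactly one". $\max$ is the maximum with respect to $<$, and $(\alpha,\beta)<^*(\gamma,\delta)$ means: $\max(\alpha,\beta)<\max(\gamma,\delta)$, or the maxima are equal and $\alpha<\gamma$, or the maxima are equal and $\alpha=\gamma$ and $\beta<\delta$. The axioms of $\mathrm{SO}$ are: (SOR) $\forall X,Y\,((\mathrm{Ord}(X)\leftrightarrow\lnot\mathrm{SOrd}(X))\land(X<Y\to\mathrm{Ord}(X)\land\mathrm{Ord}(Y))\land(X\in Y\to\mathrm{Ord}(X)\land\mathrm{SOrd}(Y))\land\mathrm{Ord}(\mathrm{G}(X,Y)))$. (WO) $\forall\alpha,\beta,\gamma\,(\lnot\alpha<\alpha\land(\alpha<\beta\land\beta<\gamma\to\alpha<\gamma)\land(\alpha<\beta\lor\alpha=\beta\lor\beta<\alpha))\land\forall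 a(\exists\alpha(\alpha\in a)\to\exists\alpha(\alpha\in a\land\forall\beta(\beta<\alpha\to\lnot\beta\in a)))$. (INF) $\exists\alpha(\exists\beta(\beta<\alpha)\land\forall\beta(\beta<\alpha\to\exists\gamma(\beta<\gamma\land\gamma<\alpha)))$. (EXT) $\forall a,b(\forall\alpha(\alpha\in a\leftrightarrow\alpha\in b)\to a=b)$. (INI) $\forall\alpha\exists a\forall\beta(\beta<\alpha\leftrightarrow\beta\in a)$. (BOU) $\forall a\exists\alpha\forall\beta(\beta\in a\to\beta<\alpha)$. (GPF) $\forall\alpha,\beta,\gamma\,(\mathrm{G}(\beta,\gamma)\le\alpha\leftrightarrow\forall\delta,\epsilon((\delta,\epsilon)<^*(\beta,\gamma)\to\mathrm{G}(\delta,\epsilon)<\alpha))$. (SUR) $\forall\alpha\exists\beta,\gamma(\alpha=\mathrm{G}(\beta,\gamma))$. (SEP) for every $L_{\mathrm{SO}}$-formula $\phi(\alpha,P_1,\dots,P_n)$: $\forall P_1,\dots,P_n\forall a\exists b\forall\alpha(\alpha\in b\leftrightarrow\alpha\in a\land\phi(\alpha,P_1,\dots,P_n))$. (REP) for every $L_{\mathrm{SO}}$-formula $\phi(\alpha,\beta,P_1,\dots,P_n)$: $\forall P_1,\dots,P_n(\forall\xi,\zeta_1,\zeta_2(\phi(\xi,\zeta_1,\vec P)\land\phi(\xi,\zeta_2,\vec P)\to\zeta_1=\zeta_2)\to\forall a\exists b\forall\zeta(\zeta\in b\leftrightarrow\exists\xi\in a\,\phi(\xi,\zeta,\vec P)))$.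 (POW) $\forall a\exists b\forall z(\exists\alpha(\alpha\in z)\land\forall\alpha(\alpha\in z\to\alpha\in a)\to\exists^{=1}\xi\forall\beta(\beta\in z\leftrightarrow\mathrm{G}(\beta,\xi)\in b))$. **Interpretability.** Let $L_1,L_2$ be first-order languages and $T_1$ an $L_1$-theory. A $T_1$-definable $L_2$-structure $\mathcal{A}$ consists of $L_1$-formulas $\phi_u$ and $\phi_i$ for each non-logical symbol $i$ of $L_2$ and for $=$, such that: $\phi_u$ has exactly one free variable and $T_1\vdash\exists x\,\phi_u(x)$ (write $x\in U$ for $\phi_u(x)$); for an $n$-ary relation symbol $r$ (including $=$) $\phi_r$ has free variables $v_1,\dots,v_n$; for an $n$-ary function symbol $f$, $\phi_f$ has free variables $v_1,\dots,v_{n+1}$ and $T_1$ proves that for all $v_1,\dots,v_n\in U$ there is $v_{n+1}\in U$ with $\phi_f(v_1,\dots,v_{n+1})$, unique up to $\phi_=$; for a constant symbol $c$, $\phi_c$ has one free variable and $T_1$ proves that it is satisfied by an element of $U$, unique up to $\phi_=$; and $T_1$ proves that $\phi_=$ is on $U$ an equivalence relation respecting all relations and functions defined by the formulas of $\mathcal{A}$. For an $L_2$-formula $\psi$, $\psi^{\mathcal{A}}$ is the $L_1$-formula obtained by replacing each symbol (including $=$) by its defining formula (function terms being unravelled in the usual way by existential quantifiers over $U$) and restricting all quantifiers to $U$; $\Phi^{\mathcal{A}}=\{\phi^{\mathcal{A}}:\phi\in\Phi\}$. An $L_1$-theory $T_1$ interprets an $L_2$-theory $T_2$ iff there is a $T_1$-definable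 $L_2$-structure $\mathcal{A}$ with $T_1\vdash T_2^{\mathcal{A}}$. *)

theory Defs
  imports Main
begin

section \<open>First-order logic with equality\<close>

datatype 'f tm = Var nat | Fun 'f "'f tm list"

text \<open>Binding is by de Bruijn indices; named quantifiers are derived below.\<close>

datatype ('f, 'r) fm =
    Bot
  | Eq "'f tm" "'f tm"                         (infix "\<^bold>=" 50)
  | Rel 'r "'f tm list"
  | Imp "('f, 'r) fm" "('f, 'r) fm"            (infixr "\<^bold>\<longrightarrow>" 25)
  | Forall "('f, 'r) fm"

abbreviation Neg :: "('f, 'r) fm \<Rightarrow> ('f, 'r) fm" ("\<^bold>\<not> _" [40] 40)
  where "\<^bold>\<not> p \<equiv> p \<^bold>\<longrightarrow> Bot"
abbreviation Or :: "('f, 'r) fm \<Rightarrow> ('f, 'r) fm \<Rightarrow> ('f, 'r) fm" (infixr "\<^bold>\<or>" 30)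
  where "p \<^bold>\<or> q \<equiv> \<^bold>\<not> p \<^bold>\<longrightarrow> q"
abbreviation And :: "('f, 'r) fm \<Rightarrow> ('f, 'r) fm \<Rightarrow> ('f, 'r) fm" (infixr "\<^bold>\<and>" 35)
  where "p \<^bold>\<and> q \<equiv> \<^bold>\<not> (p \<^bold>\<longrightarrow> \<^bold>\<not> q)"
abbreviation Iff :: "('f, 'r) fm \<Rightarrow> ('f, 'r) fm \<Rightarrow> ('f, 'r) fm" (infix "\<^bold>\<longleftrightarrow>" 25)
  where "p \<^bold>\<longleftrightarrow> q \<equiv> (p \<^bold>\<longrightarrow> q) \<^bold>\<and> (q \<^bold>\<longrightarrow> p)"

definition Conj :: "('f, 'r) fm list \<Rightarrow> ('f, 'r) fm"
  where "Conj ps = foldr And ps (\<^bold>\<not> Bot)"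

record ('f, 'r) language =
  fun_arity :: "'f \<Rightarrow> nat option"
  rel_arity :: "'r \<Rightarrow> nat option"

primrec wf_tm :: "('f, 'r) language \<Rightarrow> 'f tm \<Rightarrow> bool" where
  "wf_tm L (Var n) \<longleftrightarrow> True"
| "wf_tm L (Fun f ts) \<longleftrightarrow> fun_arity L f = Some (length ts) \<and> list_all (wf_tm L) ts"

primrec wf_fm :: "('f, 'r) language \<Rightarrow> ('f, 'r) fm \<Rightarrow> bool" where
  "wf_fm L Bot \<longleftrightarrow> True"
| "wf_fm L (s \<^bold>= t) \<longleftrightarrow> wf_tm L s \<and> wf_tm L t"
| "wf_fm L (Rel r ts) \<longleftrightarrow> rel_arity L r = Some (length ts) \<and> list_all (wf_tm L) ts"
| "wf_fm L (p \<^bold>\<longrightarrow> q) \<longleftrightarrow> wf_fm L p \<and> wf_fm L q"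
| "wf_fm L (Forall p) \<longleftrightarrow> wf_fm L p"

primrec fv_tm :: "'f tm \<Rightarrow> nat set" where
  "fv_tm (Var n) = {n}"
| "fv_tm (Fun f ts) = \<Union> (set (map fv_tm ts))"

primrec fv :: "('f, 'r) fm \<Rightarrow> nat set" where
  "fv Bot = {}"
| "fv (s \<^bold>= t) = fv_tm s \<union> fv_tm t"
| "fv (Rel r ts) = \<Union> (set (map fv_tm ts))"
| "fv (p \<^bold>\<longrightarrow> q) = fv p \<union> fv q"
| "fv (Forall p) = {n. Suc n \<in> fv p}"

primrec subst_tm :: "(nat \<Rightarrow> 'f tm) \<Rightarrow> 'f tm \<Rightarrow> 'f tm" where
  "subst_tm \<sigma> (Var n) = \<sigma> n"
| "subst_tm \<sigma> (Fun f ts) = Fun f (map (subst_tm \<sigma>) ts)"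

definition up :: "(nat \<Rightarrow> 'f tm) \<Rightarrow> nat \<Rightarrow> 'f tm"
  where "up \<sigma> n = (case n of 0 \<Rightarrow> Var 0 | Suc m \<Rightarrow> subst_tm (\<lambda>i. Var (Suc i)) (\<sigma> m))"

text \<open>Simultaneous capture-avoiding substitution.\<close>

primrec subst_fm :: "(nat \<Rightarrow> 'f tm) \<Rightarrow> ('f, 'r) fm \<Rightarrow> ('f, 'r) fm" where
  "subst_fm \<sigma> Bot = Bot"
| "subst_fm \<sigma> (s \<^bold>= t) = (subst_tm \<sigma> s \<^bold>= subst_tm \<sigma> t)"
| "subst_fm \<sigma> (Rel r ts) = Rel r (map (subst_tm \<sigma>) ts)"
| "subst_fm \<sigma> (p \<^bold>\<longrightarrow> q) = (subst_fm \<sigma> p \<^bold>\<longrightarrow> subst_fm \<sigma> q)"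
| "subst_fm \<sigma> (Forall p) = Forall (subst_fm (up \<sigma>) p)"

definition lift :: "('f, 'r) fm \<Rightarrow> ('f, 'r) fm"
  where "lift = subst_fm (\<lambda>i. Var (Suc i))"

text \<open>\<open>inst t p\<close> is the instance at \<open>t\<close> of the body \<open>p\<close> of \<open>Forall p\<close>.\<close>

definition inst :: "'f tm \<Rightarrow> ('f, 'r) fm \<Rightarrow> ('f, 'r) fm"
  where "inst t = subst_fm (case_nat t Var)"

text \<open>Classical natural deduction with equality. Only formulas of the language \<open>L\<close> may occur
  in a derivation from a set of \<open>L\<close>-formulas.\<close>

inductive proves :: "('f, 'r) language \<Rightarrow> ('f, 'r) fm set \<Rightarrow> ('f, 'r) fm \<Rightarrow> bool"
    ("_, _ \<turnstile> _" [51, 51, 20] 20)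
  for L :: "('f, 'r) language" where
  Assm: "p \<in> \<Gamma> \<Longrightarrow> L, \<Gamma> \<turnstile> p"
| ImpI: "L, insert p \<Gamma> \<turnstile> q \<Longrightarrow> wf_fm L p \<Longrightarrow> L, \<Gamma> \<turnstile> (p \<^bold>\<longrightarrow> q)"
| ImpE: "L, \<Gamma> \<turnstile> (p \<^bold>\<longrightarrow> q) \<Longrightarrow> L, \<Gamma> \<turnstile> p \<Longrightarrow> L, \<Gamma> \<turnstile> q"
| BotE: "L, insert (\<^bold>\<not> p) \<Gamma> \<turnstile> Bot \<Longrightarrow> wf_fm L p \<Longrightarrow> L, \<Gamma> \<turnstile> p"
| ForallI: "L, lift ` \<Gamma> \<turnstile> p \<Longrightarrow> L, \<Gamma> \<turnstile> Forall p"
| ForallE: "L, \<Gamma> \<turnstile> Forall p \<Longrightarrow> wf_tm L t \<Longrightarrow> L, \<Gamma> \<turnstile> inst t p"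
| EqI: "wf_tm L t \<Longrightarrow> L, \<Gamma> \<turnstile> (t \<^bold>= t)"
| EqE: "L, \<Gamma> \<turnstile> (s \<^bold>= t) \<Longrightarrow> L, \<Gamma> \<turnstile> inst s p \<Longrightarrow> L, \<Gamma> \<turnstile> inst t p"

section \<open>Named variables\<close>

text \<open>\<open>Forall (bind x p)\<close> is the quantification of \<open>p\<close> over its free variable \<open>x\<close>, so that
  formulas can be written with names (numbers) instead of indices; see \<open>fv_all\<close> and
  \<open>inst_bind\<close>.\<close>

definition bind :: "nat \<Rightarrow> ('f, 'r) fm \<Rightarrow> ('f, 'r) fm"
  where "bind x = subst_fm (\<lambda>i. if i = x then Var 0 else Var (Suc i))"

abbreviation all :: "nat \<Rightarrow> ('f, 'r) fm \<Rightarrow> ('f, 'r) fm" ("(3\<^bold>\<forall>_./ _)" [1000, 20] 20)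
  where "\<^bold>\<forall>x. p \<equiv> Forall (bind x p)"
abbreviation ex :: "nat \<Rightarrow> ('f, 'r) fm \<Rightarrow> ('f, 'r) fm" ("(3\<^bold>\<exists>_./ _)" [1000, 20] 20)
  where "\<^bold>\<exists>x. p \<equiv> \<^bold>\<not> (\<^bold>\<forall>x. \<^bold>\<not> p)"

definition alls :: "nat list \<Rightarrow> ('f, 'r) fm \<Rightarrow> ('f, 'r) fm"
  where "alls xs p = foldr all xs p"

text \<open>\<open>app p [x\<^sub>1, \<dots>, x\<^sub>n]\<close> is \<open>p(x\<^sub>1, \<dots>, x\<^sub>n)\<close>, where the variables displayed in \<open>p\<close> are
  \<open>0, \<dots>, n - 1\<close>.\<close>

definition app :: "('f, 'r) fm \<Rightarrow> nat list \<Rightarrow> ('f, 'r) fm"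
  where "app p xs = subst_fm (\<lambda>i. if i < length xs then Var (xs ! i) else Var i) p"

lemma fv_subst_tm: "fv_tm (subst_tm \<sigma> t) = (\<Union>i \<in> fv_tm t. fv_tm (\<sigma> i))"
  by (induction t) auto

lemma fv_subst_fm: "fv (subst_fm \<sigma> p) = (\<Union>i \<in> fv p. fv_tm (\<sigma> i))"
proof (induction p arbitrary: \<sigma>)
  case (Forall p)
  have "n \<in> fv (subst_fm \<sigma> (Forall p)) \<longleftrightarrow> n \<in> (\<Union>i \<in> fv (Forall p). fv_tm (\<sigma> i))" for n
  proof -
    have "n \<in> fv (subst_fm \<sigma> (Forall p)) \<longleftrightarrow> (\<exists>i \<in> fv p. Suc n \<in> fv_tm (up \<sigma> i))"
      by (simp add: Forall.IH)
    also have "\<dots> \<longleftrightarrow> (\<exists>j. Suc j \<in> fv p \<and> n \<in> fv_tm (\<sigma> j))"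
    proof
      assume "\<exists>i \<in> fv p. Suc n \<in> fv_tm (up \<sigma> i)"
      then obtain i where "i \<in> fv p" "Suc n \<in> fv_tm (up \<sigma> i)" by blast
      then show "\<exists>j. Suc j \<in> fv p \<and> n \<in> fv_tm (\<sigma> j)"
        by (cases i) (auto simp: up_def fv_subst_tm)
    next
      assume "\<exists>j. Suc j \<in> fv p \<and> n \<in> fv_tm (\<sigma> j)"
      then obtain j where "Suc j \<in> fv p" "n \<in> fv_tm (\<sigma> j)" by blast
      then show "\<exists>i \<in> fv p. Suc n \<in> fv_tm (up \<sigma> i)"
        by (intro bexI[of _ "Suc j"]) (auto simp: up_def fv_subst_tm)
    qed
    finally show ?thesis by auto
  qed
  then show ?case by blast
qed (auto simp: fv_subst_tm)

lemma fv_all [simp]: "fv (\<^bold>\<forall>x. p) = fv p - {x}"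
  by (auto simp: bind_def fv_subst_fm split: if_splits)

lemma subst_tm_subst_tm: "subst_tm \<tau> (subst_tm \<sigma> t) = subst_tm (\<lambda>i. subst_tm \<tau> (\<sigma> i)) t"
  by (induction t) auto

lemma subst_fm_subst_fm: "subst_fm \<tau> (subst_fm \<sigma> p) = subst_fm (\<lambda>i. subst_tm \<tau> (\<sigma> i)) p"
proof (induction p arbitrary: \<sigma> \<tau>)
  case (Forall p)
  have "subst_tm (up \<tau>) (up \<sigma> i) = up (\<lambda>i. subst_tm \<tau> (\<sigma> i)) i" for i
    by (cases i) (simp_all add: up_def subst_tm_subst_tm)
  then show ?case by (simp add: Forall.IH)
qed (simp_all add: subst_tm_subst_tm)

lemma inst_bind: "inst t (bind x p) = subst_fm (Var(x := t)) p"
proof -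
  have "(\<lambda>i. subst_tm (case_nat t Var) (if i = x then Var 0 else Var (Suc i))) = Var(x := t)"
    by auto
  then show ?thesis by (simp add: inst_def bind_def subst_fm_subst_fm)
qed

lemma wf_subst_tm: "wf_tm L t \<Longrightarrow> (\<And>i. wf_tm L (\<sigma> i)) \<Longrightarrow> wf_tm L (subst_tm \<sigma> t)"
  by (induction t) (auto simp: list_all_iff)

lemma wf_subst_fm: "wf_fm L p \<Longrightarrow> (\<And>i. wf_tm L (\<sigma> i)) \<Longrightarrow> wf_fm L (subst_fm \<sigma> p)"
proof (induction p arbitrary: \<sigma>)
  case (Forall p)
  have "wf_tm L (up \<sigma> i)" for i
    using Forall.prems(2) by (cases i) (auto simp: up_def intro: wf_subst_tm)
  then show ?case using Forall by simp
qed (auto simp: list_all_iff wf_subst_tm)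

lemma wf_bind: "wf_fm L p \<Longrightarrow> wf_fm L (bind x p)"
  by (simp add: bind_def wf_subst_fm)

lemma fv_alls: "fv (alls xs p) = fv p - set xs"
  by (induction xs) (auto simp: alls_def simp del: fv.simps(5))

lemma wf_alls: "wf_fm L p \<Longrightarrow> wf_fm L (alls xs p)"
  by (induction xs) (auto simp: alls_def wf_bind)

section \<open>Interpretability\<close>

record ('f, 'r, 'f2, 'r2) interp =
  univ_fm :: "('f, 'r) fm"
  eq_fm :: "('f, 'r) fm"
  rel_fm :: "'r2 \<Rightarrow> ('f, 'r) fm"
  fun_fm :: "'f2 \<Rightarrow> ('f, 'r) fm"

definition all_in :: "('f, 'r, 'f2, 'r2) interp \<Rightarrow> nat \<Rightarrow> ('f, 'r) fm \<Rightarrow> ('f, 'r) fm"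
  where "all_in A x p = (\<^bold>\<forall>x. app (univ_fm A) [x] \<^bold>\<longrightarrow> p)"
definition ex_in :: "('f, 'r, 'f2, 'r2) interp \<Rightarrow> nat \<Rightarrow> ('f, 'r) fm \<Rightarrow> ('f, 'r) fm"
  where "ex_in A x p = (\<^bold>\<exists>x. app (univ_fm A) [x] \<^bold>\<and> p)"
definition alls_in :: "('f, 'r, 'f2, 'r2) interp \<Rightarrow> nat list \<Rightarrow> ('f, 'r) fm \<Rightarrow> ('f, 'r) fm"
  where "alls_in A xs p = foldr (all_in A) xs p"

definition eqs_in :: "('f, 'r, 'f2, 'r2) interp \<Rightarrow> nat list \<Rightarrow> nat list \<Rightarrow> ('f, 'r) fm"
  where "eqs_in A xs ys = Conj (map2 (\<lambda>x y. app (eq_fm A) [x, y]) xs ys)"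

text \<open>The two conjuncts of \<open>fun_in\<close> say that on the universe the graph formula \<open>fun_fm A f\<close> of
  an \<open>n\<close>-ary \<open>f\<close> has a value, unique up to \<open>eq_fm A\<close>.\<close>

definition fun_in :: "('f, 'r, 'f2, 'r2) interp \<Rightarrow> 'f2 \<Rightarrow> nat \<Rightarrow> ('f, 'r) fm" where
  "fun_in A f n = alls_in A [0..<n]
     (ex_in A n (app (fun_fm A f) ([0..<n] @ [n])) \<^bold>\<and>
      all_in A n (all_in A (Suc n)
        (app (fun_fm A f) ([0..<n] @ [n]) \<^bold>\<and> app (fun_fm A f) ([0..<n] @ [Suc n])
          \<^bold>\<longrightarrow> app (eq_fm A) [n, Suc n])))"

definition equiv_in :: "('f, 'r, 'f2, 'r2) interp \<Rightarrow> ('f, 'r) fm" where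
  "equiv_in A = (let E = (\<lambda>x y. app (eq_fm A) [x, y]) in
     alls_in A [0] (E 0 0) \<^bold>\<and>
     alls_in A [0, 1] (E 0 1 \<^bold>\<longrightarrow> E 1 0) \<^bold>\<and>
     alls_in A [0, 1, 2] (E 0 1 \<^bold>\<and> E 1 2 \<^bold>\<longrightarrow> E 0 2))"

definition rel_cong_in :: "('f, 'r, 'f2, 'r2) interp \<Rightarrow> 'r2 \<Rightarrow> nat \<Rightarrow> ('f, 'r) fm" where
  "rel_cong_in A r n = (let xs = [0..<n]; ys = [n..<2*n] in
     alls_in A (xs @ ys)
       (eqs_in A xs ys \<^bold>\<longrightarrow> (app (rel_fm A r) xs \<^bold>\<longleftrightarrow> app (rel_fm A r) ys)))"

definition fun_cong_in :: "('f, 'r, 'f2, 'r2) interp \<Rightarrow> 'f2 \<Rightarrow> nat \<Rightarrow> ('f, 'r) fm" where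
  "fun_cong_in A f n = (let xs = [0..<n]; ys = [n..<2*n]; u = 2*n; v = 2*n+1 in
     alls_in A (xs @ ys @ [u, v])
       (eqs_in A xs ys \<^bold>\<and> app (fun_fm A f) (xs @ [u]) \<^bold>\<and> app (fun_fm A f) (ys @ [v])
         \<^bold>\<longrightarrow> app (eq_fm A) [u, v]))"

text \<open>The variables \<open>v\<^sub>1, \<dots>, v\<^sub>n\<close> of a defining formula are \<open>0, \<dots>, n - 1\<close>. Constant symbols are
  the function symbols of arity 0.\<close>

definition definable_structure ::
    "('f, 'r) language \<Rightarrow> ('f, 'r) fm set \<Rightarrow> ('f2, 'r2) language \<Rightarrow> ('f, 'r, 'f2, 'r2) interp \<Rightarrow> bool"
  where "definable_structure L1 T1 L2 A \<longleftrightarrow>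
    wf_fm L1 (univ_fm A) \<and> fv (univ_fm A) = {0} \<and> (L1, T1 \<turnstile> \<^bold>\<exists>0. univ_fm A) \<and>
    wf_fm L1 (eq_fm A) \<and> fv (eq_fm A) = {0, 1} \<and> (L1, T1 \<turnstile> equiv_in A) \<and>
    (\<forall>r n. rel_arity L2 r = Some n \<longrightarrow>
       wf_fm L1 (rel_fm A r) \<and> fv (rel_fm A r) = {0..<n} \<and> (L1, T1 \<turnstile> rel_cong_in A r n)) \<and>
    (\<forall>f n. fun_arity L2 f = Some n \<longrightarrow>
       wf_fm L1 (fun_fm A f) \<and> fv (fun_fm A f) = {0..<Suc n} \<and>
       (L1, T1 \<turnstile> fun_in A f n) \<and> (L1, T1 \<turnstile> fun_cong_in A f n))"

text \<open>Unravelling of terms, in continuation-passing style: \<open>unravel_tm A t n k\<close> is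
  \<open>k n' y\<close>, where the variable \<open>y\<close> holds the value of \<open>t\<close>, under existential quantifiers over the
  universe for the values of the non-variable subterms of \<open>t\<close>. All variables from \<open>n\<close> on
  (respectively from \<open>n'\<close> on, in the continuation) are unused.\<close>

primrec unravel_tm ::
    "('f, 'r, 'f2, 'r2) interp \<Rightarrow> 'f2 tm \<Rightarrow> nat \<Rightarrow> (nat \<Rightarrow> nat \<Rightarrow> ('f, 'r) fm) \<Rightarrow> ('f, 'r) fm"
  and unravel_tms ::
    "('f, 'r, 'f2, 'r2) interp \<Rightarrow> 'f2 tm list \<Rightarrow> nat \<Rightarrow> (nat \<Rightarrow> nat list \<Rightarrow> ('f, 'r) fm) \<Rightarrow> ('f, 'r) fm"
  where
  "unravel_tm A (Var x) = (\<lambda>n k. k n x)"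
| "unravel_tm A (Fun f ts) = (\<lambda>n k. unravel_tms A ts n
     (\<lambda>n' ys. ex_in A n' (app (fun_fm A f) (ys @ [n']) \<^bold>\<and> k (Suc n') n')))"
| "unravel_tms A [] = (\<lambda>n k. k n [])"
| "unravel_tms A (t # ts) = (\<lambda>n k. unravel_tm A t n
     (\<lambda>n' y. unravel_tms A ts n' (\<lambda>n'' ys. k n'' (y # ys))))"

definition fresh :: "'f tm list \<Rightarrow> nat"
  where "fresh ts = Suc (Max (insert 0 (\<Union> (set (map fv_tm ts)))))"

definition atom_in ::
    "('f, 'r, 'f2, 'r2) interp \<Rightarrow> ('f, 'r) fm \<Rightarrow> 'f2 tm list \<Rightarrow> ('f, 'r) fm"
  where "atom_in A p ts = unravel_tms A ts (fresh ts) (\<lambda>_. app p)"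

text \<open>The translation \<open>\<psi>\<^sup>A\<close>. In the last clause variable \<open>0\<close>, the free variable of
  \<open>univ_fm A\<close>, is the bound one.\<close>

primrec translate :: "('f, 'r, 'f2, 'r2) interp \<Rightarrow> ('f2, 'r2) fm \<Rightarrow> ('f, 'r) fm" where
  "translate A Bot = Bot"
| "translate A (s \<^bold>= t) = atom_in A (eq_fm A) [s, t]"
| "translate A (Rel r ts) = atom_in A (rel_fm A r) ts"
| "translate A (p \<^bold>\<longrightarrow> q) = (translate A p \<^bold>\<longrightarrow> translate A q)"
| "translate A (Forall p) = Forall (univ_fm A \<^bold>\<longrightarrow> translate A p)"

definition interprets ::
    "('f, 'r) language \<Rightarrow> ('f, 'r) fm set \<Rightarrow> ('f2, 'r2) language \<Rightarrow> ('f2, 'r2) fm set \<Rightarrow> bool"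
  where "interprets L1 T1 L2 T2 \<longleftrightarrow>
    (\<exists>A :: ('f, 'r, 'f2, 'r2) interp. definable_structure L1 T1 L2 A \<and>
       (\<forall>\<psi>\<in>T2. L1, T1 \<turnstile> translate A \<psi>))"

section \<open>The theory SO\<close>

datatype so_fun = GP
datatype so_rel = OrdR | SOrdR | LessR | MemR

type_synonym so_tm = "so_fun tm"
type_synonym so_fm = "(so_fun, so_rel) fm"

definition L_SO :: "(so_fun, so_rel) language" where
  "L_SO = \<lparr> fun_arity = (\<lambda>_. Some 2),
            rel_arity = (\<lambda>r. case r of OrdR \<Rightarrow> Some 1 | SOrdR \<Rightarrow> Some 1
                                     | LessR \<Rightarrow> Some 2 | MemR \<Rightarrow> Some 2) \<rparr>"

abbreviation G :: "so_tm \<Rightarrow> so_tm \<Rightarrow> so_tm" where "G s t \<equiv> Fun GP [s, t]"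
abbreviation Ord :: "so_tm \<Rightarrow> so_fm" where "Ord t \<equiv> Rel OrdR [t]"
abbreviation SOrd :: "so_tm \<Rightarrow> so_fm" where "SOrd t \<equiv> Rel SOrdR [t]"
abbreviation Less :: "so_tm \<Rightarrow> so_tm \<Rightarrow> so_fm" (infix "\<^bold><" 50) where "s \<^bold>< t \<equiv> Rel LessR [s, t]"
abbreviation Leq :: "so_tm \<Rightarrow> so_tm \<Rightarrow> so_fm" (infix "\<^bold>\<le>" 50) where "s \<^bold>\<le> t \<equiv> s \<^bold>< t \<^bold>\<or> s \<^bold>= t"
abbreviation Mem :: "so_tm \<Rightarrow> so_tm \<Rightarrow> so_fm" (infix "\<^bold>\<in>" 50) where "s \<^bold>\<in> t \<equiv> Rel MemR [s, t]"

abbreviation all_ord :: "nat \<Rightarrow> so_fm \<Rightarrow> so_fm" ("(3\<^bold>\<forall>\<^sub>O_./ _)" [1000, 20] 20)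
  where "\<^bold>\<forall>\<^sub>Ox. p \<equiv> \<^bold>\<forall>x. Ord (Var x) \<^bold>\<longrightarrow> p"
abbreviation ex_ord :: "nat \<Rightarrow> so_fm \<Rightarrow> so_fm" ("(3\<^bold>\<exists>\<^sub>O_./ _)" [1000, 20] 20)
  where "\<^bold>\<exists>\<^sub>Ox. p \<equiv> \<^bold>\<exists>x. Ord (Var x) \<^bold>\<and> p"
abbreviation all_sord :: "nat \<Rightarrow> so_fm \<Rightarrow> so_fm" ("(3\<^bold>\<forall>\<^sub>S_./ _)" [1000, 20] 20)
  where "\<^bold>\<forall>\<^sub>Sx. p \<equiv> \<^bold>\<forall>x. SOrd (Var x) \<^bold>\<longrightarrow> p"
abbreviation ex_sord :: "nat \<Rightarrow> so_fm \<Rightarrow> so_fm" ("(3\<^bold>\<exists>\<^sub>S_./ _)" [1000, 20] 20)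
  where "\<^bold>\<exists>\<^sub>Sx. p \<equiv> \<^bold>\<exists>x. SOrd (Var x) \<^bold>\<and> p"

text \<open>\<open>is_max \<alpha> \<beta> \<mu>\<close> says \<open>\<mu> = max(\<alpha>, \<beta>)\<close>; \<open>pair_less \<alpha> \<beta> \<gamma> \<delta>\<close> says
  \<open>(\<alpha>, \<beta>) <\<^sup>* (\<gamma>, \<delta>)\<close>.\<close>

definition is_max :: "nat \<Rightarrow> nat \<Rightarrow> nat \<Rightarrow> so_fm" where
  "is_max \<alpha> \<beta> \<mu> =
     ((Var \<mu> \<^bold>= Var \<alpha> \<^bold>\<or> Var \<mu> \<^bold>= Var \<beta>) \<^bold>\<and> Var \<alpha> \<^bold>\<le> Var \<mu> \<^bold>\<and> Var \<beta> \<^bold>\<le> Var \<mu>)"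

definition pair_less :: "nat \<Rightarrow> nat \<Rightarrow> nat \<Rightarrow> nat \<Rightarrow> so_fm" where
  "pair_less \<alpha> \<beta> \<gamma> \<delta> = (let \<mu> = Suc (\<alpha> + \<beta> + \<gamma> + \<delta>); \<nu> = Suc \<mu> in
     \<^bold>\<exists>\<^sub>O\<mu>. \<^bold>\<exists>\<^sub>O\<nu>. is_max \<alpha> \<beta> \<mu> \<^bold>\<and> is_max \<gamma> \<delta> \<nu> \<^bold>\<and>
       (Var \<mu> \<^bold>< Var \<nu> \<^bold>\<or>
        Var \<mu> \<^bold>= Var \<nu> \<^bold>\<and> Var \<alpha> \<^bold>< Var \<gamma> \<^bold>\<or>
        Var \<mu> \<^bold>= Var \<nu> \<^bold>\<and> Var \<alpha> \<^bold>= Var \<gamma> \<^bold>\<and> Var \<beta> \<^bold>< Var \<delta>))"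

definition ax_SOR :: so_fm where
  "ax_SOR = (let X = 0; Y = 1 in
     \<^bold>\<forall>X. \<^bold>\<forall>Y.
       (Ord (Var X) \<^bold>\<longleftrightarrow> \<^bold>\<not> SOrd (Var X)) \<^bold>\<and>
       (Var X \<^bold>< Var Y \<^bold>\<longrightarrow> Ord (Var X) \<^bold>\<and> Ord (Var Y)) \<^bold>\<and>
       (Var X \<^bold>\<in> Var Y \<^bold>\<longrightarrow> Ord (Var X) \<^bold>\<and> SOrd (Var Y)) \<^bold>\<and>
       Ord (G (Var X) (Var Y)))"

definition ax_WO :: so_fm where
  "ax_WO = (let \<alpha> = 0; \<beta> = 1; \<gamma> = 2; a = 3 in
     (\<^bold>\<forall>\<^sub>O\<alpha>. \<^bold>\<forall>\<^sub>O\<beta>. \<^bold>\<forall>\<^sub>O\<gamma>.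
        \<^bold>\<not> Var \<alpha> \<^bold>< Var \<alpha> \<^bold>\<and>
        (Var \<alpha> \<^bold>< Var \<beta> \<^bold>\<and> Var \<beta> \<^bold>< Var \<gamma> \<^bold>\<longrightarrow> Var \<alpha> \<^bold>< Var \<gamma>) \<^bold>\<and>
        (Var \<alpha> \<^bold>< Var \<beta> \<^bold>\<or> Var \<alpha> \<^bold>= Var \<beta> \<^bold>\<or> Var \<beta> \<^bold>< Var \<alpha>)) \<^bold>\<and>
     (\<^bold>\<forall>\<^sub>Sa. (\<^bold>\<exists>\<^sub>O\<alpha>. Var \<alpha> \<^bold>\<in> Var a) \<^bold>\<longrightarrow>
        (\<^bold>\<exists>\<^sub>O\<alpha>. Var \<alpha> \<^bold>\<in> Var a \<^bold>\<and> (\<^bold>\<forall>\<^sub>O\<beta>. Var \<beta> \<^bold>< Var \<alpha> \<^bold>\<longrightarrow> \<^bold>\<not> Var \<beta> \<^bold>\<in> Var a))))"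

definition ax_INF :: so_fm where
  "ax_INF = (let \<alpha> = 0; \<beta> = 1; \<gamma> = 2 in
     \<^bold>\<exists>\<^sub>O\<alpha>. (\<^bold>\<exists>\<^sub>O\<beta>. Var \<beta> \<^bold>< Var \<alpha>) \<^bold>\<and>
       (\<^bold>\<forall>\<^sub>O\<beta>. Var \<beta> \<^bold>< Var \<alpha> \<^bold>\<longrightarrow> (\<^bold>\<exists>\<^sub>O\<gamma>. Var \<beta> \<^bold>< Var \<gamma> \<^bold>\<and> Var \<gamma> \<^bold>< Var \<alpha>)))"

definition ax_EXT :: so_fm where
  "ax_EXT = (let a = 0; b = 1; \<alpha> = 2 in
     \<^bold>\<forall>\<^sub>Sa. \<^bold>\<forall>\<^sub>Sb. (\<^bold>\<forall>\<^sub>O\<alpha>. Var \<alpha> \<^bold>\<in> Var a \<^bold>\<longleftrightarrow> Var \<alpha> \<^bold>\<in> Var b) \<^bold>\<longrightarrow> Var a \<^bold>= Var b)"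

definition ax_INI :: so_fm where
  "ax_INI = (let \<alpha> = 0; a = 1; \<beta> = 2 in
     \<^bold>\<forall>\<^sub>O\<alpha>. \<^bold>\<exists>\<^sub>Sa. \<^bold>\<forall>\<^sub>O\<beta>. Var \<beta> \<^bold>< Var \<alpha> \<^bold>\<longleftrightarrow> Var \<beta> \<^bold>\<in> Var a)"

definition ax_BOU :: so_fm where
  "ax_BOU = (let a = 0; \<alpha> = 1; \<beta> = 2 in
     \<^bold>\<forall>\<^sub>Sa. \<^bold>\<exists>\<^sub>O\<alpha>. \<^bold>\<forall>\<^sub>O\<beta>. Var \<beta> \<^bold>\<in> Var a \<^bold>\<longrightarrow> Var \<beta> \<^bold>< Var \<alpha>)"

definition ax_GPF :: so_fm where
  "ax_GPF = (let \<alpha> = 0; \<beta> = 1; \<gamma> = 2; \<delta> = 3; \<epsilon> = 4 in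
     \<^bold>\<forall>\<^sub>O\<alpha>. \<^bold>\<forall>\<^sub>O\<beta>. \<^bold>\<forall>\<^sub>O\<gamma>. G (Var \<beta>) (Var \<gamma>) \<^bold>\<le> Var \<alpha> \<^bold>\<longleftrightarrow>
       (\<^bold>\<forall>\<^sub>O\<delta>. \<^bold>\<forall>\<^sub>O\<epsilon>. pair_less \<delta> \<epsilon> \<beta> \<gamma> \<^bold>\<longrightarrow> G (Var \<delta>) (Var \<epsilon>) \<^bold>< Var \<alpha>))"

definition ax_SUR :: so_fm where
  "ax_SUR = (let \<alpha> = 0; \<beta> = 1; \<gamma> = 2 in
     \<^bold>\<forall>\<^sub>O\<alpha>. \<^bold>\<exists>\<^sub>O\<beta>. \<^bold>\<exists>\<^sub>O\<gamma>. Var \<alpha> \<^bold>= G (Var \<beta>) (Var \<gamma>))"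

text \<open>In the schemata, the parameters \<open>P\<^sub>1, \<dots>, P\<^sub>n\<close> are the \<open>n\<close> variables after the ones named in
  the \<open>let\<close>.\<close>

definition ax_SEP :: "nat \<Rightarrow> so_fm \<Rightarrow> so_fm" where
  "ax_SEP n \<phi> = (let \<alpha> = 0; a = 1; b = 2 in
     alls [3..<3 + n]
       (\<^bold>\<forall>\<^sub>Sa. \<^bold>\<exists>\<^sub>Sb. \<^bold>\<forall>\<^sub>O\<alpha>. Var \<alpha> \<^bold>\<in> Var b \<^bold>\<longleftrightarrow> Var \<alpha> \<^bold>\<in> Var a \<^bold>\<and> \<phi>))"

definition ax_REP :: "nat \<Rightarrow> so_fm \<Rightarrow> so_fm" where
  "ax_REP n \<phi> = (let \<xi> = 0; \<zeta> = 1; \<zeta>\<^sub>1 = 2; \<zeta>\<^sub>2 = 3; a = 4; b = 5 in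
     alls [6..<6 + n]
       ((\<^bold>\<forall>\<^sub>O\<xi>. \<^bold>\<forall>\<^sub>O\<zeta>\<^sub>1. \<^bold>\<forall>\<^sub>O\<zeta>\<^sub>2. app \<phi> [\<xi>, \<zeta>\<^sub>1] \<^bold>\<and> app \<phi> [\<xi>, \<zeta>\<^sub>2] \<^bold>\<longrightarrow> Var \<zeta>\<^sub>1 \<^bold>= Var \<zeta>\<^sub>2) \<^bold>\<longrightarrow>
        (\<^bold>\<forall>\<^sub>Sa. \<^bold>\<exists>\<^sub>Sb. \<^bold>\<forall>\<^sub>O\<zeta>. Var \<zeta> \<^bold>\<in> Var b \<^bold>\<longleftrightarrow> (\<^bold>\<exists>\<^sub>O\<xi>. Var \<xi> \<^bold>\<in> Var a \<^bold>\<and> app \<phi> [\<xi>, \<zeta>]))))"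

definition ax_POW :: so_fm where
  "ax_POW = (let a = 0; b = 1; z = 2; \<alpha> = 3; \<beta> = 4; \<xi> = 5; \<zeta> = 6;
              codes = (\<lambda>x. \<^bold>\<forall>\<^sub>O\<beta>. Var \<beta> \<^bold>\<in> Var z \<^bold>\<longleftrightarrow> G (Var \<beta>) (Var x) \<^bold>\<in> Var b) in
     \<^bold>\<forall>\<^sub>Sa. \<^bold>\<exists>\<^sub>Sb. \<^bold>\<forall>\<^sub>Sz.
       (\<^bold>\<exists>\<^sub>O\<alpha>. Var \<alpha> \<^bold>\<in> Var z) \<^bold>\<and> (\<^bold>\<forall>\<^sub>O\<alpha>. Var \<alpha> \<^bold>\<in> Var z \<^bold>\<longrightarrow> Var \<alpha> \<^bold>\<in> Var a) \<^bold>\<longrightarrow>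
       (\<^bold>\<exists>\<^sub>O\<xi>. codes \<xi> \<^bold>\<and> (\<^bold>\<forall>\<^sub>O\<zeta>. codes \<zeta> \<^bold>\<longrightarrow> Var \<zeta> \<^bold>= Var \<xi>)))"

definition SO :: "so_fm set" where
  "SO = {ax_SOR, ax_WO, ax_INF, ax_EXT, ax_INI, ax_BOU, ax_GPF, ax_SUR, ax_POW}
     \<union> {ax_SEP n \<phi> | n \<phi>. wf_fm L_SO \<phi> \<and> fv \<phi> \<subseteq> {0} \<union> {3..<3 + n}}
     \<union> {ax_REP n \<phi> | n \<phi>. wf_fm L_SO \<phi> \<and> fv \<phi> \<subseteq> {0, 1} \<union> {6..<6 + n}}"

section \<open>The theory ZFC\<close>

datatype set_rel = InR

type_synonym set_tm = "unit tm"
type_synonym set_fm = "(unit, set_rel) fm"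

definition L_Set :: "(unit, set_rel) language" where
  "L_Set = \<lparr> fun_arity = (\<lambda>_. None), rel_arity = (\<lambda>_. Some 2) \<rparr>"

abbreviation In :: "nat \<Rightarrow> nat \<Rightarrow> set_fm" (infix "\<^bold>\<epsilon>" 50) where "x \<^bold>\<epsilon> y \<equiv> Rel InR [Var x, Var y]"
abbreviation EqV :: "nat \<Rightarrow> nat \<Rightarrow> set_fm" (infix "\<^bold>\<equiv>" 50) where "x \<^bold>\<equiv> y \<equiv> Var x \<^bold>= Var y"

definition Extensionality :: set_fm where
  "Extensionality = (let x = 0; y = 1; z = 2 in
     \<^bold>\<forall>x. \<^bold>\<forall>y. (\<^bold>\<forall>z. z \<^bold>\<epsilon> x \<^bold>\<longleftrightarrow> z \<^bold>\<epsilon> y) \<^bold>\<longrightarrow> x \<^bold>\<equiv> y)"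

definition Foundation :: set_fm where
  "Foundation = (let x = 0; y = 1; z = 2 in
     \<^bold>\<forall>x. (\<^bold>\<exists>y. y \<^bold>\<epsilon> x) \<^bold>\<longrightarrow> (\<^bold>\<exists>y. y \<^bold>\<epsilon> x \<^bold>\<and> \<^bold>\<not> (\<^bold>\<exists>z. z \<^bold>\<epsilon> x \<^bold>\<and> z \<^bold>\<epsilon> y)))"

definition Pairing :: set_fm where
  "Pairing = (let x = 0; y = 1; z = 2; w = 3 in
     \<^bold>\<forall>x. \<^bold>\<forall>y. \<^bold>\<exists>z. \<^bold>\<forall>w. w \<^bold>\<epsilon> z \<^bold>\<longleftrightarrow> w \<^bold>\<equiv> x \<^bold>\<or> w \<^bold>\<equiv> y)"

definition Unions :: set_fm where
  "Unions = (let x = 0; y = 1; z = 2; u = 3 in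
     \<^bold>\<forall>x. \<^bold>\<exists>u. \<^bold>\<forall>z. z \<^bold>\<epsilon> u \<^bold>\<longleftrightarrow> (\<^bold>\<exists>y. y \<^bold>\<epsilon> x \<^bold>\<and> z \<^bold>\<epsilon> y))"

definition Powerset :: set_fm where
  "Powerset = (let x = 0; y = 1; z = 2; w = 3 in
     \<^bold>\<forall>x. \<^bold>\<exists>y. \<^bold>\<forall>z. z \<^bold>\<epsilon> y \<^bold>\<longleftrightarrow> (\<^bold>\<forall>w. w \<^bold>\<epsilon> z \<^bold>\<longrightarrow> w \<^bold>\<epsilon> x))"

definition Infinity :: set_fm where
  "Infinity = (let x = 0; y = 1; z = 2; w = 3 in
     \<^bold>\<exists>x. (\<^bold>\<exists>y. y \<^bold>\<epsilon> x \<^bold>\<and> (\<^bold>\<forall>z. \<^bold>\<not> z \<^bold>\<epsilon> y)) \<^bold>\<and>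
       (\<^bold>\<forall>y. y \<^bold>\<epsilon> x \<^bold>\<longrightarrow> (\<^bold>\<exists>z. z \<^bold>\<epsilon> x \<^bold>\<and> (\<^bold>\<forall>w. w \<^bold>\<epsilon> z \<^bold>\<longleftrightarrow> w \<^bold>\<epsilon> y \<^bold>\<or> w \<^bold>\<equiv> y))))"

text \<open>Every set of nonempty pairwise disjoint sets has a transversal.\<close>

definition Choice :: set_fm where
  "Choice = (let x = 0; y = 1; z = 2; w = 3; c = 4 in
     \<^bold>\<forall>x. (\<^bold>\<forall>y. y \<^bold>\<epsilon> x \<^bold>\<longrightarrow> (\<^bold>\<exists>w. w \<^bold>\<epsilon> y)) \<^bold>\<and>
         (\<^bold>\<forall>y. \<^bold>\<forall>z. y \<^bold>\<epsilon> x \<^bold>\<and> z \<^bold>\<epsilon> x \<^bold>\<and> \<^bold>\<not> y \<^bold>\<equiv> z \<^bold>\<longrightarrow> \<^bold>\<not> (\<^bold>\<exists>w. w \<^bold>\<epsilon> y \<^bold>\<and> w \<^bold>\<epsilon> z)) \<^bold>\<longrightarrow>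
       (\<^bold>\<exists>c. \<^bold>\<forall>y. y \<^bold>\<epsilon> x \<^bold>\<longrightarrow> (\<^bold>\<exists>z. \<^bold>\<forall>w. w \<^bold>\<epsilon> c \<^bold>\<and> w \<^bold>\<epsilon> y \<^bold>\<longleftrightarrow> w \<^bold>\<equiv> z)))"

definition Separation :: "nat \<Rightarrow> set_fm \<Rightarrow> set_fm" where
  "Separation n \<phi> = (let x = 0; a = 1; b = 2 in
     alls [3..<3 + n] (\<^bold>\<forall>a. \<^bold>\<exists>b. \<^bold>\<forall>x. x \<^bold>\<epsilon> b \<^bold>\<longleftrightarrow> x \<^bold>\<epsilon> a \<^bold>\<and> \<phi>))"

definition Replacement :: "nat \<Rightarrow> set_fm \<Rightarrow> set_fm" where
  "Replacement n \<phi> = (let x = 0; y = 1; u = 2; v = 3; a = 4; b = 5 in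
     alls [6..<6 + n]
       ((\<^bold>\<forall>x. \<^bold>\<forall>u. \<^bold>\<forall>v. app \<phi> [x, u] \<^bold>\<and> app \<phi> [x, v] \<^bold>\<longrightarrow> u \<^bold>\<equiv> v) \<^bold>\<longrightarrow>
        (\<^bold>\<forall>a. \<^bold>\<exists>b. \<^bold>\<forall>y. y \<^bold>\<epsilon> b \<^bold>\<longleftrightarrow> (\<^bold>\<exists>x. x \<^bold>\<epsilon> a \<^bold>\<and> app \<phi> [x, y]))))"

definition ZFC :: "set_fm set" where
  "ZFC = {Extensionality, Foundation, Pairing, Unions, Powerset, Infinity, Choice}
     \<union> {Separation n \<phi> | n \<phi>. wf_fm L_Set \<phi> \<and> fv \<phi> \<subseteq> {0} \<union> {3..<3 + n}}
     \<union> {Replacement n \<phi> | n \<phi>. wf_fm L_Set \<phi> \<and> fv \<phi> \<subseteq> {0, 1} \<union> {6..<6 + n}}"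

section \<open>Both theories consist of sentences of their languages\<close>

lemma wf_app: "wf_fm L p \<Longrightarrow> wf_fm L (app p xs)"
  by (simp add: app_def wf_subst_fm)

lemma fv_app2:
  assumes "fv p \<subseteq> {0, 1} \<union> P"
  shows "fv (app p [x, y]) \<subseteq> {x, y} \<union> P"
proof -
  have "fv_tm (if i < length [x, y] then Var ([x, y] ! i) else Var i) \<subseteq> {x, y} \<union> P"
    if "i \<in> fv p" for i
    using assms that by (cases i; cases "i - 1") auto
  then show ?thesis by (auto simp: app_def fv_subst_fm)
qed

lemmas SO_axiom_defs = ax_SOR_def ax_WO_def ax_INF_def ax_EXT_def ax_INI_def ax_BOU_def
  ax_GPF_def ax_SUR_def ax_SEP_def ax_REP_def ax_POW_def

lemmas ZFC_axiom_defs = Extensionality_def Foundation_def Pairing_def Unions_def Powerset_def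
  Infinity_def Choice_def Separation_def Replacement_def

lemma fv_ax_REP:
  assumes "fv \<phi> \<subseteq> {0, 1} \<union> {6..<6 + n}"
  shows "fv (ax_REP n \<phi>) = {}"
  using fv_app2[OF assms, of 0 1] fv_app2[OF assms, of 0 2] fv_app2[OF assms, of 0 3]
  by (fastforce simp: ax_REP_def Let_def fv_alls simp del: fv.simps(5))

lemma fv_Replacement:
  assumes "fv \<phi> \<subseteq> {0, 1} \<union> {6..<6 + n}"
  shows "fv (Replacement n \<phi>) = {}"
  using fv_app2[OF assms, of 0 1] fv_app2[OF assms, of 0 2] fv_app2[OF assms, of 0 3]
  by (fastforce simp: Replacement_def Let_def fv_alls simp del: fv.simps(5))

lemma wf_SO: "\<psi> \<in> SO \<Longrightarrow> wf_fm L_SO \<psi>"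
  by (auto simp: SO_def SO_axiom_defs Let_def pair_less_def is_max_def L_SO_def wf_bind wf_alls
      wf_app)

lemma fv_SO:
  assumes "\<psi> \<in> SO"
  shows "fv \<psi> = {}"
proof -
  consider "\<psi> \<in> {ax_SOR, ax_WO, ax_INF, ax_EXT, ax_INI, ax_BOU, ax_GPF, ax_SUR, ax_POW}"
    | n \<phi> where "\<psi> = ax_SEP n \<phi>" "fv \<phi> \<subseteq> {0} \<union> {3..<3 + n}"
    | n \<phi> where "\<psi> = ax_REP n \<phi>" "fv \<phi> \<subseteq> {0, 1} \<union> {6..<6 + n}"
    using assms unfolding SO_def by blast
  then show ?thesis
  proof cases
    case 1
    then show ?thesis
      by (auto simp: SO_axiom_defs Let_def pair_less_def is_max_def simp del: fv.simps(5))
  next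
    case 2
    then show ?thesis
      by (fastforce simp: ax_SEP_def Let_def fv_alls simp del: fv.simps(5))
  next
    case 3
    then show ?thesis by (simp only: fv_ax_REP)
  qed
qed

lemma wf_ZFC: "\<psi> \<in> ZFC \<Longrightarrow> wf_fm L_Set \<psi>"
  by (auto simp: ZFC_def ZFC_axiom_defs Let_def L_Set_def wf_bind wf_alls wf_app)

lemma fv_ZFC:
  assumes "\<psi> \<in> ZFC"
  shows "fv \<psi> = {}"
proof -
  consider "\<psi> \<in> {Extensionality, Foundation, Pairing, Unions, Powerset, Infinity, Choice}"
    | n \<phi> where "\<psi> = Separation n \<phi>" "fv \<phi> \<subseteq> {0} \<union> {3..<3 + n}"
    | n \<phi> where "\<psi> = Replacement n \<phi>" "fv \<phi> \<subseteq> {0, 1} \<union> {6..<6 + n}"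
    using assms unfolding ZFC_def by blast
  then show ?thesis
  proof cases
    case 1
    then show ?thesis by (auto simp: ZFC_axiom_defs Let_def simp del: fv.simps(5))
  next
    case 2
    then show ?thesis
      by (fastforce simp: Separation_def Let_def fv_alls simp del: fv.simps(5))
  next
    case 3
    then show ?thesis by (simp only: fv_Replacement)
  qed
qed

end

theory Submission
  imports Defs "HOL-Library.Countable_Set"
begin

text \<open>By completeness it suffices to interpret ZFC uniformly in every model of SO. There, a set is
  coded by a set of ordinals, read through the pairing \<open>G\<close> as a well-founded graph on the ordinals
  together with some marked nodes: each node denotes the set of what its predecessors denote, and
  the code denotes the set of what its marked nodes denote. Equality of the denoted sets is
  bisimilarity. Changing the marks of a code gives Separation and Choice. By POW, the graphs
  below a bound can be amalgamated into one graph, so every definable class of sets that all have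
  codes below one ordinal is a set; this gives Pairing, Union, Power Set and, with REP bounding the
  least codes of the values, Replacement.\<close>

section \<open>Structures\<close>

text \<open>No deduction in SO is written out. Truth of the translated axioms is checked in HOL,
  which calls for models over one fixed type: universe \<open>nat\<close>, with identity as
  equality. INF makes the quotient of the term model infinite, so that it can be moved there.
  Structures carry their own equality \<open>eqr\<close> because two of them do not interpret it as
  identity: the term model, where it is membership of the equation in a maximal consistent set, and
  the structure of codes, where it is bisimilarity.

  SO speaks only of ordinals and sets of ordinals. Bisimilarity is therefore an existential
  statement about sets of pairs, and no rank or collapse is computed by recursion. A set can have
  many codes and none is selected as canonical; an ordinal bound on a code takes the place of a
  selection. Elements and subsets of a set coded below \<open>k\<close> have codes below
  \<open>g k k\<close>, uniformly in the element or subset. For Replacement, the least bound of a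
  code of a value is an ordinal that depends only on the node denoting the argument, so REP applies
  to it although the given relation is functional only up to bisimilarity.\<close>

record ('f, 'r, 'a) struc =
  dom :: "'a set"
  eqr :: "'a \<Rightarrow> 'a \<Rightarrow> bool"
  fn :: "'f \<Rightarrow> 'a list \<Rightarrow> 'a"
  rl :: "'r \<Rightarrow> 'a list \<Rightarrow> bool"

primrec val :: "('f, 'r, 'a) struc \<Rightarrow> (nat \<Rightarrow> 'a) \<Rightarrow> 'f tm \<Rightarrow> 'a" where
  "val M e (Var n) = e n"
| "val M e (Fun f ts) = fn M f (map (val M e) ts)"

primrec sat :: "('f, 'r, 'a) struc \<Rightarrow> (nat \<Rightarrow> 'a) \<Rightarrow> ('f, 'r) fm \<Rightarrow> bool" where
  "sat M e Bot \<longleftrightarrow> False"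
| "sat M e (s \<^bold>= t) \<longleftrightarrow> eqr M (val M e s) (val M e t)"
| "sat M e (Rel r ts) \<longleftrightarrow> rl M r (map (val M e) ts)"
| "sat M e (p \<^bold>\<longrightarrow> q) \<longleftrightarrow> (sat M e p \<longrightarrow> sat M e q)"
| "sat M e (Forall p) \<longleftrightarrow> (\<forall>x\<in>dom M. sat M (case_nat x e) p)"

lemma val_subst: "val M e (subst_tm \<sigma> t) = val M (\<lambda>i. val M e (\<sigma> i)) t"
  by (induction t) (auto simp: comp_def cong: map_cong)

lemma val_up: "(\<lambda>i. val M (case_nat x e) (up \<sigma> i)) = case_nat x (\<lambda>i. val M e (\<sigma> i))"
proof
  show "val M (case_nat x e) (up \<sigma> i) = case_nat x (\<lambda>i. val M e (\<sigma> i)) i" for i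
    by (cases i) (simp_all add: up_def val_subst)
qed

lemma sat_subst: "sat M e (subst_fm \<sigma> p) \<longleftrightarrow> sat M (\<lambda>i. val M e (\<sigma> i)) p"
  by (induction p arbitrary: e \<sigma>) (auto simp: val_subst val_up comp_def cong: map_cong)

text \<open>Quantifying over a name amounts to updating the environment at that name, so named
  formulas are evaluated without index shifts.\<close>

lemma sat_bind [simp]: "sat M (case_nat v e) (bind x p) \<longleftrightarrow> sat M (e(x := v)) p"
proof -
  have "(\<lambda>i. val M (case_nat v e) (if i = x then Var 0 else Var (Suc i))) = e(x := v)"
    by auto
  then show ?thesis by (simp add: bind_def sat_subst)
qed

text \<open>To be used as introduction rules: the connectives on the right determine how the formula on
  the left, in which the derived connectives are abbreviations, is decomposed.\<close>

lemma sat_iffs: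
  "sat M e p \<longleftrightarrow> P \<Longrightarrow> sat M e (\<^bold>\<not> p) \<longleftrightarrow> \<not> P"
  "sat M e p \<longleftrightarrow> P \<Longrightarrow> sat M e q \<longleftrightarrow> Q \<Longrightarrow> sat M e (p \<^bold>\<longrightarrow> q) \<longleftrightarrow> (P \<longrightarrow> Q)"
  "sat M e p \<longleftrightarrow> P \<Longrightarrow> sat M e q \<longleftrightarrow> Q \<Longrightarrow> sat M e (p \<^bold>\<or> q) \<longleftrightarrow> P \<or> Q"
  "sat M e p \<longleftrightarrow> P \<Longrightarrow> sat M e q \<longleftrightarrow> Q \<Longrightarrow> sat M e (p \<^bold>\<and> q) \<longleftrightarrow> P \<and> Q"
  "sat M e p \<longleftrightarrow> P \<Longrightarrow> sat M e q \<longleftrightarrow> Q \<Longrightarrow> sat M e (p \<^bold>\<longleftrightarrow> q) \<longleftrightarrow> (P \<longleftrightarrow> Q)"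
  "(\<And>v. v \<in> dom M \<Longrightarrow> sat M (e(x := v)) p \<longleftrightarrow> R v) \<Longrightarrow> sat M e (\<^bold>\<forall>x. p) \<longleftrightarrow> (\<forall>v\<in>dom M. R v)"
  "(\<And>v. v \<in> dom M \<Longrightarrow> sat M (e(x := v)) p \<longleftrightarrow> R v) \<Longrightarrow> sat M e (\<^bold>\<exists>x. p) \<longleftrightarrow> (\<exists>v\<in>dom M. R v)"
  by auto

lemma sat_app: "sat M e (app p xs) \<longleftrightarrow> sat M (\<lambda>i. if i < length xs then e (xs ! i) else e i) p"
proof -
  have "(\<lambda>i. val M e (if i < length xs then Var (xs ! i) else Var i))
      = (\<lambda>i. if i < length xs then e (xs ! i) else e i)"
    by auto
  then show ?thesis by (simp add: app_def sat_subst)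
qed

text \<open>A schema instance has an arbitrary number of parameters, so its prefix is read as one
  quantifier over environments that differ only on \<open>xs\<close>.\<close>

lemma sat_alls:
  "sat M e (alls xs p) \<longleftrightarrow>
    (\<forall>e'. (\<forall>i. i \<notin> set xs \<longrightarrow> e' i = e i) \<and> (\<forall>i\<in>set xs. e' i \<in> dom M) \<longrightarrow> sat M e' p)"
proof (induction xs arbitrary: e)
  case Nil
  have "e' = e" if "\<forall>i. e' i = e i" for e' using that by auto
  then show ?case by (auto simp: alls_def)
next
  case (Cons x xs)
  have "sat M e (alls (x # xs) p) \<longleftrightarrow> (\<forall>v\<in>dom M. sat M (e(x := v)) (alls xs p))"
    by (simp add: alls_def)
  also have "\<dots> \<longleftrightarrow> (\<forall>e'. (\<forall>i. i \<notin> set (x # xs) \<longrightarrow> e' i = e i) \<and>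
      (\<forall>i\<in>set (x # xs). e' i \<in> dom M) \<longrightarrow> sat M e' p)" (is "?l = ?r")
  proof
    assume l: ?l
    show ?r
    proof (intro allI impI, elim conjE)
      fix e' assume *: "\<forall>i. i \<notin> set (x # xs) \<longrightarrow> e' i = e i" "\<forall>i\<in>set (x # xs). e' i \<in> dom M"
      then have "sat M (e(x := e' x)) (alls xs p)" using l by auto
      then show "sat M e' p" unfolding Cons.IH using * by auto
    qed
  next
    assume r: ?r
    show ?l unfolding Cons.IH
    proof (intro ballI allI impI, elim conjE)
      fix v e' assume v: "v \<in> dom M" and "\<forall>i. i \<notin> set xs \<longrightarrow> e' i = (e(x := v)) i"
        "\<forall>i\<in>set xs. e' i \<in> dom M"
      then show "sat M e' p" by (intro r[rule_format]) (auto split: if_splits)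
    qed
  qed
  finally show ?case .
qed

lemma sat_allsD: "sat M e (alls xs p) \<Longrightarrow> range e \<subseteq> dom M \<Longrightarrow> sat M e p"
  by (simp add: sat_alls image_subset_iff)

lemma val_cong: "(\<And>i. i \<in> fv_tm t \<Longrightarrow> e i = e' i) \<Longrightarrow> val M e t = val M e' t"
proof (induction t)
  case (Fun f ts)
  have "map (val M e) ts = map (val M e') ts" using Fun by (intro map_cong) auto
  then show ?case by (simp del: map_eq_conv)
qed simp

lemma sat_cong: "(\<And>i. i \<in> fv p \<Longrightarrow> e i = e' i) \<Longrightarrow> sat M e p \<longleftrightarrow> sat M e' p"
proof (induction p arbitrary: e e')
  case (Eq s t)
  then have "val M e s = val M e' s" "val M e t = val M e' t" by (auto intro!: val_cong)
  then show ?case by simp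
next
  case (Rel r ts)
  then have "map (val M e) ts = map (val M e') ts" by (auto intro!: val_cong)
  then show ?case by (simp del: map_eq_conv)
next
  case (Imp p q)
  have "sat M e p \<longleftrightarrow> sat M e' p" by (rule Imp.IH) (simp add: Imp.prems)
  moreover have "sat M e q \<longleftrightarrow> sat M e' q" by (rule Imp.IH) (simp add: Imp.prems)
  ultimately show ?case by simp
next
  case (Forall p)
  have "sat M (case_nat x e) p \<longleftrightarrow> sat M (case_nat x e') p" for x
    using Forall.prems by (intro Forall.IH) (auto split: nat.split)
  then show ?case by simp
qed simp

lemma finite_fv_tm: "finite (fv_tm t)"
  by (induction t) auto

lemma finite_fv: "finite (fv p)"
proof (induction p)
  case (Forall p)
  have "{n. Suc n \<in> fv p} = Suc -` fv p" by auto
  then show ?case using Forall by (simp add: finite_vimageI)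
qed (auto simp: finite_fv_tm)

text \<open>Such an \<open>h\<close> behaves like a quotient map: all that a quantifier of
  \<open>N\<close> ranges over is an image. It carries the term model to its quotient in
  \<open>countermodel\<close>.\<close>

lemma sat_hom:
  assumes h: "h ` dom M = dom N"
    and eqr: "\<And>a b. a \<in> dom M \<Longrightarrow> b \<in> dom M \<Longrightarrow> eqr N (h a) (h b) \<longleftrightarrow> eqr M a b"
    and fn: "\<And>f as. set as \<subseteq> dom M \<Longrightarrow> fun_arity L f = Some (length as) \<Longrightarrow>
      fn M f as \<in> dom M \<and> h (fn M f as) = fn N f (map h as)"
    and rl: "\<And>r as. set as \<subseteq> dom M \<Longrightarrow> rel_arity L r = Some (length as) \<Longrightarrow>
      rl N r (map h as) \<longleftrightarrow> rl M r as"
  shows "wf_fm L p \<Longrightarrow> range e \<subseteq> dom M \<Longrightarrow> sat N (\<lambda>i. h (e i)) p \<longleftrightarrow> sat M e p"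
proof -
  have val: "val M e t \<in> dom M \<and> h (val M e t) = val N (\<lambda>i. h (e i)) t"
    if "wf_tm L t" "range e \<subseteq> dom M" for e t
    using that
  proof (induction t)
    case (Fun f ts)
    have *: "val M e t \<in> dom M \<and> h (val M e t) = val N (\<lambda>i. h (e i)) t" if "t \<in> set ts" for t
      using Fun.prems that by (intro Fun.IH) (auto simp: list_all_iff)
    have "set (map (val M e) ts) \<subseteq> dom M" using * by auto
    moreover have "map h (map (val M e) ts) = map (val N (\<lambda>i. h (e i))) ts"
      unfolding map_map using * by (intro map_cong) auto
    ultimately show ?case using fn[of "map (val M e) ts" f] Fun.prems by (simp del: map_map map_eq_conv)
  qed auto
  show "wf_fm L p \<Longrightarrow> range e \<subseteq> dom M \<Longrightarrow> sat N (\<lambda>i. h (e i)) p \<longleftrightarrow> sat M e p"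
  proof (induction p arbitrary: e)
    case (Eq s t)
    then show ?case using val[of s e] val[of t e] eqr[of "val M e s" "val M e t"] by simp
  next
    case (Rel r ts)
    then have "set (map (val M e) ts) \<subseteq> dom M" "map h (map (val M e) ts) = map (val N (\<lambda>i. h (e i))) ts"
      using val by (auto simp: list_all_iff)
    then show ?case using rl[of "map (val M e) ts" r] Rel.prems by (simp del: map_map map_eq_conv)
  next
    case (Forall p)
    have "sat N (case_nat (h x) (\<lambda>i. h (e i))) p \<longleftrightarrow> sat M (case_nat x e) p" if "x \<in> dom M" for x
    proof -
      have "case_nat (h x) (\<lambda>i. h (e i)) = (\<lambda>i. h (case_nat x e i))" by (auto split: nat.split)
      moreover have "range (case_nat x e) \<subseteq> dom M" using Forall.prems that by (auto simp: image_subset_iff split: nat.split)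
      ultimately show ?thesis using Forall by simp
    qed
    then show ?case by (simp flip: h)
  next
    case (Imp p q)
    then show ?case by (simp add: Imp.IH)
  next
    case Bot
    then show ?case by simp
  qed
qed

section \<open>Completeness\<close>

lemma subst_tm_Var [simp]: "subst_tm Var t = t"
  by (induction t) (auto simp: map_idI)

lemma up_Var [simp]: "up Var = Var"
  by (auto simp: up_def fun_eq_iff split: nat.split)

lemma subst_fm_Var [simp]: "subst_fm Var p = p"
  by (induction p) (auto simp: map_idI)

lemma subst_tm_cong: "(\<And>i. i \<in> fv_tm t \<Longrightarrow> \<sigma> i = \<tau> i) \<Longrightarrow> subst_tm \<sigma> t = subst_tm \<tau> t"
  by (induction t) auto

lemma subst_fm_cong: "(\<And>i. i \<in> fv p \<Longrightarrow> \<sigma> i = \<tau> i) \<Longrightarrow> subst_fm \<sigma> p = subst_fm \<tau> p"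
proof (induction p arbitrary: \<sigma> \<tau>)
  case (Eq s t)
  then show ?case by (auto intro!: subst_tm_cong)
next
  case (Rel r ts)
  then show ?case by (auto intro!: subst_tm_cong)
next
  case (Forall p)
  have "up \<sigma> i = up \<tau> i" if "i \<in> fv p" for i
    using Forall.prems that by (auto simp: up_def split: nat.split)
  then show ?case by (simp add: Forall.IH[of "up \<sigma>" "up \<tau>"])
next
  case (Imp p q)
  have "subst_fm \<sigma> p = subst_fm \<tau> p" by (rule Imp.IH) (simp add: Imp.prems)
  moreover have "subst_fm \<sigma> q = subst_fm \<tau> q" by (rule Imp.IH) (simp add: Imp.prems)
  ultimately show ?case by simp
qed simp

lemma subst_lift: "subst_fm (up \<sigma>) (lift p) = lift (subst_fm \<sigma> p)"
  by (simp add: lift_def subst_fm_subst_fm up_def)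

lemma subst_inst: "subst_fm \<sigma> (inst t p) = inst (subst_tm \<sigma> t) (subst_fm (up \<sigma>) p)"
proof -
  have "subst_tm \<sigma> (case_nat t Var i) = subst_tm (case_nat (subst_tm \<sigma> t) Var) (up \<sigma> i)" for i
    by (cases i) (simp_all add: up_def subst_tm_subst_tm)
  then show ?thesis by (simp add: inst_def subst_fm_subst_fm)
qed

lemma inst_subst_up: "inst t (subst_fm (up \<sigma>) p) = subst_fm (case_nat t \<sigma>) p"
proof -
  have "subst_tm (case_nat t Var) (up \<sigma> i) = case_nat t \<sigma> i" for i
    by (cases i) (simp_all add: up_def subst_tm_subst_tm)
  then show ?thesis by (simp add: inst_def subst_fm_subst_fm)
qed

section \<open>Admissible rules of the calculus\<close>

lemma proves_mono: "L, \<Gamma> \<turnstile> p \<Longrightarrow> \<Gamma> \<subseteq> \<Delta> \<Longrightarrow> L, \<Delta> \<turnstile> p"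
proof (induction arbitrary: \<Delta> rule: proves.induct)
  case (ImpI p \<Gamma> q)
  then show ?case by (meson insert_mono proves.ImpI)
next
  case (BotE p \<Gamma>)
  then show ?case by (meson insert_mono proves.BotE)
next
  case (ForallI \<Gamma> p)
  then show ?case by (meson image_mono proves.ForallI)
next
  case (EqE \<Gamma> s t p)
  show ?case by (rule proves.EqE[OF EqE.IH[OF EqE.prems]])
qed (auto intro: proves.intros(1,3,6,7))

lemma proves_subst:
  "L, \<Gamma> \<turnstile> p \<Longrightarrow> (\<And>i. wf_tm L (\<sigma> i)) \<Longrightarrow> L, subst_fm \<sigma> ` \<Gamma> \<turnstile> subst_fm \<sigma> p"
proof (induction arbitrary: \<sigma> rule: proves.induct)
  case (ImpI p \<Gamma> q)
  then show ?case by (auto intro: proves.ImpI wf_subst_fm)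
next
  case (ImpE \<Gamma> p q)
  then show ?case by (auto intro: proves.ImpE)
next
  case (BotE p \<Gamma>)
  then show ?case by (auto intro: proves.BotE wf_subst_fm)
next
  case (ForallI \<Gamma> p)
  have "wf_tm L (up \<sigma> i)" for i
    using ForallI.prems by (cases i) (auto simp: up_def intro: wf_subst_tm)
  then have "L, subst_fm (up \<sigma>) ` lift ` \<Gamma> \<turnstile> subst_fm (up \<sigma>) p" by (rule ForallI.IH)
  then show ?case by (simp add: image_image subst_lift proves.ForallI)
next
  case (ForallE \<Gamma> p t)
  then show ?case using proves.ForallE[of L "subst_fm \<sigma> ` \<Gamma>"] by (simp add: subst_inst wf_subst_tm)
next
  case (EqE \<Gamma> s t p)
  then have "L, subst_fm \<sigma> ` \<Gamma> \<turnstile> subst_tm \<sigma> s \<^bold>= subst_tm \<sigma> t"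
    "L, subst_fm \<sigma> ` \<Gamma> \<turnstile> inst (subst_tm \<sigma> s) (subst_fm (up \<sigma>) p)"
    by (auto simp: subst_inst)
  then show ?case unfolding subst_inst by (rule proves.EqE)
qed (auto intro: proves.intros wf_subst_tm)

text \<open>Derivations are finite, so the contexts of the premises can be thinned and joined. This
  carries consistency from the Henkin stages to their union.\<close>

lemma proves_finite: "L, \<Gamma> \<turnstile> p \<Longrightarrow> \<exists>\<Delta>. finite \<Delta> \<and> \<Delta> \<subseteq> \<Gamma> \<and> (L, \<Delta> \<turnstile> p)"
proof (induction rule: proves.induct)
  case (Assm p \<Gamma>)
  then show ?case by (intro exI[of _ "{p}"]) (auto intro: proves.Assm)
next
  case (ImpI p \<Gamma> q)
  then obtain \<Delta> where \<Delta>: "finite \<Delta>" "\<Delta> \<subseteq> insert p \<Gamma>" "L, \<Delta> \<turnstile> q" by blast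
  then have "L, insert p (\<Delta> - {p}) \<turnstile> q" by (auto elim: proves_mono)
  then show ?case using \<Delta> ImpI.hyps by (intro exI[of _ "\<Delta> - {p}"]) (auto intro: proves.ImpI)
next
  case (ImpE \<Gamma> p q)
  then obtain \<Delta>1 \<Delta>2 where "finite \<Delta>1" "\<Delta>1 \<subseteq> \<Gamma>" "L, \<Delta>1 \<turnstile> (p \<^bold>\<longrightarrow> q)" "finite \<Delta>2" "\<Delta>2 \<subseteq> \<Gamma>" "L, \<Delta>2 \<turnstile> p"
    by blast
  then show ?case
    by (intro exI[of _ "\<Delta>1 \<union> \<Delta>2"]) (auto intro: proves.ImpE proves_mono)
next
  case (BotE p \<Gamma>)
  then obtain \<Delta> where \<Delta>: "finite \<Delta>" "\<Delta> \<subseteq> insert (\<^bold>\<not> p) \<Gamma>" "L, \<Delta> \<turnstile> Bot" by blast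
  then have "L, insert (\<^bold>\<not> p) (\<Delta> - {\<^bold>\<not> p}) \<turnstile> Bot" by (auto elim: proves_mono)
  then show ?case using \<Delta> BotE.hyps by (intro exI[of _ "\<Delta> - {\<^bold>\<not> p}"]) (auto intro: proves.BotE)
next
  case (ForallI \<Gamma> p)
  then obtain \<Delta> where "finite \<Delta>" "\<Delta> \<subseteq> lift ` \<Gamma>" "L, \<Delta> \<turnstile> p" by blast
  then show ?case by (metis finite_subset_image proves.ForallI)
next
  case (ForallE \<Gamma> p t)
  then show ?case by (metis proves.ForallE)
next
  case (EqI t \<Gamma>)
  then show ?case by (intro exI[of _ "{}"]) (auto intro: proves.EqI)
next
  case (EqE \<Gamma> s t p)
  then obtain \<Delta>1 \<Delta>2 where "finite \<Delta>1" "\<Delta>1 \<subseteq> \<Gamma>" "L, \<Delta>1 \<turnstile> (s \<^bold>= t)" "finite \<Delta>2" "\<Delta>2 \<subseteq> \<Gamma>" "L, \<Delta>2 \<turnstile> inst s p"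
    by blast
  then show ?case
    by (intro exI[of _ "\<Delta>1 \<union> \<Delta>2"]) (auto intro: proves.EqE proves_mono)
qed

text \<open>\<open>ForallI\<close> shifts the context instead of asking for an eigenvariable. The
  renaming that sends \<open>n\<close> to 0 and shifts all other variables acts on
  \<open>\<Gamma>\<close> as \<open>lift\<close>, since \<open>n\<close> is not free there, and
  turns the instance back into \<open>p\<close>.\<close>

lemma proves_generalize:
  assumes "L, \<Gamma> \<turnstile> inst (Var n) p" and \<Gamma>: "\<And>q. q \<in> \<Gamma> \<Longrightarrow> n \<notin> fv q" and p: "n \<notin> fv (Forall p)"
  shows "L, \<Gamma> \<turnstile> Forall p"
proof -
  define \<rho> :: "nat \<Rightarrow> 'a tm" where "\<rho> = (\<lambda>i. if i = n then Var 0 else Var (Suc i))"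
  have "L, subst_fm \<rho> ` \<Gamma> \<turnstile> subst_fm \<rho> (inst (Var n) p)"
    using assms(1) by (rule proves_subst) (simp add: \<rho>_def)
  moreover have "subst_fm \<rho> q = lift q" if "q \<in> \<Gamma>" for q
    unfolding lift_def using \<Gamma>[OF that] by (intro subst_fm_cong) (auto simp: \<rho>_def)
  then have "subst_fm \<rho> ` \<Gamma> = lift ` \<Gamma>" by simp
  moreover have "subst_fm \<rho> (inst (Var n) p) = p"
  proof -
    have "subst_fm \<rho> (inst (Var n) p) = subst_fm Var p"
      unfolding inst_def subst_fm_subst_fm using p
      by (intro subst_fm_cong) (auto simp: \<rho>_def split: nat.split)
    then show ?thesis by simp
  qed
  ultimately show ?thesis by (simp add: proves.ForallI)
qed

section \<open>Henkin sets\<close>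

instance tm :: (countable) countable by countable_datatype
instance fm :: (countable, countable) countable by countable_datatype

text \<open>Witnesses are variables, not new constants. Finitely many variables occur free at the
  start and each stage adds at most two formulas, so a fresh variable always exists.\<close>

locale henkin =
  fixes L :: "('f::countable, 'r::countable) language" and \<Gamma> :: "('f, 'r) fm set"
  assumes con: "\<not> (L, \<Gamma> \<turnstile> Bot)" and fin: "finite (\<Union> (fv ` \<Gamma>))"
begin

definition fresh_var :: "('f, 'r) fm set \<Rightarrow> nat" where
  "fresh_var S = (SOME n. \<forall>q\<in>S. n \<notin> fv q)"

definition witness :: "('f, 'r) fm \<Rightarrow> ('f, 'r) fm set \<Rightarrow> ('f, 'r) fm set" where
  "witness q S = (case q of (Forall p) \<^bold>\<longrightarrow> Bot \<Rightarrow> insert (\<^bold>\<not> inst (Var (fresh_var S)) p) S | _ \<Rightarrow> S)"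

text \<open>Maximality and witnesses are obtained in one pass over an enumeration of all formulas:
  \<open>q\<close> is decided at stage \<open>Suc (to_nat q)\<close>.\<close>

primrec ext :: "nat \<Rightarrow> ('f, 'r) fm set" where
  "ext 0 = \<Gamma>"
| "ext (Suc n) = (let q = from_nat n in
     if wf_fm L q \<and> \<not> (L, insert q (ext n) \<turnstile> Bot) then witness q (insert q (ext n)) else ext n)"

definition H :: "('f, 'r) fm set" where "H = (\<Union>n. ext n)"

lemma witness_mono: "S \<subseteq> witness q S"
  by (auto simp: witness_def split: fm.split)

lemma fin_witness:
  assumes "finite (\<Union> (fv ` S))" shows "finite (\<Union> (fv ` witness q S))"
proof -
  have "witness q S = S \<or> (\<exists>p. witness q S = insert p S)"
    by (auto simp: witness_def split: fm.split)
  then show ?thesis using assms by (auto simp: finite_fv)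
qed

lemma fin_ext: "finite (\<Union> (fv ` ext n))"
proof (induction n)
  case (Suc n)
  then have "finite (\<Union> (fv ` insert q (ext n)))" for q by (simp add: finite_fv)
  then show ?case using Suc fin_witness by (auto simp: Let_def simp del: UN_insert Union_image_insert)
qed (simp add: fin)

lemma fresh_var:
  assumes "finite (\<Union> (fv ` S))" "q \<in> S" shows "fresh_var S \<notin> fv q"
proof -
  obtain n where "n \<notin> \<Union> (fv ` S)" using assms(1) by (metis ex_new_if_finite infinite_UNIV_nat)
  then have "\<forall>q\<in>S. n \<notin> fv q" by blast
  then show ?thesis unfolding fresh_var_def using assms(2) someI[of "\<lambda>n. \<forall>q\<in>S. n \<notin> fv q" n] by blast
qed

text \<open>If the witness caused an inconsistency, \<open>BotE\<close> would derive the instance at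
  a fresh variable, hence \<open>Forall p\<close>, whose negation is in \<open>S\<close>.\<close>

lemma con_witness:
  assumes S: "\<not> (L, S \<turnstile> Bot)" "finite (\<Union> (fv ` S))" and q: "q \<in> S" "wf_fm L q"
  shows "\<not> (L, witness q S \<turnstile> Bot)"
proof
  assume bot: "L, witness q S \<turnstile> Bot"
  then have "witness q S \<noteq> S" using S by auto
  then obtain p where p: "q = (\<^bold>\<not> Forall p)"
    by (auto simp: witness_def split: fm.splits)
  let ?n = "fresh_var S"
  have "L, insert (\<^bold>\<not> inst (Var ?n) p) S \<turnstile> Bot" using bot by (simp add: witness_def p)
  moreover have "wf_fm L (inst (Var ?n) p)"
    using q p by (auto simp: inst_def intro!: wf_subst_fm split: nat.split)
  ultimately have "L, S \<turnstile> inst (Var ?n) p" by (rule proves.BotE)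
  then have "L, S \<turnstile> Forall p"
    using fresh_var[OF S(2)] fresh_var[OF S(2) q(1)] p by (intro proves_generalize) auto
  moreover have "L, S \<turnstile> \<^bold>\<not> Forall p" using q p by (auto intro: proves.Assm)
  ultimately have "L, S \<turnstile> Bot" by (meson proves.ImpE)
  then show False using S by simp
qed

lemma con_ext: "\<not> (L, ext n \<turnstile> Bot)"
proof (induction n)
  case (Suc n)
  then show ?case
    using con_witness[of "insert (from_nat n) (ext n)" "from_nat n"] fin_ext[of n]
    by (auto simp: Let_def finite_fv)
qed (simp add: con)

lemma ext_mono: "m \<le> n \<Longrightarrow> ext m \<subseteq> ext n"
proof (rule lift_Suc_mono_le)
  show "ext n \<subseteq> ext (Suc n)" for n
    using witness_mono[of "insert (from_nat n) (ext n)" "from_nat n"] by (auto simp: Let_def)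
qed

lemma con_H: "\<not> (L, H \<turnstile> Bot)"
proof
  assume "L, H \<turnstile> Bot"
  from proves_finite[OF this] obtain \<Delta> where \<Delta>: "finite \<Delta>" "\<Delta> \<subseteq> H" "L, \<Delta> \<turnstile> Bot" by blast
  have "\<exists>n. \<Delta> \<subseteq> ext n" using \<Delta>(1,2)
  proof (induction)
    case (insert q \<Delta>)
    then obtain n m where "\<Delta> \<subseteq> ext n" "q \<in> ext m" by (auto simp: H_def)
    then have "insert q \<Delta> \<subseteq> ext (max n m)"
      using ext_mono[of n "max n m"] ext_mono[of m "max n m"] by auto
    then show ?case by blast
  qed simp
  then show False using con_ext \<Delta>(3) proves_mono by blast
qed

lemma \<Gamma>_H: "\<Gamma> \<subseteq> H"
  unfolding H_def by (metis UNIV_I UN_upper ext.simps(1))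

lemma ext_Suc_H: "ext n \<subseteq> H"
  by (auto simp: H_def)

text \<open>At its own stage \<open>q\<close> is tested only against a subset of \<open>H\<close>,
  so the test succeeds.\<close>

lemma H_insert:
  assumes "wf_fm L q" "\<not> (L, insert q H \<turnstile> Bot)" shows "q \<in> H"
proof -
  have "\<not> (L, insert q (ext (to_nat q)) \<turnstile> Bot)"
    using assms(2) proves_mono[of L "insert q (ext (to_nat q))" Bot "insert q H"] ext_Suc_H by blast
  then have "q \<in> ext (Suc (to_nat q))"
    using assms(1) witness_mono[of "insert q (ext (to_nat q))" q] by (simp add: Let_def)
  then show ?thesis using ext_Suc_H by blast
qed

lemma H_closed:
  assumes "wf_fm L q" "L, H \<turnstile> q" shows "q \<in> H"
proof (rule H_insert[OF assms(1)])
  show "\<not> (L, insert q H \<turnstile> Bot)"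
    using con_H assms by (meson proves.ImpE proves.ImpI)
qed

lemma H_neg: "wf_fm L q \<Longrightarrow> (\<^bold>\<not> q) \<in> H \<longleftrightarrow> q \<notin> H"
proof
  assume "wf_fm L q" "q \<notin> H"
  then have "L, insert q H \<turnstile> Bot" using H_insert by blast
  then have "L, H \<turnstile> \<^bold>\<not> q" using \<open>wf_fm L q\<close> by (rule proves.ImpI)
  then show "(\<^bold>\<not> q) \<in> H" using \<open>wf_fm L q\<close> by (intro H_closed) auto
next
  assume "(\<^bold>\<not> q) \<in> H"
  then show "q \<notin> H" using con_H by (meson proves.Assm proves.ImpE)
qed

lemma H_imp:
  assumes "wf_fm L p" "wf_fm L q" shows "(p \<^bold>\<longrightarrow> q) \<in> H \<longleftrightarrow> (p \<in> H \<longrightarrow> q \<in> H)"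
proof
  assume "(p \<^bold>\<longrightarrow> q) \<in> H"
  then show "p \<in> H \<longrightarrow> q \<in> H" using assms by (meson H_closed proves.Assm proves.ImpE)
next
  assume "p \<in> H \<longrightarrow> q \<in> H"
  then consider "(\<^bold>\<not> p) \<in> H" | "q \<in> H" using H_neg assms by blast
  then have "L, insert p H \<turnstile> q"
  proof cases
    case 1
    then have "L, insert (\<^bold>\<not> q) (insert p H) \<turnstile> Bot" by (auto intro: proves.ImpE[of _ _ p] proves.Assm)
    then show ?thesis using assms by (auto intro: proves.BotE)
  qed (auto intro: proves.Assm)
  then show "(p \<^bold>\<longrightarrow> q) \<in> H" using assms by (intro H_closed) (auto intro: proves.ImpI)
qed

lemma H_Forall:
  assumes "wf_fm L p" shows "Forall p \<in> H \<longleftrightarrow> (\<forall>t. wf_tm L t \<longrightarrow> inst t p \<in> H)"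
proof
  assume "Forall p \<in> H"
  show "\<forall>t. wf_tm L t \<longrightarrow> inst t p \<in> H"
  proof (intro allI impI)
    fix t assume t: "wf_tm L t"
    have "L, H \<turnstile> inst t p" using \<open>Forall p \<in> H\<close> t by (intro proves.ForallE proves.Assm)
    moreover have "wf_fm L (inst t p)"
      unfolding inst_def using assms t by (intro wf_subst_fm) (auto split: nat.split)
    ultimately show "inst t p \<in> H" by (intro H_closed)
  qed
next
  assume inst: "\<forall>t. wf_tm L t \<longrightarrow> inst t p \<in> H"
  show "Forall p \<in> H"
  proof (rule ccontr)
    let ?q = "\<^bold>\<not> Forall p"
    assume "Forall p \<notin> H"
    then have q: "?q \<in> H" using assms H_neg[of "Forall p"] by simp
    \<comment> \<open>Being in \<open>H\<close>, the negation is consistent with the stage at which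
      it is tested, so its witness was added there.\<close>
    let ?S = "insert ?q (ext (to_nat ?q))"
    have "?S \<subseteq> H" using ext_Suc_H q by auto
    then have "\<not> (L, ?S \<turnstile> Bot)" using con_H proves_mono by blast
    then have "ext (Suc (to_nat ?q)) = witness ?q ?S" using assms by (simp add: Let_def)
    then have "(\<^bold>\<not> inst (Var (fresh_var ?S)) p) \<in> H"
      using ext_Suc_H[of "Suc (to_nat ?q)"] by (auto simp: witness_def)
    moreover have "inst (Var (fresh_var ?S)) p \<in> H" using inst by simp
    ultimately show False using con_H by (meson proves.Assm proves.ImpE)
  qed
qed

section \<open>The term model\<close>

definition term_struc :: "('f, 'r, 'f tm) struc" where
  "term_struc = \<lparr>dom = {t. wf_tm L t}, eqr = (\<lambda>s t. (s \<^bold>= t) \<in> H), fn = Fun, rl = (\<lambda>r ts. Rel r ts \<in> H)\<rparr>"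

lemma val_term: "val term_struc e t = subst_tm e t"
  by (induction t) (auto simp: term_struc_def cong: map_cong)

text \<open>Environments of the term model are substitutions. The universal case rests on the
  witnesses, through \<open>H_Forall\<close>.\<close>

lemma sat_term: "wf_fm L p \<Longrightarrow> (\<And>i. wf_tm L (e i)) \<Longrightarrow> sat term_struc e p \<longleftrightarrow> subst_fm e p \<in> H"
proof (induction p arbitrary: e)
  case Bot
  then show ?case using con_H by (auto intro: proves.Assm)
next
  case (Eq s t)
  then show ?case by (simp add: val_term) (simp add: term_struc_def)
next
  case (Rel r ts)
  then show ?case by (simp add: val_term cong: map_cong) (simp add: term_struc_def)
next
  case (Imp p q)
  then show ?case by (simp add: H_imp wf_subst_fm)
next
  case (Forall p)
  have up: "wf_tm L (up e i)" for i
    using Forall.prems by (cases i) (auto simp: up_def intro: wf_subst_tm)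
  have "sat term_struc (case_nat t e) p \<longleftrightarrow> inst t (subst_fm (up e) p) \<in> H" if "wf_tm L t" for t
    unfolding inst_subst_up using Forall that by (auto split: nat.split)
  then have "sat term_struc e (Forall p) \<longleftrightarrow> (\<forall>t. wf_tm L t \<longrightarrow> inst t (subst_fm (up e) p) \<in> H)"
    by (auto simp: term_struc_def)
  then show ?case using Forall.prems up by (simp add: H_Forall wf_subst_fm)
qed

definition lift_tm :: "'f tm \<Rightarrow> 'f tm" where "lift_tm = subst_tm (\<lambda>i. Var (Suc i))"

lemma inst_lift_tm [simp]: "subst_tm (case_nat t Var) (lift_tm s) = s"
  by (simp add: lift_tm_def subst_tm_subst_tm)

lemma H_Eq_refl: "wf_tm L t \<Longrightarrow> (t \<^bold>= t) \<in> H"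
  by (auto intro: H_closed proves.EqI)

lemma H_EqE: "(s \<^bold>= t) \<in> H \<Longrightarrow> inst s p \<in> H \<Longrightarrow> wf_fm L (inst t p) \<Longrightarrow> inst t p \<in> H"
  by (meson H_closed proves.Assm proves.EqE)

lemma H_Eq_sym: "(s \<^bold>= t) \<in> H \<Longrightarrow> wf_tm L s \<Longrightarrow> wf_tm L t \<Longrightarrow> (t \<^bold>= s) \<in> H"
  using H_EqE[of s t "Var 0 \<^bold>= lift_tm s"] H_Eq_refl[of s] by (simp add: inst_def)

lemma H_Eq_trans: "(s \<^bold>= t) \<in> H \<Longrightarrow> (t \<^bold>= u) \<in> H \<Longrightarrow> wf_tm L s \<Longrightarrow> wf_tm L u \<Longrightarrow> (s \<^bold>= u) \<in> H"
  using H_EqE[of t u "lift_tm s \<^bold>= Var 0"] by (simp add: inst_def)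

text \<open>\<open>EqE\<close> replaces one term at a time: \<open>us\<close> holds the arguments
  already replaced, and the terms around the hole \<open>Var 0\<close> are lifted past it.\<close>

lemma H_Rel_cong:
  assumes "list_all2 (\<lambda>s t. (s \<^bold>= t) \<in> H) ss ts" "Rel r (us @ ss) \<in> H"
    "rel_arity L r = Some (length us + length ss)" "list_all (wf_tm L) (us @ ss @ ts)"
  shows "Rel r (us @ ts) \<in> H"
  using assms
proof (induction ss ts arbitrary: us rule: list_all2_induct)
  case (Cons s ss t ts)
  have "Rel r (us @ t # ss) \<in> H"
    using H_EqE[of s t "Rel r (map lift_tm us @ Var 0 # map lift_tm ss)"] Cons
    by (simp add: inst_def comp_def)
  then show ?case using Cons.IH[of "us @ [t]"] Cons.prems by simp
qed simp

lemma H_Fun_cong: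
  assumes "list_all2 (\<lambda>s t. (s \<^bold>= t) \<in> H) ss ts" "(v \<^bold>= Fun f (us @ ss)) \<in> H"
    "fun_arity L f = Some (length us + length ss)" "list_all (wf_tm L) (v # us @ ss @ ts)"
  shows "(v \<^bold>= Fun f (us @ ts)) \<in> H"
  using assms
proof (induction ss ts arbitrary: us rule: list_all2_induct)
  case (Cons s ss t ts)
  have "(v \<^bold>= Fun f (us @ t # ss)) \<in> H"
    using H_EqE[of s t "lift_tm v \<^bold>= Fun f (map lift_tm us @ Var 0 # map lift_tm ss)"] Cons
    by (simp add: inst_def comp_def)
  then show ?case using Cons.IH[of "us @ [t]"] Cons.prems by simp
qed simp

end

text \<open>The term model is countable; if it has infinitely many elements up to equality, it can be
  moved to the type of natural numbers, with equality interpreted as identity.\<close>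

theorem countermodel:
  fixes L :: "('f::countable, 'r::countable) language"
  assumes \<Gamma>: "\<And>q. q \<in> \<Gamma> \<Longrightarrow> wf_fm L q \<and> fv q = {}" and p: "wf_fm L p" and np: "\<not> (L, \<Gamma> \<turnstile> p)"
    and inf: "\<And>M :: ('f, 'r, 'f tm) struc. dom M \<noteq> {} \<Longrightarrow> (\<And>q e. q \<in> \<Gamma> \<Longrightarrow> range e \<subseteq> dom M \<Longrightarrow> sat M e q) \<Longrightarrow>
      (\<And>r ss ts. set ss \<union> set ts \<subseteq> dom M \<Longrightarrow> list_all2 (eqr M) ss ts \<Longrightarrow>
         rel_arity L r = Some (length ss) \<Longrightarrow> rl M r ss \<Longrightarrow> rl M r ts) \<Longrightarrow>
      \<exists>s :: nat \<Rightarrow> 'f tm. range s \<subseteq> dom M \<and> (\<forall>i j. i < j \<longrightarrow> \<not> eqr M (s i) (s j))"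
  obtains N :: "('f, 'r, nat) struc" and e where
    "dom N = UNIV" "eqr N = (=)" "\<And>q e. q \<in> \<Gamma> \<Longrightarrow> sat N e q" "\<not> sat N e p"
proof -
  have "\<Union> (fv ` insert (\<^bold>\<not> p) \<Gamma>) \<subseteq> fv p" using \<Gamma> by auto
  then have fin: "finite (\<Union> (fv ` insert (\<^bold>\<not> p) \<Gamma>))" using finite_fv finite_subset by blast
  interpret henkin L "insert (\<^bold>\<not> p) \<Gamma>"
    using np p fin by unfold_locales (auto intro: proves.BotE)
  let ?M = term_struc
  have dom: "dom ?M = {t. wf_tm L t}" and eqr: "eqr ?M s t \<longleftrightarrow> (s \<^bold>= t) \<in> H" for s t
    by (simp_all add: term_struc_def)
  have sat_\<Gamma>: "sat ?M e q" if "q \<in> \<Gamma>" "range e \<subseteq> dom ?M" for q e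
  proof -
    have "subst_fm e q = subst_fm Var q" using \<Gamma>[OF that(1)] by (intro subst_fm_cong) auto
    then have "subst_fm e q \<in> H" using \<Gamma>_H that by auto
    then show ?thesis using that \<Gamma> by (subst sat_term) (auto simp: dom)
  qed
  have rel_cong: "rl ?M r ts" if "set ss \<union> set ts \<subseteq> dom ?M" "list_all2 (eqr ?M) ss ts"
    "rel_arity L r = Some (length ss)" "rl ?M r ss" for r ss ts
    using H_Rel_cong[of ss ts r "[]"] that by (auto simp: term_struc_def list_all_iff)
  have "dom ?M \<noteq> {}" using wf_tm.simps(1)[of L 0] unfolding dom by blast
  then have "\<exists>s :: nat \<Rightarrow> 'f tm. range s \<subseteq> dom ?M \<and> (\<forall>i j. i < j \<longrightarrow> \<not> eqr ?M (s i) (s j))"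
  proof (rule inf)
    show "sat ?M e q" if "q \<in> \<Gamma>" "range e \<subseteq> dom ?M" for q e using that by (rule sat_\<Gamma>)
    show "rl ?M r ts" if "set ss \<union> set ts \<subseteq> dom ?M" "list_all2 (eqr ?M) ss ts"
      "rel_arity L r = Some (length ss)" "rl ?M r ss" for r ss ts using that by (rule rel_cong)
  qed
  then obtain s :: "nat \<Rightarrow> 'f tm" where s: "range s \<subseteq> dom ?M" "\<And>i j. i < j \<Longrightarrow> \<not> eqr ?M (s i) (s j)"
    by auto
  \<comment> \<open>Classes of equal terms. They form a countable, infinite set, which gives the
    bijection with the natural numbers.\<close>
  define cl where "cl t = {u. wf_tm L u \<and> (t \<^bold>= u) \<in> H}" for t
  have cl: "cl t = cl u \<longleftrightarrow> (t \<^bold>= u) \<in> H" if "wf_tm L t" "wf_tm L u" for t u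
    using that unfolding cl_def by (auto dest: H_Eq_sym H_Eq_trans intro: H_Eq_refl)
  have "inj (cl \<circ> s)"
  proof (rule linorder_injI)
    fix i j :: nat assume "i < j"
    then show "(cl \<circ> s) i \<noteq> (cl \<circ> s) j"
      using s(1) s(2)[of i j] cl[of "s i" "s j"] by (simp add: dom eqr image_subset_iff)
  qed
  then have "infinite (range (cl \<circ> s))" by (rule range_inj_infinite)
  moreover have "range (cl \<circ> s) \<subseteq> cl ` dom ?M" using s by auto
  ultimately have "infinite (cl ` dom ?M)" using finite_subset by blast
  then have bij: "bij_betw (to_nat_on (cl ` dom ?M)) (cl ` dom ?M) UNIV"
    by (intro to_nat_on_infinite) auto
  define h where "h = to_nat_on (cl ` dom ?M) \<circ> cl"
  have h_eq: "h t = h u \<longleftrightarrow> (t \<^bold>= u) \<in> H" if "t \<in> dom ?M" "u \<in> dom ?M" for t u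
    using that cl[of t u] bij by (auto simp: h_def dom bij_betw_def inj_on_eq_iff)
  have h_surj: "h ` dom ?M = UNIV"
    using bij by (auto simp: h_def bij_betw_def image_comp)
  define g where "g = inv_into (dom ?M) h"
  have g: "g n \<in> dom ?M" "h (g n) = n" for n
    unfolding g_def using h_surj by (auto intro: inv_into_into f_inv_into_f)
  have gh: "list_all2 (\<lambda>s t. (s \<^bold>= t) \<in> H) ts (map (g \<circ> h) ts)"
    "list_all2 (\<lambda>s t. (s \<^bold>= t) \<in> H) (map (g \<circ> h) ts) ts" if "set ts \<subseteq> dom ?M" for ts
    using that g h_eq by (auto simp: list_all2_conv_all_nth subset_iff simp flip: h_eq)
  \<comment> \<open>Functions and relations act on the representatives chosen by \<open>g\<close>;
    by \<open>gh\<close> and the congruence lemmas other representatives would give the same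
    result.\<close>
  define N where "N = \<lparr>dom = UNIV :: nat set, eqr = (=), fn = (\<lambda>f ns. h (Fun f (map g ns))),
    rl = (\<lambda>r ns. Rel r (map g ns) \<in> H)\<rparr>"
  have hom: "sat N (\<lambda>i. h (e i)) q \<longleftrightarrow> sat ?M e q" if q: "wf_fm L q" and e: "range e \<subseteq> dom ?M" for q e
  proof (rule sat_hom[OF _ _ _ _ q e])
    show "h ` dom ?M = dom N" by (simp add: N_def h_surj)
    show "eqr N (h a) (h b) \<longleftrightarrow> eqr ?M a b" if "a \<in> dom ?M" "b \<in> dom ?M" for a b
      using that h_eq by (simp add: N_def eqr)
    show "fn ?M f as \<in> dom ?M \<and> h (fn ?M f as) = fn N f (map h as)"
      if as: "set as \<subseteq> dom ?M" "fun_arity L f = Some (length as)" for f as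
    proof -
      have wf: "list_all (wf_tm L) as" "list_all (wf_tm L) (map (g \<circ> h) as)"
        using as g by (auto simp: dom list_all_iff)
      then have F: "wf_tm L (Fun f as)" "wf_tm L (Fun f (map (g \<circ> h) as))" using as(2) by auto
      have "(Fun f as \<^bold>= Fun f (map (g \<circ> h) as)) \<in> H"
        using H_Fun_cong[of as "map (g \<circ> h) as" "Fun f as" f "[]"] gh[OF as(1)] H_Eq_refl[OF F(1)] as(2) wf
        by simp
      then show ?thesis using F h_eq by (simp add: N_def term_struc_def)
    qed
    show "rl N r (map h as) \<longleftrightarrow> rl ?M r as"
      if as: "set as \<subseteq> dom ?M" "rel_arity L r = Some (length as)" for r as
    proof -
      have wf: "list_all (wf_tm L) as" "list_all (wf_tm L) (map (g \<circ> h) as)"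
        using as g by (auto simp: dom list_all_iff)
      show ?thesis
        using H_Rel_cong[of as "map (g \<circ> h) as" r "[]"] H_Rel_cong[of "map (g \<circ> h) as" as r "[]"]
          gh[OF as(1)] as(2) wf by (auto simp: N_def term_struc_def)
    qed
  qed
  show ?thesis
  proof (rule that)
    show "dom N = UNIV" "eqr N = (=)" by (simp_all add: N_def)
    show "sat N e q" if "q \<in> \<Gamma>" for q e
    proof -
      show ?thesis
        using hom[of q "\<lambda>i. g (e i)"] sat_\<Gamma>[of q "\<lambda>i. g (e i)"] g \<Gamma> that by (simp add: image_subset_iff)
    qed
    have "subst_fm Var p \<notin> H" using \<Gamma>_H H_neg[OF p] by auto
    then have "\<not> sat ?M Var p" using sat_term[OF p, of Var] by simp
    then show "\<not> sat N (\<lambda>i. h (Var i)) p" using hom[OF p, of Var] by (simp add: dom image_subset_iff)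
  qed
qed

section \<open>Models of SO\<close>

text \<open>With the whole type as domain and identity as equality, the axioms become HOL statements
  with plain quantifiers.\<close>

locale so_model =
  fixes M :: "(so_fun, so_rel, 'a) struc"
  assumes dom [simp]: "dom M = UNIV" and eqr [simp]: "eqr M = (=)"
    and sat_SO: "\<And>\<psi> e. \<psi> \<in> SO \<Longrightarrow> sat M e \<psi>"
begin

definition ord :: "'a \<Rightarrow> bool" where "ord x \<longleftrightarrow> rl M OrdR [x]"
definition sord :: "'a \<Rightarrow> bool" where "sord x \<longleftrightarrow> rl M SOrdR [x]"
definition lt :: "'a \<Rightarrow> 'a \<Rightarrow> bool" (infix "\<prec>" 50) where "x \<prec> y \<longleftrightarrow> rl M LessR [x, y]"
definition mem :: "'a \<Rightarrow> 'a \<Rightarrow> bool" (infix "\<in>\<^sub>o" 50) where "x \<in>\<^sub>o y \<longleftrightarrow> rl M MemR [x, y]"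
definition g :: "'a \<Rightarrow> 'a \<Rightarrow> 'a" where "g x y = fn M GP [x, y]"

lemmas folds = ord_def [symmetric] sord_def [symmetric] lt_def [symmetric] mem_def [symmetric]
  g_def [symmetric]

abbreviation le :: "'a \<Rightarrow> 'a \<Rightarrow> bool" (infix "\<preceq>" 50) where "x \<preceq> y \<equiv> x \<prec> y \<or> x = y"

subsection \<open>Definable predicates\<close>

text \<open>Parameters occupy the odd variables, so that formulas with different parameters can be
  combined.\<close>

definition mrg :: "(nat \<Rightarrow> 'a) \<Rightarrow> (nat \<Rightarrow> 'a) \<Rightarrow> nat \<Rightarrow> 'a" where
  "mrg e p i = (if even i then e (i div 2) else p (i div 2))"

text \<open>Definability with parameters, for predicates of whole environments: the closure rules
  then follow the shape of a HOL formula and need no arities.\<close>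

definition dfn :: "((nat \<Rightarrow> 'a) \<Rightarrow> bool) \<Rightarrow> bool" where
  "dfn P \<longleftrightarrow> (\<exists>\<phi> p. wf_fm L_SO \<phi> \<and> (\<forall>e. P e \<longleftrightarrow> sat M (mrg e p) \<phi>))"

definition dft :: "((nat \<Rightarrow> 'a) \<Rightarrow> 'a) \<Rightarrow> bool" where
  "dft t \<longleftrightarrow> (\<exists>s p. wf_tm L_SO s \<and> (\<forall>e. t e = val M (mrg e p) s))"

text \<open>Sends parameter \<open>j\<close> to parameter \<open>2 * j + k\<close>, where
  \<open>mrg p q\<close> keeps the parameters of \<open>p\<close> (\<open>k = 0\<close>) or of
  \<open>q\<close> (\<open>k = 1\<close>).\<close>

definition ren :: "nat \<Rightarrow> nat \<Rightarrow> so_tm" where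
  "ren k i = (if even i then Var i else Var (2 * (2 * (i div 2) + k) + 1))"

lemma mrg_ren:
  "(\<lambda>i. val M (mrg e (mrg p q)) (ren 0 i)) = mrg e p"
  "(\<lambda>i. val M (mrg e (mrg p q)) (ren (Suc 0) i)) = mrg e q"
  by (auto simp: mrg_def ren_def fun_eq_iff elim!: oddE)

lemma wf_ren: "wf_tm L (ren k i)"
  by (simp add: ren_def)

lemma dft_var: "dft (\<lambda>e. e i)"
  unfolding dft_def by (rule exI[of _ "Var (2 * i)"]) (simp add: mrg_def)

lemma dft_const: "dft (\<lambda>e. c)"
  unfolding dft_def by (rule exI[of _ "Var 1"], rule exI[of _ "\<lambda>_. c"]) (simp add: mrg_def)

lemma dft_common:
  assumes "dft t" "dft u"
  obtains s1 s2 p where "wf_tm L_SO s1" "wf_tm L_SO s2"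
    "\<And>e. t e = val M (mrg e p) s1" "\<And>e. u e = val M (mrg e p) s2"
proof -
  from assms obtain s1 p1 s2 p2 where "wf_tm L_SO s1" "wf_tm L_SO s2"
    "\<And>e. t e = val M (mrg e p1) s1" "\<And>e. u e = val M (mrg e p2) s2"
    unfolding dft_def by blast
  then show ?thesis
    by (intro that[of "subst_tm (ren 0) s1" "subst_tm (ren (Suc 0)) s2" "mrg p1 p2"])
      (simp_all add: val_subst mrg_ren wf_subst_tm wf_ren)
qed

lemma dfn_common:
  assumes "dfn P" "dfn Q"
  obtains \<phi> \<psi> p where "wf_fm L_SO \<phi>" "wf_fm L_SO \<psi>"
    "\<And>e. P e \<longleftrightarrow> sat M (mrg e p) \<phi>" "\<And>e. Q e \<longleftrightarrow> sat M (mrg e p) \<psi>"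
proof -
  from assms obtain \<phi> p1 \<psi> p2 where "wf_fm L_SO \<phi>" "wf_fm L_SO \<psi>"
    "\<And>e. P e \<longleftrightarrow> sat M (mrg e p1) \<phi>" "\<And>e. Q e \<longleftrightarrow> sat M (mrg e p2) \<psi>"
    unfolding dfn_def by blast
  then show ?thesis
    by (intro that[of "subst_fm (ren 0) \<phi>" "subst_fm (ren (Suc 0)) \<psi>" "mrg p1 p2"])
      (simp_all add: sat_subst mrg_ren wf_subst_fm wf_ren)
qed

lemma dft_g:
  assumes "dft t" "dft u" shows "dft (\<lambda>e. g (t e) (u e))"
proof -
  obtain s1 s2 p where "wf_tm L_SO s1" "wf_tm L_SO s2"
    "\<And>e. t e = val M (mrg e p) s1" "\<And>e. u e = val M (mrg e p) s2"
    by (rule dft_common[OF assms], rule that)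
  then show ?thesis unfolding dft_def
    by (intro exI[of _ "Fun GP [s1, s2]"] exI[of _ p]) (simp add: g_def L_SO_def)
qed

lemma dfn_atoms:
  assumes "dft t" "dft u"
  shows "dfn (\<lambda>e. t e = u e)" "dfn (\<lambda>e. t e \<prec> u e)" "dfn (\<lambda>e. t e \<in>\<^sub>o u e)"
    "dfn (\<lambda>e. ord (t e))" "dfn (\<lambda>e. sord (t e))"
proof -
  obtain s1 s2 p where *: "wf_tm L_SO s1" "wf_tm L_SO s2"
    "\<And>e. t e = val M (mrg e p) s1" "\<And>e. u e = val M (mrg e p) s2"
    by (rule dft_common[OF assms], rule that)
  have rel: "dfn (\<lambda>e. rl M r [t e, u e])" if "r = LessR \<or> r = MemR" for r
    unfolding dfn_def using * that
    by (intro exI[of _ "Rel r [s1, s2]"] exI[of _ p]) (auto simp: L_SO_def)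
  show "dfn (\<lambda>e. t e \<prec> u e)" "dfn (\<lambda>e. t e \<in>\<^sub>o u e)"
    unfolding lt_def mem_def by (auto intro: rel)
  have rel: "dfn (\<lambda>e. rl M r [t e])" if "r = OrdR \<or> r = SOrdR" for r
    unfolding dfn_def using * that
    by (intro exI[of _ "Rel r [s1]"] exI[of _ p]) (auto simp: L_SO_def)
  show "dfn (\<lambda>e. ord (t e))" "dfn (\<lambda>e. sord (t e))"
    unfolding ord_def sord_def by (auto intro: rel)
  show "dfn (\<lambda>e. t e = u e)"
    unfolding dfn_def using * by (intro exI[of _ "s1 \<^bold>= s2"] exI[of _ p]) auto
qed

lemma dfn_False: "dfn (\<lambda>e. False)"
  unfolding dfn_def by (rule exI[of _ Bot]) simp

lemma dfn_imp:
  assumes "dfn P" "dfn Q" shows "dfn (\<lambda>e. P e \<longrightarrow> Q e)"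
proof -
  obtain \<phi> \<psi> p where "wf_fm L_SO \<phi>" "wf_fm L_SO \<psi>"
    "\<And>e. P e \<longleftrightarrow> sat M (mrg e p) \<phi>" "\<And>e. Q e \<longleftrightarrow> sat M (mrg e p) \<psi>"
    by (rule dfn_common[OF assms], rule that)
  then show ?thesis unfolding dfn_def by (intro exI[of _ "\<phi> \<^bold>\<longrightarrow> \<psi>"] exI[of _ p]) simp
qed

lemma dfn_not: "dfn P \<Longrightarrow> dfn (\<lambda>e. \<not> P e)"
  using dfn_imp[OF _ dfn_False] by simp

lemma dfn_or: "dfn P \<Longrightarrow> dfn Q \<Longrightarrow> dfn (\<lambda>e. P e \<or> Q e)"
  using dfn_imp[OF dfn_not, of P Q] by (simp add: disj_imp)

lemma dfn_and: "dfn P \<Longrightarrow> dfn Q \<Longrightarrow> dfn (\<lambda>e. P e \<and> Q e)"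
  using dfn_not[OF dfn_imp[OF _ dfn_not], of P Q] by simp

lemma dfn_iff: "dfn P \<Longrightarrow> dfn Q \<Longrightarrow> dfn (\<lambda>e. P e \<longleftrightarrow> Q e)"
  using dfn_and[OF dfn_imp[of P Q] dfn_imp[of Q P]] by (simp add: iff_conv_conj_imp)

lemma dfn_all:
  assumes "dfn (\<lambda>e. P (e 0) (\<lambda>i. e (Suc i)))" shows "dfn (\<lambda>e. \<forall>x. P x e)"
proof -
  obtain \<phi> p where \<phi>: "wf_fm L_SO \<phi>" "\<And>e. P (e 0) (\<lambda>i. e (Suc i)) \<longleftrightarrow> sat M (mrg e p) \<phi>"
    using assms unfolding dfn_def by blast
  \<comment> \<open>Below the quantifier all of \<open>mrg e p\<close> is shifted up by one. Object
    variables also move down one place, that is two indices, which leaves \<open>i - 1\<close>;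
    parameters keep their place and become \<open>i + 1\<close>.\<close>
  define \<rho> :: "nat \<Rightarrow> so_tm" where "\<rho> = (\<lambda>i. if i = 0 then Var 0 else if even i then Var (i - 1) else Var (i + 1))"
  have "mrg (case_nat x e) p i = val M (case_nat x (mrg e p)) (\<rho> i)" for x e i
  proof (cases "even i")
    case True
    then obtain k where "i = 2 * k" by blast
    then show ?thesis by (cases k) (auto simp: mrg_def \<rho>_def)
  next
    case False
    then obtain k where "i = 2 * k + 1" using oddE by blast
    then show ?thesis by (auto simp: mrg_def \<rho>_def)
  qed
  then have "(\<lambda>i. val M (case_nat x (mrg e p)) (\<rho> i)) = mrg (case_nat x e) p" for x e
    by (simp add: fun_eq_iff)
  then have "sat M (case_nat x (mrg e p)) (subst_fm \<rho> \<phi>) \<longleftrightarrow> P x e" for x e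
    using \<phi>(2)[of "case_nat x e"] by (simp add: sat_subst)
  then show ?thesis unfolding dfn_def using \<phi>(1)
    by (intro exI[of _ "Forall (subst_fm \<rho> \<phi>)"] exI[of _ p]) (auto simp: \<rho>_def intro: wf_subst_fm)
qed

lemma dfn_ex: "dfn (\<lambda>e. P (e 0) (\<lambda>i. e (Suc i))) \<Longrightarrow> dfn (\<lambda>e. \<exists>x. P x e)"
  using dfn_not[OF dfn_all[of "\<lambda>x e. \<not> P x e"]] dfn_not[of "\<lambda>e. P (e 0) (\<lambda>i. e (Suc i))"] by simp

section \<open>Substituting terms into definable predicates\<close>

lemma dft_rename:
  assumes "dft t" shows "dft (\<lambda>e. t (\<lambda>i. e (f i)))"
proof -
  obtain s p where s: "wf_tm L_SO s" "\<And>e. t e = val M (mrg e p) s"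
    using assms unfolding dft_def by blast
  define \<rho> :: "nat \<Rightarrow> so_tm" where "\<rho> = (\<lambda>i. if even i then Var (2 * f (i div 2)) else Var i)"
  have "(\<lambda>i. val M (mrg e p) (\<rho> i)) = mrg (\<lambda>i. e (f i)) p" for e
    by (auto simp: mrg_def \<rho>_def)
  then show ?thesis unfolding dft_def using s
    by (intro exI[of _ "subst_tm \<rho> s"] exI[of _ p]) (auto simp: val_subst \<rho>_def intro: wf_subst_tm)
qed

text \<open>\<open>P\<close> at \<open>t\<close> is expressed as \<open>P\<close> at every
  \<open>x\<close> equal to \<open>t\<close>, so the closure rules replace a substitution into the
  formula.\<close>

lemma dfn_subst0:
  assumes "dfn P" "dft t" shows "dfn (\<lambda>e. P (case_nat (t e) e))"
proof -
  have "dfn (\<lambda>e. \<forall>x. x = t e \<longrightarrow> P (case_nat x e))"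
  proof (rule dfn_all, rule dfn_imp)
    show "dfn (\<lambda>e. e 0 = t (\<lambda>i. e (Suc i)))"
      by (rule dfn_atoms(1)[OF dft_var dft_rename[OF assms(2)]])
    have "case_nat (e 0) (\<lambda>i. e (Suc i)) = e" for e :: "nat \<Rightarrow> 'a" by (auto split: nat.split)
    then show "dfn (\<lambda>e. P (case_nat (e 0) (\<lambda>i. e (Suc i))))" using assms(1) by simp
  qed
  then show ?thesis by simp
qed

lemma dfn_subst:
  assumes "dfn P" "\<forall>t\<in>set ts. dft t" shows "dfn (\<lambda>e. P (foldr case_nat (map (\<lambda>t. t e) ts) e))"
  using assms
proof (induction ts arbitrary: P)
  case (Cons t ts)
  have shift: "foldr case_nat (map (\<lambda>t. t e) ts) e (i + length ts) = e i"
    for e :: "nat \<Rightarrow> 'a" and i and ts :: "((nat \<Rightarrow> 'a) \<Rightarrow> 'a) list"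
    by (induction ts) auto
  \<comment> \<open>The remaining terms will occupy the positions below \<open>length ts\<close>, so
    \<open>t\<close> is evaluated past them.\<close>
  have "dfn (\<lambda>e. P (case_nat (t (\<lambda>i. e (i + length ts))) e))"
    using dfn_subst0[OF Cons.prems(1) dft_rename[of t "\<lambda>i. i + length ts"]] Cons.prems(2) by simp
  then have "dfn (\<lambda>e. P (case_nat (t (\<lambda>i. (foldr case_nat (map (\<lambda>t. t e) ts) e) (i + length ts)))
      (foldr case_nat (map (\<lambda>t. t e) ts) e)))"
    using Cons.prems by (intro Cons.IH) auto
  then show ?case by (simp add: shift)
qed simp

text \<open>With this and the next three rules, definability of a new notion is checked on variables
  and transferred to arbitrary terms.\<close>

lemma dfn_subst1: "dfn (\<lambda>e. P (e 0)) \<Longrightarrow> dft a \<Longrightarrow> dfn (\<lambda>e. P (a e))"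
  using dfn_subst[of "\<lambda>e. P (e 0)" "[a]"] by simp

lemma dfn_subst2: "dfn (\<lambda>e. P (e 0) (e 1)) \<Longrightarrow> dft a \<Longrightarrow> dft b \<Longrightarrow> dfn (\<lambda>e. P (a e) (b e))"
  using dfn_subst[of "\<lambda>e. P (e 0) (e 1)" "[a, b]"] by simp

lemma dfn_subst3:
  "dfn (\<lambda>e. P (e 0) (e 1) (e 2)) \<Longrightarrow> dft a \<Longrightarrow> dft b \<Longrightarrow> dft c \<Longrightarrow> dfn (\<lambda>e. P (a e) (b e) (c e))"
  using dfn_subst[of "\<lambda>e. P (e 0) (e 1) (e 2)" "[a, b, c]"] by (simp add: numeral_2_eq_2)

lemma dfn_subst4:
  "dfn (\<lambda>e. P (e 0) (e 1) (e 2) (e 3)) \<Longrightarrow> dft a \<Longrightarrow> dft b \<Longrightarrow> dft c \<Longrightarrow> dft d \<Longrightarrow>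
    dfn (\<lambda>e. P (a e) (b e) (c e) (d e))"
  using dfn_subst[of "\<lambda>e. P (e 0) (e 1) (e 2) (e 3)" "[a, b, c, d]"]
  by (simp add: numeral_2_eq_2 numeral_3_eq_3)

lemmas dfn_intros = dft_var dft_const dft_g dfn_atoms(1-3) dfn_atoms(4,5)[OF _ dft_const[of undefined]]
  dfn_False dfn_imp dfn_not dfn_or dfn_and dfn_iff dfn_all dfn_ex

subsection \<open>The axioms\<close>

lemma sat_quant_iffs:
  "(\<And>v. sat M (e(x := v)) p \<longleftrightarrow> R v) \<Longrightarrow> sat M e (\<^bold>\<forall>x. p) \<longleftrightarrow> (\<forall>v. R v)"
  "(\<And>v. sat M (e(x := v)) p \<longleftrightarrow> R v) \<Longrightarrow> sat M e (\<^bold>\<exists>x. p) \<longleftrightarrow> (\<exists>v. R v)"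
  by simp_all

lemmas sat_SO_iffs = sat_iffs(1-5) sat_quant_iffs

lemma sat_axioms:
  "sat M e ax_SOR" "sat M e ax_WO" "sat M e ax_INF" "sat M e ax_EXT" "sat M e ax_INI"
  "sat M e ax_BOU" "sat M e ax_GPF" "sat M e ax_POW"
  by (intro sat_SO; simp add: SO_def)+

lemma SOR:
  "ord x \<longleftrightarrow> \<not> sord x" "x \<prec> y \<Longrightarrow> ord x \<and> ord y" "x \<in>\<^sub>o c \<Longrightarrow> ord x \<and> sord c" "ord (g x y)"
proof -
  have "sat M undefined ax_SOR \<longleftrightarrow> (\<forall>x y. (ord x \<longleftrightarrow> \<not> sord x) \<and> (x \<prec> y \<longrightarrow> ord x \<and> ord y) \<and>
      (x \<in>\<^sub>o y \<longrightarrow> ord x \<and> sord y) \<and> ord (g x y))"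
    unfolding ax_SOR_def Let_def by (intro sat_SO_iffs; simp add: folds)
  then show "ord x \<longleftrightarrow> \<not> sord x" "x \<prec> y \<Longrightarrow> ord x \<and> ord y" "x \<in>\<^sub>o c \<Longrightarrow> ord x \<and> sord c" "ord (g x y)"
    using sat_axioms(1) by blast+
qed

text \<open>Here and in the following axioms, guards \<open>ord\<close> and \<open>sord\<close>
  disappear where SOR derives them from \<open>\<prec>\<close> or membership.\<close>

lemma WO:
  "\<not> x \<prec> x" "x \<prec> y \<Longrightarrow> y \<prec> z \<Longrightarrow> x \<prec> z" "ord x \<Longrightarrow> ord y \<Longrightarrow> x \<prec> y \<or> x = y \<or> y \<prec> x"
  "z \<in>\<^sub>o c \<Longrightarrow> \<exists>x. x \<in>\<^sub>o c \<and> (\<forall>y. y \<prec> x \<longrightarrow> \<not> y \<in>\<^sub>o c)"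
proof -
  have "sat M undefined ax_WO \<longleftrightarrow>
    (\<forall>x. ord x \<longrightarrow> (\<forall>y. ord y \<longrightarrow> (\<forall>z. ord z \<longrightarrow>
      \<not> x \<prec> x \<and> (x \<prec> y \<and> y \<prec> z \<longrightarrow> x \<prec> z) \<and> (x \<prec> y \<or> x = y \<or> y \<prec> x)))) \<and>
    (\<forall>c. sord c \<longrightarrow> (\<exists>x. ord x \<and> x \<in>\<^sub>o c) \<longrightarrow>
      (\<exists>x. ord x \<and> x \<in>\<^sub>o c \<and> (\<forall>y. ord y \<longrightarrow> y \<prec> x \<longrightarrow> \<not> y \<in>\<^sub>o c)))"
    unfolding ax_WO_def Let_def by (intro sat_SO_iffs; simp add: folds)
  note * = this[THEN iffD1, OF sat_axioms(2)]
  show "\<not> x \<prec> x" "x \<prec> y \<Longrightarrow> y \<prec> z \<Longrightarrow> x \<prec> z" "ord x \<Longrightarrow> ord y \<Longrightarrow> x \<prec> y \<or> x = y \<or> y \<prec> x"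
    using *[THEN conjunct1] SOR(2) by meson+
  show "z \<in>\<^sub>o c \<Longrightarrow> \<exists>x. x \<in>\<^sub>o c \<and> (\<forall>y. y \<prec> x \<longrightarrow> \<not> y \<in>\<^sub>o c)"
    using *[THEN conjunct2] SOR(2,3) by meson
qed

lemma INF: "\<exists>l. (\<exists>x. x \<prec> l) \<and> (\<forall>x. x \<prec> l \<longrightarrow> (\<exists>y. x \<prec> y \<and> y \<prec> l))"
proof -
  have "sat M undefined ax_INF \<longleftrightarrow> (\<exists>l. ord l \<and> (\<exists>x. ord x \<and> x \<prec> l) \<and>
      (\<forall>x. ord x \<longrightarrow> x \<prec> l \<longrightarrow> (\<exists>y. ord y \<and> x \<prec> y \<and> y \<prec> l)))"
    unfolding ax_INF_def Let_def by (intro sat_SO_iffs; simp add: folds)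
  then show ?thesis using sat_axioms(3) SOR(2) by blast
qed

lemma EXT: assumes "sord a" "sord b" "\<And>x. x \<in>\<^sub>o a \<longleftrightarrow> x \<in>\<^sub>o b" shows "a = b"
proof -
  have "sat M undefined ax_EXT \<longleftrightarrow>
    (\<forall>a. sord a \<longrightarrow> (\<forall>b. sord b \<longrightarrow> (\<forall>x. ord x \<longrightarrow> (x \<in>\<^sub>o a \<longleftrightarrow> x \<in>\<^sub>o b)) \<longrightarrow> a = b))"
    unfolding ax_EXT_def Let_def by (intro sat_SO_iffs; simp add: folds)
  then show ?thesis using sat_axioms(4) assms by blast
qed

lemma INI: "ord x \<Longrightarrow> \<exists>a. sord a \<and> (\<forall>y. y \<prec> x \<longleftrightarrow> y \<in>\<^sub>o a)"
proof -
  have "sat M undefined ax_INI \<longleftrightarrow>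
    (\<forall>x. ord x \<longrightarrow> (\<exists>a. sord a \<and> (\<forall>y. ord y \<longrightarrow> (y \<prec> x \<longleftrightarrow> y \<in>\<^sub>o a))))"
    unfolding ax_INI_def Let_def by (intro sat_SO_iffs; simp add: folds)
  then show "ord x \<Longrightarrow> ?thesis" using sat_axioms(5) SOR(2,3) by meson
qed

lemma BOU: "sord a \<Longrightarrow> \<exists>x. ord x \<and> (\<forall>y. y \<in>\<^sub>o a \<longrightarrow> y \<prec> x)"
proof -
  have "sat M undefined ax_BOU \<longleftrightarrow>
    (\<forall>a. sord a \<longrightarrow> (\<exists>x. ord x \<and> (\<forall>y. ord y \<longrightarrow> y \<in>\<^sub>o a \<longrightarrow> y \<prec> x)))"
    unfolding ax_BOU_def Let_def by (intro sat_SO_iffs; simp add: folds)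
  then show "sord a \<Longrightarrow> ?thesis" using sat_axioms(6) SOR(3) by meson
qed

lemma POW:
  assumes "sord a"
  shows "\<exists>b. sord b \<and> (\<forall>z x. x \<in>\<^sub>o z \<longrightarrow> (\<forall>y. y \<in>\<^sub>o z \<longrightarrow> y \<in>\<^sub>o a) \<longrightarrow>
    (\<exists>\<xi>. ord \<xi> \<and> (\<forall>y. ord y \<longrightarrow> (y \<in>\<^sub>o z \<longleftrightarrow> g y \<xi> \<in>\<^sub>o b))))"
proof -
  have "sat M undefined ax_POW \<longleftrightarrow>
    (\<forall>a. sord a \<longrightarrow> (\<exists>b. sord b \<and> (\<forall>z. sord z \<longrightarrow>
      (\<exists>x. ord x \<and> x \<in>\<^sub>o z) \<and> (\<forall>y. ord y \<longrightarrow> y \<in>\<^sub>o z \<longrightarrow> y \<in>\<^sub>o a) \<longrightarrow>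
      (\<exists>\<xi>. ord \<xi> \<and> (\<forall>y. ord y \<longrightarrow> (y \<in>\<^sub>o z \<longleftrightarrow> g y \<xi> \<in>\<^sub>o b)) \<and>
        (\<forall>\<zeta>. ord \<zeta> \<longrightarrow> (\<forall>y. ord y \<longrightarrow> (y \<in>\<^sub>o z \<longleftrightarrow> g y \<zeta> \<in>\<^sub>o b)) \<longrightarrow> \<zeta> = \<xi>)))))"
    unfolding ax_POW_def Let_def by (intro sat_SO_iffs; simp add: folds)
  from this[THEN iffD1, OF sat_axioms(8), THEN spec, THEN mp, OF assms]
  obtain b where b: "sord b \<and> (\<forall>z. sord z \<longrightarrow>
      (\<exists>x. ord x \<and> x \<in>\<^sub>o z) \<and> (\<forall>y. ord y \<longrightarrow> y \<in>\<^sub>o z \<longrightarrow> y \<in>\<^sub>o a) \<longrightarrow>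
      (\<exists>\<xi>. ord \<xi> \<and> (\<forall>y. ord y \<longrightarrow> (y \<in>\<^sub>o z \<longleftrightarrow> g y \<xi> \<in>\<^sub>o b)) \<and>
        (\<forall>\<zeta>. ord \<zeta> \<longrightarrow> (\<forall>y. ord y \<longrightarrow> (y \<in>\<^sub>o z \<longleftrightarrow> g y \<zeta> \<in>\<^sub>o b)) \<longrightarrow> \<zeta> = \<xi>)))"
    by (rule exE)
  show ?thesis
  proof (rule exI[of _ b], intro conjI allI impI)
    fix z x assume z: "x \<in>\<^sub>o z" "\<forall>y. y \<in>\<^sub>o z \<longrightarrow> y \<in>\<^sub>o a"
    then have "sord z" "(\<exists>x. ord x \<and> x \<in>\<^sub>o z) \<and> (\<forall>y. ord y \<longrightarrow> y \<in>\<^sub>o z \<longrightarrow> y \<in>\<^sub>o a)"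
      using SOR(3) by blast+
    from b[THEN conjunct2, THEN spec, THEN mp, THEN mp, OF this]
    show "\<exists>\<xi>. ord \<xi> \<and> (\<forall>y. ord y \<longrightarrow> (y \<in>\<^sub>o z \<longleftrightarrow> g y \<xi> \<in>\<^sub>o b))"
      by (elim ex_forward conj_forward) (assumption, erule conjunct1)
  qed (rule b[THEN conjunct1])
qed

lemma SEP:
  assumes "dfn (\<lambda>e. P (e 0))" "sord a"
  shows "\<exists>b. sord b \<and> (\<forall>x. x \<in>\<^sub>o b \<longleftrightarrow> x \<in>\<^sub>o a \<and> P x)"
proof -
  obtain \<phi> p where \<phi>: "wf_fm L_SO \<phi>" "\<And>e. P (e 0) \<longleftrightarrow> sat M (mrg e p) \<phi>"
    using assms(1) unfolding dfn_def by blast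
  \<comment> \<open>The element is variable 0 and parameter \<open>j\<close> is variable
    \<open>3 + j\<close>. All even variables can become 0, as the truth of the formula depends on
    \<open>e 0\<close> alone.\<close>
  define \<rho> :: "nat \<Rightarrow> so_tm" where "\<rho> = (\<lambda>i. if even i then Var 0 else Var (3 + i div 2))"
  define n where "n = Suc (Max (insert 0 (fv \<phi>)))"
  have n: "i < n" if "i \<in> fv \<phi>" for i
    using that finite_fv[of \<phi>] by (simp add: n_def less_Suc_eq_le)
  have "fv (subst_fm \<rho> \<phi>) \<subseteq> {0} \<union> {3..<3 + n}"
  proof
    fix j assume "j \<in> fv (subst_fm \<rho> \<phi>)"
    then obtain i where "i \<in> fv \<phi>" "j \<in> fv_tm (\<rho> i)" by (auto simp: fv_subst_fm)
    then show "j \<in> {0} \<union> {3..<3 + n}" using n[of i] by (auto simp: \<rho>_def split: if_splits)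
  qed
  moreover have "wf_fm L_SO (subst_fm \<rho> \<phi>)" using \<phi>(1) by (auto simp: \<rho>_def intro: wf_subst_fm)
  ultimately have "ax_SEP n (subst_fm \<rho> \<phi>) \<in> SO" unfolding SO_def by blast
  \<comment> \<open>This environment gives variable \<open>3 + j\<close> the value
    \<open>p j\<close>; the lower variables are bound inside the axiom.\<close>
  from sat_SO[OF this, of "\<lambda>i. p (i - 3)", unfolded ax_SEP_def Let_def, THEN sat_allsD]
  have ax: "sat M (\<lambda>i. p (i - 3)) (\<^bold>\<forall>\<^sub>S1. \<^bold>\<exists>\<^sub>S2. \<^bold>\<forall>\<^sub>O0. Var 0 \<^bold>\<in> Var 2 \<^bold>\<longleftrightarrow> Var 0 \<^bold>\<in> Var 1 \<^bold>\<and> subst_fm \<rho> \<phi>)"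
    by simp
  have sat: "sat M ((\<lambda>i. p (i - 3))(1 := c, 2 := b, 0 := x)) (subst_fm \<rho> \<phi>) \<longleftrightarrow> P x" for b c x
  proof -
    have "(\<lambda>i. val M ((\<lambda>i. p (i - 3))(1 := c, 2 := b, 0 := x)) (\<rho> i)) = mrg (\<lambda>_. x) p"
      by (auto simp: \<rho>_def mrg_def)
    then show ?thesis using \<phi>(2)[of "\<lambda>_. x"] by (simp only: sat_subst)
  qed
  have "\<forall>a. sord a \<longrightarrow> (\<exists>b. sord b \<and> (\<forall>x. ord x \<longrightarrow> (x \<in>\<^sub>o b \<longleftrightarrow> x \<in>\<^sub>o a \<and> P x)))"
    by (rule iffD1[OF _ ax]) (intro sat_SO_iffs sat; simp add: folds)
  then obtain b where b: "sord b" "\<And>x. ord x \<Longrightarrow> x \<in>\<^sub>o b \<longleftrightarrow> x \<in>\<^sub>o a \<and> P x"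
    using assms(2) by auto
  have "x \<in>\<^sub>o b \<longleftrightarrow> x \<in>\<^sub>o a \<and> P x" for x
    using b(2)[of x] SOR(3)[of x a] SOR(3)[of x b] by blast
  then show ?thesis using b(1) by auto
qed

text \<open>BOU turns the image into a bound, the form in which \<open>collect\<close> asks for
  it.\<close>

lemma REP:
  assumes "dfn (\<lambda>e. P (e 0) (e 1))" "sord a"
    and fct: "\<And>x y z. ord x \<Longrightarrow> ord y \<Longrightarrow> ord z \<Longrightarrow> P x y \<Longrightarrow> P x z \<Longrightarrow> y = z"
  shows "\<exists>k. ord k \<and> (\<forall>x y. x \<in>\<^sub>o a \<longrightarrow> ord y \<longrightarrow> P x y \<longrightarrow> y \<prec> k)"
proof -
  obtain \<phi> p where \<phi>: "wf_fm L_SO \<phi>" "\<And>e. P (e 0) (e 1) \<longleftrightarrow> sat M (mrg e p) \<phi>"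
    using assms(1) unfolding dfn_def by blast
  define \<rho> :: "nat \<Rightarrow> so_tm" where
    "\<rho> = (\<lambda>i. if i = 0 then Var 0 else if even i then Var 1 else Var (6 + i div 2))"
  define n where "n = Suc (Max (insert 0 (fv \<phi>)))"
  have n: "i < n" if "i \<in> fv \<phi>" for i
    using that finite_fv[of \<phi>] by (simp add: n_def less_Suc_eq_le)
  have "fv (subst_fm \<rho> \<phi>) \<subseteq> {0, 1} \<union> {6..<6 + n}"
  proof
    fix j assume "j \<in> fv (subst_fm \<rho> \<phi>)"
    then obtain i where "i \<in> fv \<phi>" "j \<in> fv_tm (\<rho> i)" by (auto simp: fv_subst_fm)
    then show "j \<in> {0, 1} \<union> {6..<6 + n}" using n[of i] by (auto simp: \<rho>_def split: if_splits)
  qed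
  moreover have "wf_fm L_SO (subst_fm \<rho> \<phi>)" using \<phi>(1) by (auto simp: \<rho>_def intro: wf_subst_fm)
  ultimately have "ax_REP n (subst_fm \<rho> \<phi>) \<in> SO" unfolding SO_def by blast
  from sat_SO[OF this, of "\<lambda>i. p (i - 6)", unfolded ax_REP_def Let_def, THEN sat_allsD]
  have ax: "sat M (\<lambda>i. p (i - 6))
    ((\<^bold>\<forall>\<^sub>O0. \<^bold>\<forall>\<^sub>O2. \<^bold>\<forall>\<^sub>O3. app (subst_fm \<rho> \<phi>) [0, 2] \<^bold>\<and> app (subst_fm \<rho> \<phi>) [0, 3] \<^bold>\<longrightarrow> Var 2 \<^bold>= Var 3) \<^bold>\<longrightarrow>
        (\<^bold>\<forall>\<^sub>S4. \<^bold>\<exists>\<^sub>S5. \<^bold>\<forall>\<^sub>O1. Var 1 \<^bold>\<in> Var 5 \<^bold>\<longleftrightarrow> (\<^bold>\<exists>\<^sub>O0. Var 0 \<^bold>\<in> Var 4 \<^bold>\<and> app (subst_fm \<rho> \<phi>) [0, 1])))"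
    by simp
  have sat: "sat M e (app (subst_fm \<rho> \<phi>) [i, j]) \<longleftrightarrow> P x y"
    if "e i = x" "e j = y" "\<And>k. 6 \<le> k \<Longrightarrow> e k = p (k - 6)" for e i j x y
  proof -
    have "(\<lambda>k. val M (\<lambda>l. if l < length [i, j] then e ([i, j] ! l) else e l) (\<rho> k)) = mrg (case_nat x (\<lambda>_. y)) p"
      using that by (auto simp: \<rho>_def mrg_def fun_eq_iff split: nat.split)
    then show ?thesis using \<phi>(2)[of "case_nat x (\<lambda>_. y)"] by (simp add: sat_app sat_subst)
  qed
  have "(\<forall>x. ord x \<longrightarrow> (\<forall>y. ord y \<longrightarrow> (\<forall>z. ord z \<longrightarrow> P x y \<and> P x z \<longrightarrow> y = z))) \<longrightarrow>
      (\<forall>a. sord a \<longrightarrow> (\<exists>b. sord b \<and> (\<forall>y. ord y \<longrightarrow> (y \<in>\<^sub>o b \<longleftrightarrow> (\<exists>x. ord x \<and> x \<in>\<^sub>o a \<and> P x y)))))"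
    by (rule iffD1[OF _ ax]) (intro sat_SO_iffs sat; simp add: folds)
  then obtain b where "sord b" "\<And>y. ord y \<Longrightarrow> y \<in>\<^sub>o b \<longleftrightarrow> (\<exists>x. ord x \<and> x \<in>\<^sub>o a \<and> P x y)"
    using fct assms(2) by blast
  then show ?thesis using BOU[of b] SOR(3) by blast
qed

subsection \<open>Ordinals and pairs\<close>

text \<open>WO speaks of sets, so the class is cut down to its part below \<open>x\<close>, a set by
  INI and SEP. If that part is empty, \<open>x\<close> itself is least.\<close>

lemma least:
  assumes P: "dfn (\<lambda>e. P (e 0))" and x: "ord x" "P x"
  obtains m where "ord m" "P m" "\<And>y. y \<prec> m \<Longrightarrow> \<not> P y"
proof (cases "\<exists>y. y \<prec> x \<and> P y")
  case True
  then obtain y where y: "y \<prec> x" "P y" by blast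
  obtain a where a: "sord a" "\<And>y. y \<prec> x \<longleftrightarrow> y \<in>\<^sub>o a" using INI[OF x(1)] by blast
  obtain b where b: "\<And>y. y \<in>\<^sub>o b \<longleftrightarrow> y \<in>\<^sub>o a \<and> P y" using SEP[OF P a(1)] by blast
  have "y \<in>\<^sub>o b" using y a b by blast
  from WO(4)[OF this] obtain m where m: "m \<in>\<^sub>o b" "\<And>y. y \<prec> m \<Longrightarrow> \<not> y \<in>\<^sub>o b" by blast
  show ?thesis
  proof (rule that)
    show "ord m" "P m" using m(1) b SOR(3) by blast+
    show "\<not> P y" if "y \<prec> m" for y using m that a b WO(2) by blast
  qed
qed (use that x in blast)

definition mx :: "'a \<Rightarrow> 'a \<Rightarrow> 'a" where "mx a b = (if a \<prec> b then b else a)"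

text \<open>The maximum-first order \<open><\<^sup>*\<close> on pairs from GPF.\<close>

definition pl :: "'a \<Rightarrow> 'a \<Rightarrow> 'a \<Rightarrow> 'a \<Rightarrow> bool" where
  "pl a b c d \<longleftrightarrow> mx a b \<prec> mx c d \<or> mx a b = mx c d \<and> (a \<prec> c \<or> a = c \<and> b \<prec> d)"

text \<open>GPF with \<open>g c d\<close> itself as the bound: the left side holds by equality, so
  the right side places all smaller pairs strictly below.\<close>

lemma g_mono:
  assumes o: "ord a" "ord b" "ord c" "ord d" and pl: "pl a b c d" shows "g a b \<prec> g c d"
proof -
  let ?m = "mx a b" and ?n = "mx c d"
  have mx: "ord ?m" "ord ?n" "?m = a \<or> ?m = b" "?n = c \<or> ?n = d"
    "a \<preceq> ?m" "b \<preceq> ?m" "c \<preceq> ?n" "d \<preceq> ?n" using o WO(3) by (auto simp: mx_def)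
  have "\<forall>x. ord x \<longrightarrow> (\<forall>c. ord c \<longrightarrow> (\<forall>d. ord d \<longrightarrow> (g c d \<prec> x \<or> g c d = x \<longleftrightarrow>
      (\<forall>a. ord a \<longrightarrow> (\<forall>b. ord b \<longrightarrow>
        (\<exists>m. ord m \<and> (\<exists>n. ord n \<and> ((m = a \<or> m = b) \<and> a \<preceq> m \<and> b \<preceq> m) \<and> ((n = c \<or> n = d) \<and> c \<preceq> n \<and> d \<preceq> n) \<and>
          (m \<prec> n \<or> m = n \<and> a \<prec> c \<or> m = n \<and> a = c \<and> b \<prec> d))) \<longrightarrow> g a b \<prec> x)))))"
    by (rule iffD1[OF _ sat_axioms(7)[of undefined]], unfold ax_GPF_def Let_def is_max_def pair_less_def)
      (intro sat_SO_iffs; simp add: folds)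
  note gpf = this[THEN spec, THEN mp, OF SOR(4)[of c d], THEN spec, THEN mp, OF o(3), THEN spec,
      THEN mp, OF o(4), THEN iffD1, OF disjI2[OF refl], THEN spec, THEN mp, OF o(1), THEN spec,
      THEN mp, OF o(2), THEN mp]
  show ?thesis
  proof (rule gpf, rule exI[of _ ?m], rule conjI[OF mx(1)], rule exI[of _ ?n], intro conjI)
    show "?m \<prec> ?n \<or> ?m = ?n \<and> a \<prec> c \<or> ?m = ?n \<and> a = c \<and> b \<prec> d"
      using pl unfolding pl_def by blast
  qed (use mx in simp_all)
qed

lemma pl_total:
  assumes "ord a" "ord b" "ord c" "ord d"
  shows "pl a b c d \<or> pl c d a b \<or> a = c \<and> b = d"
proof -
  have "ord (mx a b)" "ord (mx c d)" using assms by (auto simp: mx_def)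
  then have "mx a b \<prec> mx c d \<or> mx a b = mx c d \<or> mx c d \<prec> mx a b" by (rule WO(3))
  moreover have "a \<prec> c \<or> a = c \<or> c \<prec> a" "b \<prec> d \<or> b = d \<or> d \<prec> b" 
    using assms WO(3)[of a c] WO(3)[of b d] by simp_all
  ultimately show ?thesis unfolding pl_def by auto
qed

lemma g_inj:
  assumes "ord a" "ord b" "ord c" "ord d" shows "g a b = g c d \<longleftrightarrow> a = c \<and> b = d"
proof
  assume eq: "g a b = g c d"
  then have "\<not> g a b \<prec> g c d" "\<not> g c d \<prec> g a b" using WO(1) by auto
  then show "a = c \<and> b = d"
    using pl_total[OF assms] g_mono[OF assms] g_mono[OF assms(3,4,1,2)] by blast
qed simp

lemma g_bound: "a \<prec> k \<Longrightarrow> b \<prec> k \<Longrightarrow> g a b \<prec> g k k"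
  using SOR(2) by (intro g_mono) (auto simp: pl_def mx_def)

text \<open>At a least \<open>m\<close> with \<open>f m \<prec> m\<close>, monotonicity gives
  \<open>f (f m) \<prec> f m\<close>, so \<open>f m\<close> would be a smaller one.\<close>

lemma strict_mono_ge:
  assumes f: "dft (\<lambda>e. f (e 0))" "\<And>x. ord x \<Longrightarrow> ord (f x)" "\<And>x y. x \<prec> y \<Longrightarrow> f x \<prec> f y" and x: "ord x"
  shows "x \<preceq> f x"
proof (rule ccontr)
  assume "\<not> x \<preceq> f x"
  then have "f x \<prec> x" using WO(3) f(2) x by blast
  then obtain m where "f m \<prec> m" "\<And>y. y \<prec> m \<Longrightarrow> \<not> f y \<prec> y"
    using least[OF dfn_atoms(2)[OF f(1) dft_var] x] by blast
  then show False using f(3) by blast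
qed

lemma g_ge: assumes "ord a" "ord b" shows "a \<preceq> g a b" "b \<preceq> g a b"
proof -
  show "a \<preceq> g a b"
  proof (rule strict_mono_ge)
    show "g x b \<prec> g y b" if "x \<prec> y" for x y
    proof (rule g_mono)
      show "pl x b y b"
        using that WO(2)[of x y b] WO(3)[of b y] SOR(2)[OF that] assms by (auto simp: pl_def mx_def)
    qed (use that SOR(2) assms in auto)
  qed (use assms in \<open>auto intro: dfn_intros SOR\<close>)
  show "b \<preceq> g a b"
  proof (rule strict_mono_ge)
    show "g a x \<prec> g a y" if "x \<prec> y" for x y
    proof (rule g_mono)
      show "pl a x a y"
        using that WO(2)[of a x y] by (auto simp: pl_def mx_def)
    qed (use that SOR(2) assms in auto)
  qed (use assms in \<open>auto intro: dfn_intros SOR\<close>)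
qed

lemma g_lessD: "ord a \<Longrightarrow> ord b \<Longrightarrow> g a b \<prec> k \<Longrightarrow> a \<prec> k \<and> b \<prec> k"
  using g_ge[of a b] WO(2)[of a "g a b" k] WO(2)[of b "g a b" k] by auto

text \<open>Pairing stands in for a successor axiom. INF yields some \<open>b \<prec> a\<close>; if
  \<open>b \<prec> x\<close>, then \<open>x \<preceq> g b x \<prec> g x x\<close>, and otherwise
  \<open>x \<preceq> b \<prec> a\<close>.\<close>

lemma no_max:
  assumes "ord x" obtains y where "x \<prec> y"
proof -
  obtain a b where a: "b \<prec> a" using INF by blast
  show ?thesis
  proof (cases "b \<prec> x")
    case True
    have "x \<preceq> g b x" using g_ge[of b x] True SOR(2) by blast
    moreover have "g b x \<prec> g x x"
      using True SOR(2)[OF True] WO(1)[of x] WO(2)[of x b x] by (intro g_mono) (auto simp: pl_def mx_def)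
    ultimately have "x \<prec> g x x" using WO(2)[of x "g b x" "g x x"] by auto
    then show ?thesis by (rule that)
  next
    case False
    then have "x \<prec> a" using WO(2,3) a assms SOR(2) by blast
    then show ?thesis by (rule that)
  qed
qed

lemma upper2:
  assumes "ord x" "ord y" obtains k where "x \<prec> k" "y \<prec> k"
  using assms no_max WO(2,3) by metis

lemma compr:
  assumes P: "dfn (\<lambda>e. P (e 0))" and k: "\<And>x. ord x \<Longrightarrow> P x \<Longrightarrow> x \<prec> k" "ord k"
  obtains c where "sord c" "\<And>x. x \<in>\<^sub>o c \<longleftrightarrow> ord x \<and> P x"
proof -
  obtain a where a: "sord a" "\<And>y. y \<prec> k \<longleftrightarrow> y \<in>\<^sub>o a" using INI[OF k(2)] by blast
  show ?thesis using SEP[OF P a(1)] a(2) k(1) SOR(2) that by metis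
qed

end

section \<open>Sets as marked well-founded graphs\<close>

context so_model
begin

text \<open>A set \<open>c\<close> of ordinals codes a graph on the ordinals by its elements \<open>g x y\<close> with
  \<open>x \<noteq> y\<close>, and a set of marked nodes by its elements \<open>g x x\<close>. If the graph is well-founded, each
  node denotes a set, whose elements are denoted by the predecessors of the node, and \<open>c\<close>
  denotes the set of all sets denoted by marked nodes.\<close>

definition edge :: "'a \<Rightarrow> 'a \<Rightarrow> 'a \<Rightarrow> bool" where
  "edge c x y \<longleftrightarrow> ord x \<and> ord y \<and> x \<noteq> y \<and> g x y \<in>\<^sub>o c"

definition mark :: "'a \<Rightarrow> 'a \<Rightarrow> bool" where
  "mark c x \<longleftrightarrow> ord x \<and> g x x \<in>\<^sub>o c"

text \<open>Well-foundedness is required for sets of nodes only, which keeps it first-order;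
  \<open>code_induct\<close> extends it to definable classes.\<close>

definition code :: "'a \<Rightarrow> bool" where
  "code c \<longleftrightarrow> sord c \<and> (\<forall>z. sord z \<longrightarrow> (\<exists>x. x \<in>\<^sub>o z) \<longrightarrow> (\<exists>x. x \<in>\<^sub>o z \<and> (\<forall>y. y \<in>\<^sub>o z \<longrightarrow> \<not> edge c y x)))"

definition bis :: "'a \<Rightarrow> 'a \<Rightarrow> 'a \<Rightarrow> bool" where
  "bis c d r \<longleftrightarrow> (\<forall>x y. ord x \<and> ord y \<and> g x y \<in>\<^sub>o r \<longrightarrow>
     (\<forall>x'. edge c x' x \<longrightarrow> (\<exists>y'. edge d y' y \<and> g x' y' \<in>\<^sub>o r)) \<and>
     (\<forall>y'. edge d y' y \<longrightarrow> (\<exists>x'. edge c x' x \<and> g x' y' \<in>\<^sub>o r)))"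

text \<open>The union of all bisimulations that are sets. An existential quantifier thus does the
  work of a recursion along the edges.\<close>

definition sim :: "'a \<Rightarrow> 'a \<Rightarrow> 'a \<Rightarrow> 'a \<Rightarrow> bool" where
  "sim c x d y \<longleftrightarrow> ord x \<and> ord y \<and> (\<exists>r. sord r \<and> bis c d r \<and> g x y \<in>\<^sub>o r)"

definition eqs :: "'a \<Rightarrow> 'a \<Rightarrow> bool" where
  "eqs c d \<longleftrightarrow> (\<forall>x. mark c x \<longrightarrow> (\<exists>y. mark d y \<and> sim c x d y)) \<and>
     (\<forall>y. mark d y \<longrightarrow> (\<exists>x. mark c x \<and> sim c x d y))"

text \<open>\<open>nd c d y\<close>: the code \<open>c\<close> denotes the same set as the node \<open>y\<close> of \<open>d\<close>.\<close>

definition nd :: "'a \<Rightarrow> 'a \<Rightarrow> 'a \<Rightarrow> bool" where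
  "nd c d y \<longleftrightarrow> (\<forall>x. mark c x \<longrightarrow> (\<exists>y'. edge d y' y \<and> sim c x d y')) \<and>
     (\<forall>y'. edge d y' y \<longrightarrow> (\<exists>x. mark c x \<and> sim c x d y'))"

definition ins :: "'a \<Rightarrow> 'a \<Rightarrow> bool" where
  "ins c d \<longleftrightarrow> (\<exists>y. mark d y \<and> nd c d y)"

text \<open>The measure of size for codes. Since \<open>g\<close> dominates its arguments,
  \<open>k\<close> also bounds every marked node and every node on an edge.\<close>

definition bd :: "'a \<Rightarrow> 'a \<Rightarrow> bool" where
  "bd c k \<longleftrightarrow> ord k \<and> (\<forall>x. x \<in>\<^sub>o c \<longrightarrow> x \<prec> k)"

lemma dfn_edge: "dft a \<Longrightarrow> dft b \<Longrightarrow> dft c \<Longrightarrow> dfn (\<lambda>e. edge (a e) (b e) (c e))"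
  by (rule dfn_subst3) (unfold edge_def, intro dfn_intros)

lemma dfn_mark: "dft a \<Longrightarrow> dft b \<Longrightarrow> dfn (\<lambda>e. mark (a e) (b e))"
  by (rule dfn_subst2) (unfold mark_def, intro dfn_intros)

lemma dfn_code: "dft a \<Longrightarrow> dfn (\<lambda>e. code (a e))"
  by (rule dfn_subst1) (unfold code_def, intro dfn_intros dfn_edge)

lemma dfn_bis: "dft a \<Longrightarrow> dft b \<Longrightarrow> dft c \<Longrightarrow> dfn (\<lambda>e. bis (a e) (b e) (c e))"
  by (rule dfn_subst3) (unfold bis_def, intro dfn_intros dfn_edge)

lemma dfn_sim: "dft a \<Longrightarrow> dft b \<Longrightarrow> dft c \<Longrightarrow> dft d \<Longrightarrow> dfn (\<lambda>e. sim (a e) (b e) (c e) (d e))"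
  by (rule dfn_subst4) (unfold sim_def, intro dfn_intros dfn_bis)

lemma dfn_eqs: "dft a \<Longrightarrow> dft b \<Longrightarrow> dfn (\<lambda>e. eqs (a e) (b e))"
  by (rule dfn_subst2) (unfold eqs_def, intro dfn_intros dfn_mark dfn_sim)

lemma dfn_nd: "dft a \<Longrightarrow> dft b \<Longrightarrow> dft c \<Longrightarrow> dfn (\<lambda>e. nd (a e) (b e) (c e))"
  by (rule dfn_subst3) (unfold nd_def, intro dfn_intros dfn_mark dfn_edge dfn_sim)

lemma dfn_ins: "dft a \<Longrightarrow> dft b \<Longrightarrow> dfn (\<lambda>e. ins (a e) (b e))"
  by (rule dfn_subst2) (unfold ins_def, intro dfn_intros dfn_mark dfn_nd)

lemma dfn_bd: "dft a \<Longrightarrow> dft b \<Longrightarrow> dfn (\<lambda>e. bd (a e) (b e))"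
  by (rule dfn_subst2) (unfold bd_def, intro dfn_intros)

lemmas dfn_all_intros = dfn_intros dfn_edge dfn_mark dfn_code dfn_sim dfn_eqs dfn_nd dfn_ins dfn_bd

section \<open>Sorts and bounds\<close>

lemma code_sord: "code c \<Longrightarrow> sord c"
  by (simp add: code_def)

lemma edge_ord: "edge c x y \<Longrightarrow> ord x \<and> ord y"
  by (simp add: edge_def)

lemma mark_ord: "mark c x \<Longrightarrow> ord x"
  by (simp add: mark_def)

lemma sim_ord: "sim c x d y \<Longrightarrow> ord x \<and> ord y"
  by (simp add: sim_def)

lemma bd_edge: "bd c k \<Longrightarrow> edge c x y \<Longrightarrow> x \<prec> k \<and> y \<prec> k"
  unfolding bd_def edge_def using g_lessD by blast

lemma bd_mark: "bd c k \<Longrightarrow> mark c x \<Longrightarrow> x \<prec> k"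
  unfolding bd_def mark_def using g_lessD by blast

lemma bd_less: "bd c k \<Longrightarrow> k \<prec> l \<Longrightarrow> bd c l"
  unfolding bd_def using WO(2) SOR(2) by blast

lemma bd_ex: assumes "sord c" obtains k where "bd c k"
  unfolding bd_def using BOU[OF assms] by blast

lemma upper:
  assumes "sord c" "sord d" "ord x" "ord y"
  obtains k where "bd c k" "bd d k" "x \<prec> k" "y \<prec> k"
proof -
  obtain k1 k2 where k: "bd c k1" "bd d k2" using assms bd_ex by meson
  then obtain k3 where k3: "k1 \<prec> k3" "k2 \<prec> k3" using upper2[of k1 k2] by (auto simp: bd_def)
  obtain k4 where k4: "x \<prec> k4" "y \<prec> k4" using upper2[OF assms(3,4)] .
  obtain k where "k3 \<prec> k" "k4 \<prec> k" using upper2[of k3 k4] SOR(2) k3 k4 by blast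
  then show ?thesis using that[of k] k k3 k4 WO(2) bd_less by blast
qed

subsection \<open>Bisimilarity\<close>

text \<open>Bisimilarity is a fixed point. From right to left, the pair of \<open>x\<close> and
  \<open>y\<close> is added to the similar pairs below a common bound \<open>k\<close> of both
  codes. This is a set, and predecessors stay below \<open>k\<close>, so it is a
  bisimulation.\<close>

lemma sim_unfold:
  assumes "sord c" "sord d"
  shows "sim c x d y \<longleftrightarrow> ord x \<and> ord y \<and>
    (\<forall>x'. edge c x' x \<longrightarrow> (\<exists>y'. edge d y' y \<and> sim c x' d y')) \<and>
    (\<forall>y'. edge d y' y \<longrightarrow> (\<exists>x'. edge c x' x \<and> sim c x' d y'))" (is "_ \<longleftrightarrow> ?R")
proof
  assume "sim c x d y"
  then obtain r where r: "ord x" "ord y" "sord r" "bis c d r" "g x y \<in>\<^sub>o r" unfolding sim_def by blast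
  have "(\<forall>x'. edge c x' x \<longrightarrow> (\<exists>y'. edge d y' y \<and> g x' y' \<in>\<^sub>o r)) \<and>
     (\<forall>y'. edge d y' y \<longrightarrow> (\<exists>x'. edge c x' x \<and> g x' y' \<in>\<^sub>o r))"
    using r unfolding bis_def by blast
  moreover have "sim c x' d y'" if "edge c x' x" "edge d y' y" "g x' y' \<in>\<^sub>o r" for x' y'
    using r(3,4) that edge_ord unfolding sim_def by blast
  ultimately show ?R using r(1,2) by blast
next
  assume R: ?R
  then obtain k where k: "bd c k" "bd d k" "x \<prec> k" "y \<prec> k" using upper assms by blast
  let ?Q = "\<lambda>u v. u = x \<and> v = y \<or> sim c u d v"
  let ?P = "\<lambda>p. \<exists>u v. u \<prec> k \<and> v \<prec> k \<and> p = g u v \<and> ?Q u v"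
  have "dfn (\<lambda>e. ?P (e 0))" by (intro dfn_all_intros)
  then obtain r where r: "sord r" "\<And>p. p \<in>\<^sub>o r \<longleftrightarrow> ord p \<and> ?P p"
    using compr[of ?P "g k k"] g_bound SOR(4) by blast
  have rI: "g u v \<in>\<^sub>o r" if "?Q u v" "u \<prec> k" "v \<prec> k" for u v
    using that r(2) SOR(4) by blast
  have rD: "?Q u v" if "g u v \<in>\<^sub>o r" "ord u" "ord v" for u v
    using that r(2) g_inj SOR(2) by metis
  have "bis c d r" unfolding bis_def
  proof (intro allI impI, elim conjE)
    fix u v assume "ord u" "ord v" "g u v \<in>\<^sub>o r"
    then consider "u = x" "v = y" | "sim c u d v" using rD by blast
    then have Q: "(\<forall>u'. edge c u' u \<longrightarrow> (\<exists>v'. edge d v' v \<and> sim c u' d v')) \<and>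
      (\<forall>v'. edge d v' v \<longrightarrow> (\<exists>u'. edge c u' u \<and> sim c u' d v'))"
    proof cases
      case 2
      then obtain s where s: "sord s" "bis c d s" "g u v \<in>\<^sub>o s" "ord u" "ord v" unfolding sim_def by blast
      have "(\<forall>x'. edge c x' u \<longrightarrow> (\<exists>y'. edge d y' v \<and> g x' y' \<in>\<^sub>o s)) \<and>
         (\<forall>y'. edge d y' v \<longrightarrow> (\<exists>x'. edge c x' u \<and> g x' y' \<in>\<^sub>o s))"
        using s unfolding bis_def by blast
      moreover have "sim c x' d y'" if "edge c x' u" "edge d y' v" "g x' y' \<in>\<^sub>o s" for x' y'
        using s(1,2) that edge_ord unfolding sim_def by blast
      ultimately show ?thesis by blast
    qed (use R in simp)
    have "g u' v' \<in>\<^sub>o r" if "edge c u' u" "edge d v' v" "sim c u' d v'" for u' v'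
      using that rI bd_edge[OF k(1) that(1)] bd_edge[OF k(2) that(2)] by blast
    with Q show "(\<forall>u'. edge c u' u \<longrightarrow> (\<exists>v'. edge d v' v \<and> g u' v' \<in>\<^sub>o r)) \<and>
      (\<forall>v'. edge d v' v \<longrightarrow> (\<exists>u'. edge c u' u \<and> g u' v' \<in>\<^sub>o r))" by blast
  qed
  then show "sim c x d y" unfolding sim_def using R r(1) rI[of x y] k by blast
qed

lemma sim_edgeD:
  assumes "sim c x d y" "sord c" "sord d"
  shows "edge c x' x \<Longrightarrow> \<exists>y'. edge d y' y \<and> sim c x' d y'"
    "edge d y' y \<Longrightarrow> \<exists>x'. edge c x' x \<and> sim c x' d y'"
  using sim_unfold[OF assms(2,3), of x y] assms(1) by blast+

lemma sim_edgeI: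
  assumes "sord c" "sord d" "ord x" "ord y"
    "\<And>x'. edge c x' x \<Longrightarrow> \<exists>y'. edge d y' y \<and> sim c x' d y'"
    "\<And>y'. edge d y' y \<Longrightarrow> \<exists>x'. edge c x' x \<and> sim c x' d y'"
  shows "sim c x d y"
  using sim_unfold[OF assms(1,2), of x y] assms by blast

text \<open>The nodes at which \<open>P\<close> fails, taken below a bound of the code and of
  \<open>x\<close>, form a set. Predecessors never leave the bound, so all predecessors of a minimal
  element satisfy \<open>P\<close>.\<close>

lemma code_induct:
  assumes c: "code c" and P: "dfn (\<lambda>e. P (e 0))"
    and step: "\<And>x. ord x \<Longrightarrow> (\<And>y. edge c y x \<Longrightarrow> P y) \<Longrightarrow> P x" and x: "ord x"
  shows "P x"
proof (rule ccontr)
  assume nP: "\<not> P x"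
  obtain k where k: "bd c k" "x \<prec> k" using upper[OF code_sord code_sord, of c c x x] c x by blast
  have "dfn (\<lambda>e. e 0 \<prec> k \<and> \<not> P (e 0))" by (intro dfn_intros P)
  then obtain z where z: "sord z" "\<And>u. u \<in>\<^sub>o z \<longleftrightarrow> ord u \<and> u \<prec> k \<and> \<not> P u"
    using compr[of "\<lambda>u. u \<prec> k \<and> \<not> P u" k] k SOR(2) by blast
  have "x \<in>\<^sub>o z" using z x k nP by blast
  then obtain m where m: "m \<in>\<^sub>o z" "\<And>y. y \<in>\<^sub>o z \<Longrightarrow> \<not> edge c y m"
    using c z(1) unfolding code_def by meson
  have "P y" if "edge c y m" for y
    using that m(2)[of y] z(2)[of y] bd_edge[OF k(1) that] edge_ord by blast
  then show False using step m(1) z(2) by blast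
qed

lemma sim_refl:
  assumes "code c" "ord x" shows "sim c x c x"
proof (rule code_induct[OF assms(1), of "\<lambda>x. sim c x c x"])
  show "dfn (\<lambda>e. sim c (e 0) c (e 0))" by (intro dfn_all_intros)
  show "sim c x c x" if "ord x" "\<And>y. edge c y x \<Longrightarrow> sim c y c y" for x
    using that assms(1) by (intro sim_edgeI code_sord) auto
qed (rule assms)

lemma sim_sym:
  assumes "code c" "code d" "sim c x d y" shows "sim d y c x"
proof -
  have "\<forall>y. sim c x d y \<longrightarrow> sim d y c x"
  proof (rule code_induct[OF assms(1), of "\<lambda>x. \<forall>y. sim c x d y \<longrightarrow> sim d y c x"])
    show "dfn (\<lambda>e. \<forall>y. sim c (e 0) d y \<longrightarrow> sim d y c (e 0))" by (intro dfn_all_intros)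
    show "\<forall>y. sim c x d y \<longrightarrow> sim d y c x"
      if "ord x" and IH: "\<And>x'. edge c x' x \<Longrightarrow> \<forall>y. sim c x' d y \<longrightarrow> sim d y c x'" for x
    proof (intro allI impI)
      fix y assume y: "sim c x d y"
      show "sim d y c x"
      proof (rule sim_edgeI)
        show "\<exists>x'. edge c x' x \<and> sim d y' c x'" if "edge d y' y" for y'
          using sim_edgeD(2)[OF y assms(1,2)[THEN code_sord] that] IH by blast
        show "\<exists>y'. edge d y' y \<and> sim d y' c x'" if "edge c x' x" for x'
          using sim_edgeD(1)[OF y assms(1,2)[THEN code_sord] that] IH[OF that] by blast
      qed (use assms code_sord sim_ord[OF y] in auto)
    qed
  qed (use sim_ord[OF assms(3)] in auto)
  then show ?thesis using assms by blast
qed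

lemma sim_trans:
  assumes "code c" "code d" "code f" "sim c x d y" "sim d y f z" shows "sim c x f z"
proof -
  let ?P = "\<lambda>x. \<forall>y z. sim c x d y \<and> sim d y f z \<longrightarrow> sim c x f z"
  have "?P x"
  proof (rule code_induct[OF assms(1), of ?P])
    show "dfn (\<lambda>e. ?P (e 0))" by (intro dfn_all_intros)
    show "?P x" if "ord x" and IH: "\<And>x'. edge c x' x \<Longrightarrow> ?P x'" for x
    proof (intro allI impI, elim conjE)
      fix y z assume y: "sim c x d y" and z: "sim d y f z"
      show "sim c x f z"
      proof (rule sim_edgeI)
        show "\<exists>z'. edge f z' z \<and> sim c x' f z'" if e: "edge c x' x" for x'
        proof -
          obtain y' where y': "edge d y' y" "sim c x' d y'"
            using sim_edgeD(1)[OF y assms(1,2)[THEN code_sord] e] by blast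
          then obtain z' where "edge f z' z" "sim d y' f z'"
            using sim_edgeD(1)[OF z assms(2,3)[THEN code_sord]] by blast
          then show ?thesis using y' IH[OF e] by blast
        qed
        show "\<exists>x'. edge c x' x \<and> sim c x' f z'" if e: "edge f z' z" for z'
        proof -
          obtain y' where y': "edge d y' y" "sim d y' f z'"
            using sim_edgeD(2)[OF z assms(2,3)[THEN code_sord] e] by blast
          then obtain x' where x': "edge c x' x" "sim c x' d y'"
            using sim_edgeD(2)[OF y assms(1,2)[THEN code_sord]] by blast
          then show ?thesis using y' IH[OF x'(1)] by blast
        qed
      qed (use assms code_sord sim_ord[OF y] sim_ord[OF z] in auto)
    qed
  qed (use sim_ord[OF assms(4)] in auto)
  then show ?thesis using assms by blast
qed

text \<open>Bisimulations mention edges only, so changing the marks of a code leaves similarity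
  intact.\<close>

lemma sim_edge_cong: "edge c = edge c' \<Longrightarrow> edge d = edge d' \<Longrightarrow> sim c x d y \<longleftrightarrow> sim c' x d' y"
  by (simp add: sim_def bis_def)

lemma eqs_refl: "code c \<Longrightarrow> eqs c c"
  unfolding eqs_def using sim_refl mark_ord by blast

lemma eqs_sym: "code c \<Longrightarrow> code d \<Longrightarrow> eqs c d \<Longrightarrow> eqs d c"
  unfolding eqs_def using sim_sym by meson

lemma eqs_trans: assumes "code c" "code d" "code f" "eqs c d" "eqs d f" shows "eqs c f"
  using assms(4,5) sim_trans[OF assms(1-3)] unfolding eqs_def by meson

subsection \<open>The members of a set\<close>

text \<open>Edges sit off the diagonal and marks on it, so by injectivity of \<open>g\<close> the
  old edges and the new marks do not interfere. The last clause bounds the new code in terms of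
  \<open>k\<close> alone, uniformly in \<open>P\<close>.\<close>

lemma remark:
  assumes c: "code c" and P: "dfn (\<lambda>e. P (e 0))" and Pk: "\<And>x. P x \<Longrightarrow> x \<prec> l"
  obtains d where "code d" "edge d = edge c" "\<And>x. mark d x \<longleftrightarrow> P x"
    "\<And>k. bd c k \<Longrightarrow> (\<And>x. P x \<Longrightarrow> x \<prec> k) \<Longrightarrow> bd d (g k k)"
proof -
  let ?P = "\<lambda>p. (\<exists>u v. edge c u v \<and> p = g u v) \<or> (\<exists>u. P u \<and> p = g u u)"
  have le: "p \<prec> g k k" if "bd c k" "\<And>x. P x \<Longrightarrow> x \<prec> k" "?P p" for p k
    using that bd_edge[OF that(1)] g_bound by blast
  obtain k where k: "bd c k" "\<And>x. P x \<Longrightarrow> x \<prec> k"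
  \<comment> \<open>Nothing makes \<open>l\<close> an ordinal; if it is not one, no \<open>x\<close>
    lies below it and \<open>P\<close> is empty.\<close>
  proof (cases "ord l")
    case True
    then obtain k where "bd c k" "l \<prec> k" using upper[OF code_sord code_sord, of c c l l] c by blast
    then show ?thesis using that[of k] Pk WO(2) by blast
  next
    case False
    then have "\<not> P x" for x using Pk SOR(2) by blast
    moreover obtain k where "bd c k" using bd_ex[OF code_sord[OF c]] .
    ultimately show ?thesis using that[of k] by blast
  qed
  have Q: "dfn (\<lambda>e. ?P (e 0))" by (intro dfn_all_intros P)
  obtain d where d: "sord d" "\<And>p. p \<in>\<^sub>o d \<longleftrightarrow> ord p \<and> ?P p"
  proof (rule compr[OF Q _ SOR(4)[of k k]])
    show "p \<prec> g k k" if "?P p" for p using le[OF k that] .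
  qed (rule that)
  have P_ord: "P x \<Longrightarrow> ord x" for x using Pk SOR(2) by blast
  have edge: "edge d x y \<longleftrightarrow> edge c x y" for x y
  proof
    assume "edge d x y"
    then have *: "ord x" "ord y" "x \<noteq> y" "?P (g x y)" unfolding edge_def d(2) by blast+
    then obtain u v where "edge c u v" "g x y = g u v" using g_inj P_ord by metis
    then show "edge c x y" using * g_inj edge_ord by metis
  next
    assume "edge c x y"
    then show "edge d x y" unfolding edge_def d(2) using SOR(4) edge_def by blast
  qed
  have mark: "mark d x \<longleftrightarrow> P x" for x
  proof
    assume "mark d x"
    then have *: "ord x" "?P (g x x)" unfolding mark_def d(2) by blast+
    have "\<not> (edge c u v \<and> g x x = g u v)" for u v
      using g_inj[of x x u v] *(1) unfolding edge_def by blast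
    then obtain u where "P u" "g x x = g u u" using * by blast
    then show "P x" using g_inj[of x x u u] P_ord[of u] * by simp
  next
    assume "P x"
    then show "mark d x" unfolding mark_def d(2) using SOR(4) P_ord by blast
  qed
  show ?thesis
  proof (rule that)
    show "edge d = edge c" using edge by (intro ext) simp
    then show "code d" using c d(1) by (simp add: code_def)
    show "mark d x \<longleftrightarrow> P x" for x by (rule mark)
    show "bd d (g k k)" if "bd c k" "\<And>x. P x \<Longrightarrow> x \<prec> k" for k
      using le[OF that] d(2) SOR(4) unfolding bd_def by blast
  qed
qed

text \<open>Makes a node into a code, so that elements, which are nodes, can be handled as sets of
  the interpretation.\<close>

definition nodeset :: "'a \<Rightarrow> 'a \<Rightarrow> 'a" where
  "nodeset d y = (SOME c. code c \<and> edge c = edge d \<and> (\<forall>x. mark c x \<longleftrightarrow> edge d x y) \<and>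
     (\<forall>k. bd d k \<longrightarrow> bd c (g k k)))"

lemma nodeset:
  assumes "code d"
  shows "code (nodeset d y)" "edge (nodeset d y) = edge d" "mark (nodeset d y) x \<longleftrightarrow> edge d x y"
    "bd d k \<Longrightarrow> bd (nodeset d y) (g k k)"
proof -
  obtain l where l: "bd d l" using bd_ex[OF code_sord[OF assms]] .
  have Q: "dfn (\<lambda>e. edge d (e 0) y)" by (intro dfn_all_intros)
  obtain c where "code c" "edge c = edge d" "\<And>x. mark c x \<longleftrightarrow> edge d x y"
    "\<And>k. bd d k \<Longrightarrow> (\<And>x. edge d x y \<Longrightarrow> x \<prec> k) \<Longrightarrow> bd c (g k k)"
  proof (rule remark[OF assms Q, of l])
    show "x \<prec> l" if "edge d x y" for x using bd_edge[OF l that] by blast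
  qed (rule that; blast)
  then have "\<exists>c. code c \<and> edge c = edge d \<and> (\<forall>x. mark c x \<longleftrightarrow> edge d x y) \<and> (\<forall>k. bd d k \<longrightarrow> bd c (g k k))"
    using bd_edge by blast
  from someI_ex[OF this]
  show "code (nodeset d y)" "edge (nodeset d y) = edge d" "mark (nodeset d y) x \<longleftrightarrow> edge d x y"
    "bd d k \<Longrightarrow> bd (nodeset d y) (g k k)"
    unfolding nodeset_def[symmetric] by blast+
qed

lemma nd_edge_cong: "edge d = edge d' \<Longrightarrow> nd c d y \<longleftrightarrow> nd c d' y"
  unfolding nd_def using sim_edge_cong[OF refl, of d d' c] by simp

lemma nd_iff_nodeset: "code d \<Longrightarrow> nd c d y \<longleftrightarrow> eqs c (nodeset d y)"
  unfolding nd_def eqs_def using sim_edge_cong[OF refl nodeset(2)[of d y], of c] nodeset(3)[of d y] by simp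

lemma nodeset_nd: "code d \<Longrightarrow> nd (nodeset d y) d y"
  using nd_iff_nodeset eqs_refl nodeset(1) by blast

lemma nd_cong: "code c \<Longrightarrow> code c' \<Longrightarrow> code d \<Longrightarrow> eqs c c' \<Longrightarrow> nd c d y \<longleftrightarrow> nd c' d y"
  using nd_iff_nodeset nodeset(1) eqs_sym eqs_trans by metis

lemma nd_unique: "code c \<Longrightarrow> code c' \<Longrightarrow> code d \<Longrightarrow> nd c d y \<Longrightarrow> nd c' d y \<Longrightarrow> eqs c c'"
  using nd_iff_nodeset nodeset(1) eqs_sym eqs_trans by metis

text \<open>The marks of a \<open>nodeset\<close> are the predecessors of the node, so
  \<open>eqs\<close> unfolds to the fixed point condition of \<open>sim_unfold\<close>.\<close>

lemma sim_iff_nodeset: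
  assumes "code c" "code d" "ord x" "ord y"
  shows "sim c x d y \<longleftrightarrow> eqs (nodeset c x) (nodeset d y)"
  unfolding eqs_def nodeset(3)[OF assms(1)] nodeset(3)[OF assms(2)]
    sim_edge_cong[OF nodeset(2)[OF assms(1)] nodeset(2)[OF assms(2)]]
  using sim_unfold[OF code_sord[OF assms(1)] code_sord[OF assms(2)], of x y] assms(3,4) by blast

lemma nd_sim:
  assumes "code c" "code d" "code f" "nd c d x" "nd c f y" "ord x" "ord y"
  shows "sim d x f y"
proof -
  have "eqs c (nodeset d x)" "eqs c (nodeset f y)" 
    using assms(4,5) nd_iff_nodeset[OF assms(2)] nd_iff_nodeset[OF assms(3)] by auto
  then have "eqs (nodeset d x) (nodeset f y)"
    using nodeset(1)[OF assms(2)] nodeset(1)[OF assms(3)] eqs_sym eqs_trans assms(1) by blast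
  then show ?thesis using sim_iff_nodeset[OF assms(2,3,6,7)] by simp
qed

lemma sim_nd:
  assumes "code c" "code d" "code f" "sim d x f y" "nd c d x" shows "nd c f y"
proof -
  have "ord x" "ord y" using sim_ord[OF assms(4)] by auto
  then have "eqs (nodeset d x) (nodeset f y)" using sim_iff_nodeset[OF assms(2,3)] assms(4) by blast
  moreover have "eqs c (nodeset d x)" using nd_iff_nodeset[OF assms(2)] assms(5) by blast
  ultimately have "eqs c (nodeset f y)"
    using eqs_trans[OF assms(1) nodeset(1)[OF assms(2)] nodeset(1)[OF assms(3)]] by blast
  then show ?thesis using nd_iff_nodeset[OF assms(3)] by simp
qed

text \<open>The mark of \<open>d\<close> denoting \<open>c\<close> is similar to some mark of
  \<open>d'\<close>, and \<open>sim_nd\<close> moves the denotation there.\<close>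

lemma ins_cong:
  assumes "code c" "code c'" "code d" "code d'" "eqs c c'" "eqs d d'" "ins c d"
  shows "ins c' d'"
proof -
  obtain y where y: "mark d y" "nd c d y" using assms(7) unfolding ins_def by blast
  then obtain y' where y': "mark d' y'" "sim d y d' y'" using assms(6) unfolding eqs_def by blast
  have "nd c' d y" using y(2) nd_cong assms by blast
  then have "nd c' d' y'" using sim_nd[OF assms(2,3,4) y'(2)] by blast
  then show ?thesis using y' unfolding ins_def by blast
qed

lemma ins_nodeset: "code d \<Longrightarrow> ins w (nodeset d y) \<longleftrightarrow> (\<exists>x. edge d x y \<and> nd w d x)"
  unfolding ins_def using nodeset(3) nd_edge_cong[OF nodeset(2)] by blast

lemma nodeset_ins: "code d \<Longrightarrow> mark d y \<Longrightarrow> ins (nodeset d y) d"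
  unfolding ins_def using nodeset_nd by blast

text \<open>Each mark \<open>a\<close> of \<open>x\<close> yields a member
  \<open>nodeset x a\<close>. It is also denoted by a mark of \<open>y\<close>, and nodes denoting
  the same set are similar.\<close>

lemma set_ext:
  assumes x: "code x" and y: "code y" and *: "\<And>z. code z \<Longrightarrow> ins z x \<longleftrightarrow> ins z y"
  shows "eqs x y"
proof -
  have "\<exists>b. mark y b \<and> sim x a y b" if a: "mark x a" for a
  proof -
    have "ins (nodeset x a) y" using nodeset_ins[OF x a] * nodeset(1)[OF x] by blast
    then obtain b where b: "mark y b" "nd (nodeset x a) y b" unfolding ins_def by blast
    then show ?thesis using nd_sim[OF nodeset(1)[OF x] x y nodeset_nd[OF x] b(2)] a mark_ord by blast
  qed
  moreover have "\<exists>a. mark x a \<and> sim x a y b" if b: "mark y b" for b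
  proof -
    have "ins (nodeset y b) x" using nodeset_ins[OF y b] * nodeset(1)[OF y] by blast
    then obtain a where a: "mark x a" "nd (nodeset y b) x a" unfolding ins_def by blast
    then show ?thesis using nd_sim[OF nodeset(1)[OF y] x y a(2) nodeset_nd[OF y]] b mark_ord by blast
  qed
  ultimately show ?thesis unfolding eqs_def by blast
qed

text \<open>A mark stays if some code of the set it denotes satisfies \<open>\<Phi>\<close>; by
  \<open>nd_unique\<close> and \<open>cong\<close>, one such code does iff all do. The bound
  \<open>g k k\<close> is independent of \<open>\<Phi>\<close>, which Power Set relies on.\<close>

lemma separation:
  assumes a: "code a" and \<Phi>: "dfn (\<lambda>e. \<Phi> (e 0))"
    and cong: "\<And>c d. code c \<Longrightarrow> code d \<Longrightarrow> eqs c d \<Longrightarrow> \<Phi> c \<Longrightarrow> \<Phi> d"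
  obtains b where "code b" "\<And>w. code w \<Longrightarrow> ins w b \<longleftrightarrow> ins w a \<and> \<Phi> w" "\<And>k. bd a k \<Longrightarrow> bd b (g k k)"
proof -
  let ?P = "\<lambda>y. mark a y \<and> (\<exists>c. code c \<and> nd c a y \<and> \<Phi> c)"
  obtain l where l: "bd a l" using bd_ex[OF code_sord[OF a]] .
  have "dfn (\<lambda>e. ?P (e 0))" by (intro dfn_all_intros dfn_subst1[OF \<Phi>])
  then obtain b where b: "code b" "edge b = edge a" "\<And>x. mark b x \<longleftrightarrow> ?P x"
    "\<And>k. bd a k \<Longrightarrow> (\<And>x. ?P x \<Longrightarrow> x \<prec> k) \<Longrightarrow> bd b (g k k)"
    using remark[OF a, of ?P l] bd_mark[OF l] by blast
  show ?thesis
  proof (rule that)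
    show "ins w b \<longleftrightarrow> ins w a \<and> \<Phi> w" if w: "code w" for w
    proof
      assume "ins w b"
      then obtain y c where "mark a y" "code c" "nd c a y" "\<Phi> c" "nd w a y"
        unfolding ins_def b(3) nd_edge_cong[OF b(2)] by blast
      then show "ins w a \<and> \<Phi> w" using cong nd_unique w a unfolding ins_def by meson
    next
      assume "ins w a \<and> \<Phi> w"
      then show "ins w b" unfolding ins_def b(3) nd_edge_cong[OF b(2)] using w by blast
    qed
  qed (use b bd_mark in blast)+
qed

subsection \<open>The sets with small codes form a set\<close>

text \<open>POW lists the subsets of \<open>k\<close> as \<open>B \<xi>\<close>; the graphs coded by them are amalgamated by
  renaming the node \<open>x\<close> of \<open>B \<xi>\<close> to \<open>g \<xi> x\<close>, and adding a node \<open>g \<xi> k\<close> for the set that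
  \<open>B \<xi>\<close> denotes.\<close>

lemma codes_below:
  assumes k: "ord k"
  obtains b where "code b" "\<And>w. code w \<Longrightarrow> bd w k \<Longrightarrow> ins w b"
proof -
  obtain a where a: "sord a" "\<And>y. y \<prec> k \<longleftrightarrow> y \<in>\<^sub>o a" using INI[OF k] by blast
  obtain b where b: "sord b" and pow: "\<And>z x. x \<in>\<^sub>o z \<Longrightarrow> (\<forall>y. y \<in>\<^sub>o z \<longrightarrow> y \<in>\<^sub>o a) \<Longrightarrow>
    (\<exists>\<xi>. ord \<xi> \<and> (\<forall>y. ord y \<longrightarrow> (y \<in>\<^sub>o z \<longleftrightarrow> g y \<xi> \<in>\<^sub>o b)))"
    using POW[OF a(1)] by blast
  obtain k1 where k1: "bd b k1" using bd_ex[OF b] .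
  then have ok1: "ord k1" by (simp add: bd_def)
  \<comment> \<open>Above all nodes and all indices. It must exceed \<open>k1\<close> itself,
    because \<open>k1\<close> will serve as the index of the empty set.\<close>
  obtain k2 where k2: "k \<prec> k2" "k1 \<prec> k2" using upper2[OF k ok1] .
  have ok2: "ord k2" using k2 SOR(2) by blast
  define K where "K = g k2 k2"
  have oK: "ord K" unfolding K_def by (rule SOR)
  define B where "B \<xi> c \<longleftrightarrow> \<xi> \<prec> k2 \<and> code c \<and> (\<forall>x. x \<in>\<^sub>o c \<longleftrightarrow> x \<prec> k \<and> g x \<xi> \<in>\<^sub>o b)" for \<xi> c
  \<comment> \<open>The graph of \<open>c\<close> with a top node \<open>k\<close>, whose
    predecessors are the marked nodes. The place \<open>k\<close> is free, since edges of
    \<open>c\<close> run between nodes below \<open>k\<close>.\<close>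
  define R where "R c x y \<longleftrightarrow> edge c x y \<or> mark c x \<and> y = k" for c x y
  define E where "E n m \<longleftrightarrow> (\<exists>c \<xi> x y. B \<xi> c \<and> n = g \<xi> x \<and> m = g \<xi> y \<and> R c x y)" for n m
  define T where "T n \<longleftrightarrow> (\<exists>c \<xi>. B \<xi> c \<and> n = g \<xi> k)" for n
  define P where "P p \<longleftrightarrow> (\<exists>n m. E n m \<and> p = g n m) \<or> (\<exists>n. T n \<and> p = g n n)" for p
  have Bk: "bd c k" if "B \<xi> c" for \<xi> c
    using that k unfolding B_def bd_def by blast
  have B_ord: "ord \<xi>" if "B \<xi> c" for \<xi> c using that SOR(2) unfolding B_def by blast
  have B_code: "code c" if "B \<xi> c" for \<xi> c using that unfolding B_def by blast
  have B_unique: "c = c'" if "B \<xi> c" "B \<xi> c'" for \<xi> c c'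
    by (rule EXT) (use that code_sord in \<open>auto simp: B_def\<close>)
  have R: "x \<prec> k \<and> (y \<prec> k \<or> y = k) \<and> ord x \<and> ord y \<and> x \<noteq> y" if "B \<xi> c" "R c x y" for \<xi> c x y
  proof -
    have "x \<prec> k" "y \<prec> k \<or> y = k"
      using that bd_edge[OF Bk[OF that(1)], of x y] bd_mark[OF Bk[OF that(1)], of x] unfolding R_def by blast+
    moreover have "x \<noteq> y" using that(2) \<open>x \<prec> k\<close> WO(1) unfolding R_def edge_def by blast
    ultimately show ?thesis using SOR(2) k by blast
  qed
  have E: "n \<prec> K \<and> m \<prec> K \<and> n \<noteq> m \<and> ord n \<and> ord m" if nm: "E n m" for n m
  proof -
    obtain c \<xi> x y where *: "B \<xi> c" "n = g \<xi> x" "m = g \<xi> y" "R c x y" using nm unfolding E_def by blast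
    note R = R[OF *(1,4)]
    have "\<xi> \<prec> k2" using *(1) unfolding B_def by blast
    moreover have "x \<prec> k2" "y \<prec> k2" using R k2(1) WO(2)[of _ k k2] by blast+
    moreover have "g \<xi> x \<noteq> g \<xi> y" using g_inj[of \<xi> x \<xi> y] R B_ord[OF *(1)] by blast
    ultimately show ?thesis using * g_bound SOR(4) unfolding K_def by blast
  qed
  have T: "n \<prec> K \<and> ord n" if "T n" for n
    using that k2(1) g_bound SOR(4) unfolding T_def B_def K_def by blast
  have P_def2: "dfn (\<lambda>e. P (e 0))"
    unfolding P_def E_def T_def B_def R_def by (intro dfn_all_intros)
  have PK: "p \<prec> g K K" if "ord p" "P p" for p
    using that(2) E T g_bound unfolding P_def by blast
  obtain h where h: "sord h" "\<And>p. p \<in>\<^sub>o h \<longleftrightarrow> ord p \<and> P p"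
    by (rule compr[OF P_def2 PK SOR(4)[of K K]], assumption, assumption, rule that)
  have edge_h: "edge h n m \<longleftrightarrow> E n m" for n m
  proof
    assume "edge h n m"
    then have *: "ord n" "ord m" "n \<noteq> m" "P (g n m)" unfolding edge_def h(2) by blast+
    from *(4) consider n' m' where "E n' m'" "g n m = g n' m'" | n' where "T n'" "g n m = g n' n'"
      unfolding P_def by blast
    then show "E n m"
    proof cases
      case 1
      then show ?thesis using g_inj[OF *(1,2), of n' m'] E by blast
    next
      case 2
      then show ?thesis using g_inj[OF *(1,2), of n' n'] T *(3) by blast
    qed
  next
    assume "E n m"
    then show "edge h n m" using E[of n m] SOR(4) unfolding edge_def h(2) P_def by blast
  qed
  have mark_h: "mark h n \<longleftrightarrow> T n" for n
  proof
    assume "mark h n"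
    then have *: "ord n" "P (g n n)" unfolding mark_def h(2) by blast+
    from *(2) consider n' m' where "E n' m'" "g n n = g n' m'" | n' where "T n'" "g n n = g n' n'"
      unfolding P_def by blast
    then show "T n"
    proof cases
      case 1
      then show ?thesis using g_inj[OF *(1,1), of n' m'] E by blast
    next
      case 2
      then show ?thesis using g_inj[OF *(1,1), of n' n'] T by blast
    qed
  next
    assume "T n"
    then show "mark h n" using T[of n] SOR(4) unfolding mark_def h(2) P_def by blast
  qed
  \<comment> \<open>Injectivity of \<open>g\<close> keeps every edge inside one copy, and an edge
    whose target is below the top comes from an edge of \<open>c\<close>.\<close>
  have E_node: "\<exists>x'. n = g \<xi> x' \<and> edge c x' x" if "B \<xi> c" "E n (g \<xi> x)" "x \<prec> k" for \<xi> c n x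
  proof -
    obtain c' \<xi>' x' y' where *: "B \<xi>' c'" "n = g \<xi>' x'" "g \<xi> x = g \<xi>' y'" "R c' x' y'"
      using \<open>E n (g \<xi> x)\<close> unfolding E_def by blast
    have "\<xi> = \<xi>'" "x = y'"
      using g_inj[of \<xi> x \<xi>' y'] *(3) B_ord[OF *(1)] B_ord[OF that(1)] R[OF *(1,4)] SOR(2)[OF that(3)] by blast+
    moreover have "c = c'" using B_unique that(1) *(1) \<open>\<xi> = \<xi>'\<close> by blast
    ultimately show ?thesis using * that(3) WO(1) unfolding R_def by blast
  qed
  have h_code: "code h" unfolding code_def
  proof (intro conjI allI impI, rule h)
    fix z assume z: "sord z" and ne: "\<exists>x. x \<in>\<^sub>o z"
    show "\<exists>x. x \<in>\<^sub>o z \<and> (\<forall>y. y \<in>\<^sub>o z \<longrightarrow> \<not> edge h y x)"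
    \<comment> \<open>If \<open>z\<close> meets a copy below its top, the well-foundedness of that
      copy gives a minimal node. Otherwise no element of \<open>z\<close> is the source of an edge,
      and any element will do.\<close>
    proof (cases "\<exists>c \<xi> x. B \<xi> c \<and> x \<prec> k \<and> g \<xi> x \<in>\<^sub>o z")
      case True
      then obtain c \<xi> x where c: "B \<xi> c" and x: "x \<prec> k" "g \<xi> x \<in>\<^sub>o z" by blast
      have Q: "dfn (\<lambda>e. e 0 \<prec> k \<and> g \<xi> (e 0) \<in>\<^sub>o z)" by (intro dfn_all_intros)
      obtain z' where z': "sord z'" "\<And>x. x \<in>\<^sub>o z' \<longleftrightarrow> ord x \<and> x \<prec> k \<and> g \<xi> x \<in>\<^sub>o z"
        by (rule compr[OF Q _ k], erule conjunct1, rule that)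
      have "x \<in>\<^sub>o z'" using x z' SOR(2) by blast
      then obtain m where m: "m \<in>\<^sub>o z'" "\<And>y. y \<in>\<^sub>o z' \<Longrightarrow> \<not> edge c y m"
        using B_code[OF c] z'(1) unfolding code_def by meson
      have mk: "m \<prec> k" "g \<xi> m \<in>\<^sub>o z" using m(1) z' by blast+
      have "\<not> edge h y (g \<xi> m)" if "y \<in>\<^sub>o z" for y
      proof
        assume "edge h y (g \<xi> m)"
        then obtain x' where x': "y = g \<xi> x'" "edge c x' m" using E_node[OF c _ mk(1)] edge_h by blast
        then have "x' \<in>\<^sub>o z'" using z'(2) that bd_edge[OF Bk[OF c]] edge_ord by blast
        then show False using m(2) x'(2) by blast
      qed
      then show ?thesis using mk(2) by blast
    next
      case False
      have "\<not> edge h y x" if "y \<in>\<^sub>o z" for x y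
      proof
        assume "edge h y x"
        then obtain c \<xi> x' y' where *: "B \<xi> c" "y = g \<xi> x'" "R c x' y'" unfolding edge_h E_def by blast
        then show False using False that R[OF *(1,3)] by blast
      qed
      then show ?thesis using ne by blast
    qed
  qed
  \<comment> \<open>Below the top, the renaming is an isomorphism onto the copy; similarity follows
    by induction along the edges of \<open>c\<close>.\<close>
  have sim_h: "sim c x h (g \<xi> x)" if c: "B \<xi> c" and x: "x \<prec> k" for \<xi> c x
  proof -
    have "x \<prec> k \<longrightarrow> sim c x h (g \<xi> x)"
    proof (rule code_induct[OF B_code[OF c], of "\<lambda>x. x \<prec> k \<longrightarrow> sim c x h (g \<xi> x)"])
      show "dfn (\<lambda>e. e 0 \<prec> k \<longrightarrow> sim c (e 0) h (g \<xi> (e 0)))" by (intro dfn_all_intros)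
      show "x \<prec> k \<longrightarrow> sim c x h (g \<xi> x)"
        if IH: "\<And>y. edge c y x \<Longrightarrow> y \<prec> k \<longrightarrow> sim c y h (g \<xi> y)" and "ord x" for x
      proof
        assume xk: "x \<prec> k"
        have edge: "edge h (g \<xi> x') (g \<xi> x)" if "edge c x' x" for x'
          using that c unfolding edge_h E_def R_def by blast
        have IH': "sim c x' h (g \<xi> x')" if "edge c x' x" for x'
          using IH[OF that] bd_edge[OF Bk[OF c] that] by blast
        show "sim c x h (g \<xi> x)"
        proof (rule sim_edgeI[OF code_sord[OF B_code[OF c]] h(1) \<open>ord x\<close> SOR(4)])
          show "\<exists>y'. edge h y' (g \<xi> x) \<and> sim c x' h y'" if "edge c x' x" for x'
            using edge[OF that] IH'[OF that] by blast
          show "\<exists>x'. edge c x' x \<and> sim c x' h y'" if "edge h y' (g \<xi> x)" for y'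
            using E_node[OF c _ xk, of y'] that IH' unfolding edge_h by blast
        qed
      qed
    qed (use x SOR(2) in blast)
    then show ?thesis using x by blast
  qed
  have nd_h: "nd c h (g \<xi> k)" if c: "B \<xi> c" for \<xi> c
    unfolding nd_def
  proof (intro conjI allI impI)
    show "\<exists>y'. edge h y' (g \<xi> k) \<and> sim c x h y'" if "mark c x" for x
    proof -
      have "edge h (g \<xi> x) (g \<xi> k)" using that c unfolding edge_h E_def R_def by blast
      then show ?thesis using sim_h[OF c bd_mark[OF Bk[OF c] that]] by blast
    qed
    show "\<exists>x. mark c x \<and> sim c x h y'" if y': "edge h y' (g \<xi> k)" for y'
    proof -
      obtain c' \<xi>' x z where *: "B \<xi>' c'" "y' = g \<xi>' x" "g \<xi> k = g \<xi>' z" "R c' x z"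
        using y' unfolding edge_h E_def by blast
      have "\<xi> = \<xi>'" "k = z"
        using g_inj[of \<xi> k \<xi>' z] *(3) B_ord[OF *(1)] B_ord[OF c] R[OF *(1,4)] k by blast+
      moreover have "c = c'" using B_unique c *(1) \<open>\<xi> = \<xi>'\<close> by blast
      moreover have "\<not> edge c x k" using bd_edge[OF Bk[OF c]] WO(1) by blast
      ultimately have "mark c x" using *(4) unfolding R_def by blast
      then show ?thesis
        using sim_h[OF c bd_mark[OF Bk[OF c]]] *(2) \<open>\<xi> = \<xi>'\<close> by blast
    qed
  qed
  show ?thesis
  proof (rule that[OF h_code])
    fix w assume w: "code w" "bd w k"
    have wk: "x \<prec> k" if "x \<in>\<^sub>o w" for x using w(2) that unfolding bd_def by blast
    have "\<exists>\<xi>. B \<xi> w"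
    proof (cases "\<exists>x. x \<in>\<^sub>o w")
      case True
      then obtain x where x: "x \<in>\<^sub>o w" by blast
      have "\<forall>y. y \<in>\<^sub>o w \<longrightarrow> y \<in>\<^sub>o a" using wk a(2) by blast
      then obtain \<xi> where \<xi>: "ord \<xi>" "\<And>y. ord y \<Longrightarrow> y \<in>\<^sub>o w \<longleftrightarrow> g y \<xi> \<in>\<^sub>o b" using pow[OF x] by blast
      have "ord x" using x SOR(3) by blast
      then have "g x \<xi> \<prec> k1" using \<xi>(2) x k1 unfolding bd_def by blast
      then have "\<xi> \<prec> k1" using g_lessD[OF \<open>ord x\<close> \<xi>(1)] by blast
      then have "\<xi> \<prec> k2" using k2 WO(2) by blast
      then have "B \<xi> w" using w(1) \<xi>(2) wk SOR(2) unfolding B_def by blast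
      then show ?thesis by blast
    next
      case False
      \<comment> \<open>POW lists nonempty sets only. The index \<open>k1\<close> yields the empty
        one: \<open>g x k1\<close> is at least \<open>k1\<close>, which bounds
        \<open>b\<close>.\<close>
      have "\<not> g x k1 \<in>\<^sub>o b" if "x \<prec> k" for x
        using g_lessD[of x k1 k1] ok1 SOR(2)[OF that] WO(1)[of k1] k1 unfolding bd_def by blast
      then have "B k1 w" using False k2 w(1) unfolding B_def by blast
      then show ?thesis by blast
    qed
    then obtain \<xi> where \<xi>: "B \<xi> w" by blast
    then have "mark h (g \<xi> k)" unfolding mark_h T_def by blast
    then show "ins w h" using nd_h[OF \<xi>] unfolding ins_def by blast
  qed
qed

text \<open>Separation from the set given by \<open>codes_below\<close>. Only some code of each set
  has to lie below \<open>k\<close>, since membership respects \<open>eqs\<close>.\<close>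

lemma collect:
  assumes \<Phi>: "dfn (\<lambda>e. \<Phi> (e 0))"
    and cong: "\<And>c d. code c \<Longrightarrow> code d \<Longrightarrow> eqs c d \<Longrightarrow> \<Phi> c \<Longrightarrow> \<Phi> d"
    and k: "ord k" "\<And>w. code w \<Longrightarrow> \<Phi> w \<Longrightarrow> \<exists>w'. code w' \<and> eqs w w' \<and> bd w' k"
  shows "\<exists>b. code b \<and> (\<forall>w. code w \<longrightarrow> (ins w b \<longleftrightarrow> \<Phi> w))"
proof -
  obtain a where a: "code a" "\<And>w. code w \<Longrightarrow> bd w k \<Longrightarrow> ins w a" by (rule codes_below[OF k(1)], rule that; blast)
  have *: "ins w a" if w: "code w" "\<Phi> w" for w
  proof -
    obtain w' where w': "code w'" "eqs w w'" "bd w' k" using k(2)[OF w] by blast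
    show ?thesis using ins_cong[OF w'(1) w(1) a(1) a(1) eqs_sym[OF w(1) w'(1,2)] eqs_refl[OF a(1)] a(2)[OF w'(1,3)]] .
  qed
  obtain b where "code b" "\<And>w. code w \<Longrightarrow> ins w b \<longleftrightarrow> ins w a \<and> \<Phi> w"
    by (rule separation[OF a(1) \<Phi> cong]) (assumption+, rule that)
  then show ?thesis using * by blast
qed

subsection \<open>The axioms of ZFC\<close>

lemma ins_congL: "code c \<Longrightarrow> code c' \<Longrightarrow> code d \<Longrightarrow> eqs c c' \<Longrightarrow> ins c d \<Longrightarrow> ins c' d"
  using ins_cong eqs_refl by blast

lemma ins_congR: "code c \<Longrightarrow> code d \<Longrightarrow> code d' \<Longrightarrow> eqs d d' \<Longrightarrow> ins c d \<Longrightarrow> ins c d'"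
  using ins_cong eqs_refl by blast

text \<open>Without a minimal member, induction shows that no node is similar to a mark of
  \<open>x\<close>: a mark \<open>v\<close> similar to \<open>u\<close> would have an element that
  is also a member of \<open>x\<close>, denoted by a predecessor of \<open>v\<close> and by a mark
  \<open>w\<close>, so a predecessor of \<open>u\<close> would be similar to \<open>w\<close>. But a
  mark exists and is similar to itself.\<close>

lemma foundation:
  assumes x: "code x" and y: "code y" "ins y x"
  shows "\<exists>y. code y \<and> ins y x \<and> \<not> (\<exists>z. code z \<and> ins z x \<and> ins z y)"
proof (rule ccontr)
  assume no: "\<not> ?thesis"
  let ?P = "\<lambda>u. \<not> (\<exists>v. mark x v \<and> sim x u x v)"
  have "?P u" if "ord u" for u
  proof (rule code_induct[OF x, of ?P])
    show "dfn (\<lambda>e. ?P (e 0))" by (intro dfn_all_intros)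
    show "?P u" if u: "ord u" and IH: "\<And>u'. edge x u' u \<Longrightarrow> ?P u'" for u
    proof
      assume "\<exists>v. mark x v \<and> sim x u x v"
      then obtain v where v: "mark x v" "sim x u x v" by blast
      obtain z where z: "code z" "ins z x" "ins z (nodeset x v)"
        using no nodeset_ins[OF x v(1)] nodeset(1)[OF x, of v] by blast
      obtain v' where v': "edge x v' v" "nd z x v'" using z(3) ins_nodeset[OF x] by blast
      obtain u' where u': "edge x u' u" "sim x u' x v'"
        using sim_edgeD(2)[OF v(2) code_sord[OF x] code_sord[OF x] v'(1)] by blast
      obtain w where w: "mark x w" "nd z x w" using z(2) unfolding ins_def by blast
      have "sim x v' x w" using nd_sim[OF z(1) x x v'(2) w(2)] edge_ord[OF v'(1)] mark_ord[OF w(1)] by blast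
      then have "sim x u' x w" using sim_trans[OF x x x u'(2)] by blast
      then show False using IH[OF u'(1)] w(1) by blast
    qed
  qed (rule that)
  moreover obtain v where "mark x v" using y(2) unfolding ins_def by blast
  ultimately show False using sim_refl[OF x] mark_ord by blast
qed

lemma pairing:
  assumes x: "code x" and y: "code y"
  shows "\<exists>z. code z \<and> (\<forall>w. code w \<longrightarrow> (ins w z \<longleftrightarrow> eqs w x \<or> eqs w y))"
proof -
  obtain k where k: "bd x k" "bd y k"
    using upper[OF code_sord[OF x] code_sord[OF y] SOR(4) SOR(4)] by blast
  show ?thesis
  proof (rule collect)
    show "dfn (\<lambda>e. eqs (e 0) x \<or> eqs (e 0) y)" by (intro dfn_all_intros)
    show "ord k" using k by (simp add: bd_def)
    show "eqs d x \<or> eqs d y" if "code c" "code d" "eqs c d" "eqs c x \<or> eqs c y" for c d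
      using that x y eqs_sym[OF that(1-3)] eqs_trans[OF that(2,1)] by blast
  qed (use x y k in blast)
qed

text \<open>Elements of members of \<open>x\<close> are denoted by nodes of \<open>x\<close> itself,
  so they have \<open>nodeset\<close> codes below \<open>g k k\<close>.\<close>

lemma union:
  assumes x: "code x"
  shows "\<exists>u. code u \<and> (\<forall>z. code z \<longrightarrow> (ins z u \<longleftrightarrow> (\<exists>y. code y \<and> ins y x \<and> ins z y)))"
proof -
  obtain k where k: "bd x k" using bd_ex[OF code_sord[OF x]] .
  show ?thesis
  proof (rule collect)
    show "dfn (\<lambda>e. \<exists>y. code y \<and> ins y x \<and> ins (e 0) y)" by (intro dfn_all_intros)
    show "\<exists>y. code y \<and> ins y x \<and> ins d y"
      if "code c" "code d" "eqs c d" "\<exists>y. code y \<and> ins y x \<and> ins c y" for c d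
      using that ins_congL by blast
    show "ord (g k k)" by (rule SOR)
    show "\<exists>z'. code z' \<and> eqs z z' \<and> bd z' (g k k)"
      if z: "code z" "\<exists>y. code y \<and> ins y x \<and> ins z y" for z
    proof -
      obtain y where y: "code y" "ins y x" "ins z y" using z(2) by blast
      obtain u where u: "mark x u" "nd y x u" using y(2) unfolding ins_def by blast
      have "ins z (nodeset x u)" using ins_congR[OF z(1) y(1) nodeset(1)[OF x] _ y(3)] u(2) nd_iff_nodeset[OF x] by blast
      then obtain v where "nd z x v" using ins_nodeset[OF x] by blast
      then show ?thesis using nd_iff_nodeset[OF x] nodeset(1)[OF x] nodeset(4)[OF x k] by blast
    qed
  qed
qed

text \<open>Every subset equals one separated from \<open>x\<close>, and the code of that one is
  below \<open>g k k\<close> whatever the subset.\<close>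

lemma powerset:
  assumes x: "code x"
  shows "\<exists>y. code y \<and> (\<forall>z. code z \<longrightarrow> (ins z y \<longleftrightarrow> (\<forall>w. code w \<longrightarrow> ins w z \<longrightarrow> ins w x)))"
proof -
  obtain k where k: "bd x k" using bd_ex[OF code_sord[OF x]] .
  show ?thesis
  proof (rule collect)
    show "dfn (\<lambda>e. \<forall>w. code w \<longrightarrow> ins w (e 0) \<longrightarrow> ins w x)" by (intro dfn_all_intros)
    show "\<forall>w. code w \<longrightarrow> ins w d \<longrightarrow> ins w x"
      if "code c" "code d" "eqs c d" "\<forall>w. code w \<longrightarrow> ins w c \<longrightarrow> ins w x" for c d
      using that(4) ins_congR[OF _ that(2,1) eqs_sym[OF that(1-3)]] by blast
    show "ord (g k k)" by (rule SOR)
    show "\<exists>z'. code z' \<and> eqs z z' \<and> bd z' (g k k)"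
      if z: "code z" "\<forall>w. code w \<longrightarrow> ins w z \<longrightarrow> ins w x" for z
    proof -
      have Q: "dfn (\<lambda>e. ins (e 0) z)" by (intro dfn_all_intros)
      have cong: "ins d z" if "code c" "code d" "eqs c d" "ins c z" for c d
        using ins_congL[OF that(1,2) z(1) that(3,4)] .
      obtain b where b: "code b" "\<And>w. code w \<Longrightarrow> ins w b \<longleftrightarrow> ins w x \<and> ins w z"
        "\<And>k. bd x k \<Longrightarrow> bd b (g k k)"
        by (rule separation[OF x Q cong]) (assumption+, rule that)
      have "eqs z b" by (rule set_ext[OF z(1) b(1)]) (use b(2) z(2) in blast)
      then show ?thesis using b(1) b(3)[OF k] by blast
    qed
  qed
qed

text \<open>\<open>\<Psi>\<close> relates codes and is functional only up to \<open>eqs\<close>. REP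
  is applied instead to \<open>F\<close>, which sends a node of \<open>a\<close> to the least bound
  of a code of a value; least ordinals are unique.\<close>

lemma replacement:
  assumes a: "code a" and \<Psi>: "dfn (\<lambda>e. \<Psi> (e 0) (e 1))"
    and cong: "\<And>x x' y y'. code x \<Longrightarrow> code x' \<Longrightarrow> code y \<Longrightarrow> code y' \<Longrightarrow> eqs x x' \<Longrightarrow> eqs y y' \<Longrightarrow> \<Psi> x y \<Longrightarrow> \<Psi> x' y'"
    and fct: "\<And>x y z. code x \<Longrightarrow> code y \<Longrightarrow> code z \<Longrightarrow> \<Psi> x y \<Longrightarrow> \<Psi> x z \<Longrightarrow> eqs y z"
  shows "\<exists>b. code b \<and> (\<forall>y. code y \<longrightarrow> (ins y b \<longleftrightarrow> (\<exists>x. code x \<and> ins x a \<and> \<Psi> x y)))"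
proof -
  define Q where "Q u k \<longleftrightarrow> (\<exists>c w. code c \<and> nd c a u \<and> code w \<and> \<Psi> c w \<and> bd w k)" for u k
  define F where "F u k \<longleftrightarrow> Q u k \<and> (\<forall>l. l \<prec> k \<longrightarrow> \<not> Q u l)" for u k
  have dfn_Q: "dft s \<Longrightarrow> dft t \<Longrightarrow> dfn (\<lambda>e. Q (s e) (t e))" for s t
    by (rule dfn_subst2) (unfold Q_def, intro dfn_all_intros dfn_subst2[OF \<Psi>])
  have dfn_F: "dfn (\<lambda>e. F (e 0) (e 1))"
    unfolding F_def by (intro dfn_intros dfn_Q)
  obtain l where l: "bd a l" using bd_ex[OF code_sord[OF a]] .
  have dfn_m: "dfn (\<lambda>e. mark a (e 0))" by (intro dfn_all_intros)
  have ol: "ord l" using l by (simp add: bd_def)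
  obtain m where m: "sord m" "\<And>u. u \<in>\<^sub>o m \<longleftrightarrow> ord u \<and> mark a u"
    by (rule compr[OF dfn_m bd_mark[OF l] ol], assumption, rule that)
  have "k = k'" if "ord k" "ord k'" "F u k" "F u k'" for u k k'
    using WO(3)[OF that(1,2)] that(3,4) unfolding F_def by blast
  then obtain K where K: "ord K" "\<And>u k. u \<in>\<^sub>o m \<Longrightarrow> ord k \<Longrightarrow> F u k \<Longrightarrow> k \<prec> K"
    using REP[OF dfn_F m(1)] by blast
  show ?thesis
  proof (rule collect)
    show "dfn (\<lambda>e. \<exists>x. code x \<and> ins x a \<and> \<Psi> x (e 0))" by (intro dfn_all_intros dfn_subst2[OF \<Psi>])
    show "\<exists>x. code x \<and> ins x a \<and> \<Psi> x d"
      if c: "code c" "code d" "eqs c d" "\<exists>x. code x \<and> ins x a \<and> \<Psi> x c" for c d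
    proof -
      obtain x where "code x" "ins x a" "\<Psi> x c" using c(4) by blast
      then show ?thesis using cong[OF _ _ c(1,2) eqs_refl c(3)] by blast
    qed
    show "ord K" by (rule K)
    show "\<exists>w'. code w' \<and> eqs w w' \<and> bd w' K"
      if w: "code w" "\<exists>x. code x \<and> ins x a \<and> \<Psi> x w" for w
    proof -
      obtain x where x: "code x" "ins x a" "\<Psi> x w" using w(2) by blast
      obtain u where u: "mark a u" "nd x a u" using x(2) unfolding ins_def by blast
      obtain k0 where k0: "bd w k0" using bd_ex[OF code_sord[OF w(1)]] .
      then have "ord k0" "Q u k0" using x u w(1) unfolding Q_def by (auto simp: bd_def)
      then obtain k where k: "ord k" "Q u k" "\<And>l. l \<prec> k \<Longrightarrow> \<not> Q u l"
        using least[OF dfn_Q[OF dft_const dft_var], of k0] by blast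
      then have "k \<prec> K" using K(2)[of u k] m(2) u(1) mark_ord[OF u(1)] unfolding F_def by blast
      obtain c w' where c: "code c" "nd c a u" "code w'" "\<Psi> c w'" "bd w' k"
        using k(2) unfolding Q_def by blast
      \<comment> \<open>One node denotes both \<open>c\<close> and \<open>x\<close>, so the small
        value \<open>w'\<close> of \<open>c\<close> is also a value of \<open>x\<close> and hence
        equal to \<open>w\<close>.\<close>
      have "eqs c x" using nd_unique[OF c(1) x(1) a c(2) u(2)] .
      then have "\<Psi> x w'" using cong[OF c(1) x(1) c(3) c(3) _ eqs_refl[OF c(3)] c(4)] by blast
      then have "eqs w w'" using fct[OF x(1) w(1) c(3) x(3)] by blast
      then show ?thesis using c(3) bd_less[OF c(5) \<open>k \<prec> K\<close>] by blast
    qed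
  qed
qed

text \<open>\<open>h\<close> codes the limit \<open>l\<close> of INF as a von Neumann ordinal: every
  node below \<open>l\<close> is marked and denotes the set of what the smaller nodes
  denote.\<close>

lemma infinity:
  "\<exists>x. code x \<and> (\<exists>y. code y \<and> ins y x \<and> (\<forall>z. code z \<longrightarrow> \<not> ins z y)) \<and>
    (\<forall>y. code y \<longrightarrow> ins y x \<longrightarrow> (\<exists>z. code z \<and> ins z x \<and>
      (\<forall>w. code w \<longrightarrow> (ins w z \<longleftrightarrow> ins w y \<or> eqs w y))))"
proof -
  obtain l x0 where l: "x0 \<prec> l" "\<And>x. x \<prec> l \<Longrightarrow> \<exists>y. x \<prec> y \<and> y \<prec> l" using INF by blast
  have ol: "ord l" using l(1) SOR(2) by blast
  let ?P = "\<lambda>p. \<exists>u v. (u \<prec> v \<or> u = v) \<and> v \<prec> l \<and> p = g u v"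
  have Q: "dfn (\<lambda>e. ?P (e 0))" by (intro dfn_all_intros)
  have PK: "p \<prec> g l l" if "ord p" "?P p" for p
    using that(2) g_bound WO(2) by blast
  obtain h where h: "sord h" "\<And>p. p \<in>\<^sub>o h \<longleftrightarrow> ord p \<and> ?P p"
    by (rule compr[OF Q PK SOR(4)[of l l]], assumption, assumption, rule that)
  have gh: "g u v \<in>\<^sub>o h \<longleftrightarrow> (u \<prec> v \<or> u = v) \<and> v \<prec> l" if "ord u" "ord v" for u v
  proof
    assume "g u v \<in>\<^sub>o h"
    then obtain u' v' where *: "u' \<prec> v' \<or> u' = v'" "v' \<prec> l" "g u v = g u' v'" unfolding h(2) by blast
    then have "ord u'" "ord v'" using SOR(2) by blast+
    then show "(u \<prec> v \<or> u = v) \<and> v \<prec> l" using g_inj[OF that, of u' v'] * by blast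
  next
    assume "(u \<prec> v \<or> u = v) \<and> v \<prec> l"
    then show "g u v \<in>\<^sub>o h" unfolding h(2) using SOR(4) by blast
  qed
  have edge: "edge h u v \<longleftrightarrow> u \<prec> v \<and> v \<prec> l" for u v
    unfolding edge_def using gh[of u v] SOR(2)[of u v] WO(1)[of u] by blast
  have mark: "mark h u \<longleftrightarrow> u \<prec> l" for u
    unfolding mark_def using gh[of u u] SOR(2)[of u l] by blast
  have c: "code h" unfolding code_def edge
  proof (intro conjI allI impI, rule h)
    fix z assume "sord z" "\<exists>x. x \<in>\<^sub>o z"
    then obtain x where "x \<in>\<^sub>o z" "\<forall>y. y \<prec> x \<longrightarrow> \<not> y \<in>\<^sub>o z" using WO(4) by blast
    then show "\<exists>x. x \<in>\<^sub>o z \<and> (\<forall>y. y \<in>\<^sub>o z \<longrightarrow> \<not> (y \<prec> x \<and> x \<prec> l))" by blast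
  qed
  show ?thesis
  proof (rule exI[of _ h], intro conjI allI impI, rule c)
    have D: "dfn (\<lambda>e. e 0 \<prec> l)" by (intro dfn_intros)
    \<comment> \<open>The least ordinal has no predecessors and denotes the empty set.\<close>
    obtain o0 where o0: "o0 \<prec> l" "\<And>y. y \<prec> o0 \<Longrightarrow> \<not> y \<prec> l"
      using least[OF D SOR(2)[OF l(1), THEN conjunct1] l(1)] by metis
    have "\<not> edge h u o0" for u using o0 WO(2) unfolding edge by blast
    then have "\<not> ins z (nodeset h o0)" for z using ins_nodeset[OF c] by blast
    then show "\<exists>y. code y \<and> ins y h \<and> (\<forall>z. code z \<longrightarrow> \<not> ins z y)"
      using nodeset_ins[OF c, of o0] mark o0(1) nodeset(1)[OF c] by blast
  next
    fix y assume y: "code y" "ins y h"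
    then obtain u where u: "u \<prec> l" "nd y h u" unfolding ins_def mark by blast
    obtain v0 where v0: "u \<prec> v0" "v0 \<prec> l" using l(2)[OF u(1)] by blast
    have D: "dfn (\<lambda>e. u \<prec> e 0)" by (intro dfn_intros)
    \<comment> \<open>The successor of \<open>u\<close>, below \<open>l\<close> because
      \<open>l\<close> is a limit. Its predecessors are \<open>u\<close> and those of
      \<open>u\<close>.\<close>
    obtain v where v: "u \<prec> v" "\<And>v'. v' \<prec> v \<Longrightarrow> \<not> u \<prec> v'"
      using least[OF D SOR(2)[OF v0(1), THEN conjunct2] v0(1)] by metis
    have "v \<prec> l"
      using v v0 WO(2)[of v v0 l] WO(3)[of v v0] SOR(2) by blast
    have edge_v: "edge h w v \<longleftrightarrow> w \<prec> u \<or> w = u" for w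
    proof -
      have "w \<prec> u \<or> w = u" if "w \<prec> v"
        using v(2)[OF that] WO(3)[of w u] SOR(2)[OF that] SOR(2)[OF v(1)] by blast
      then show ?thesis using v(1) WO(2)[of w u v] \<open>v \<prec> l\<close> unfolding edge by blast
    qed
    have edge_u: "edge h w u \<longleftrightarrow> w \<prec> u" for w using u(1) unfolding edge by blast
    have "ins w (nodeset h v) \<longleftrightarrow> ins w y \<or> eqs w y" if w: "code w" for w
    proof -
      have yu: "eqs y (nodeset h u)" using u(2) nd_iff_nodeset[OF c] by blast
      have "ins w y \<longleftrightarrow> ins w (nodeset h u)"
        using ins_congR[OF w y(1) nodeset(1)[OF c] yu] ins_congR[OF w nodeset(1)[OF c] y(1) eqs_sym[OF y(1) nodeset(1)[OF c] yu]] by blast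
      moreover have "eqs w y \<longleftrightarrow> nd w h u"
        using nd_unique[OF w y(1) c _ u(2)] nd_cong[OF w y(1) c, of u] u(2) by blast
      ultimately show ?thesis unfolding ins_nodeset[OF c] edge_v edge_u by blast
    qed
    then show "\<exists>z. code z \<and> ins z h \<and> (\<forall>w. code w \<longrightarrow> (ins w z \<longleftrightarrow> ins w y \<or> eqs w y))"
      using nodeset_ins[OF c, of v] mark \<open>v \<prec> l\<close> nodeset(1)[OF c] by blast
  qed
qed

text \<open>The transversal picks from each member of \<open>x\<close> the least node that is below some mark denoting
  this member.\<close>

lemma choice:
  assumes x: "code x"
    and ne: "\<And>y. code y \<Longrightarrow> ins y x \<Longrightarrow> \<exists>w. code w \<and> ins w y"
    and disj: "\<And>y z w. code y \<Longrightarrow> code z \<Longrightarrow> ins y x \<Longrightarrow> ins z x \<Longrightarrow> \<not> eqs y z \<Longrightarrow> code w \<Longrightarrow> ins w y \<Longrightarrow> \<not> ins w z"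
  shows "\<exists>c. code c \<and> (\<forall>y. code y \<longrightarrow> ins y x \<longrightarrow>
    (\<exists>z. code z \<and> (\<forall>w. code w \<longrightarrow> (ins w c \<and> ins w y \<longleftrightarrow> eqs w z))))"
proof -
  \<comment> \<open>All marks similar to \<open>u\<close> contribute, so \<open>N u\<close> and its
    least element depend only on the member that \<open>u\<close> denotes.\<close>
  define N where "N u p \<longleftrightarrow> (\<exists>v. mark x v \<and> sim x v x u \<and> edge x p v)" for u p
  define L where "L u p \<longleftrightarrow> N u p \<and> (\<forall>q. q \<prec> p \<longrightarrow> \<not> N u q)" for u p
  define P where "P p \<longleftrightarrow> (\<exists>u. mark x u \<and> L u p)" for p
  have dfn_N: "dfn (\<lambda>e. N u (e 0))" for u unfolding N_def by (intro dfn_all_intros)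
  have dfn_P: "dfn (\<lambda>e. P (e 0))" unfolding P_def L_def N_def by (intro dfn_all_intros)
  have N_cong: "N u p \<longleftrightarrow> N u' p" if "sim x u x u'" for u u' p
    using sim_trans[OF x x x _ that] sim_trans[OF x x x _ sim_sym[OF x x that]] unfolding N_def by blast
  obtain l where l: "bd x l" using bd_ex[OF code_sord[OF x]] .
  have P_l: "p \<prec> l" if "P p" for p using that bd_edge[OF l] unfolding P_def L_def N_def by blast
  obtain c where c: "code c" "edge c = edge x" "\<And>p. mark c p \<longleftrightarrow> P p"
    by (rule remark[OF x dfn_P P_l], assumption, rule that)
  have nd_c: "nd w c p \<longleftrightarrow> nd w x p" for w p by (rule nd_edge_cong[OF c(2)])
  show ?thesis
  proof (rule exI[of _ c], intro conjI allI impI, rule c)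
    fix y assume y: "code y" "ins y x"
    obtain u where u: "mark x u" "nd y x u" using y(2) unfolding ins_def by blast
    have ou: "ord u" using u(1) mark_ord by blast
    have yu: "eqs y (nodeset x u)" using u(2) nd_iff_nodeset[OF x] by blast
    obtain w0 where w0: "code w0" "ins w0 y" using ne[OF y] by blast
    then have "ins w0 (nodeset x u)" using ins_congR[OF w0(1) y(1) nodeset(1)[OF x] yu] by blast
    then obtain p0 where "edge x p0 u" unfolding ins_nodeset[OF x] by blast
    then have "N u p0" "ord p0" unfolding N_def using u(1) sim_refl[OF x ou] edge_ord by blast+
    then obtain p where p: "ord p" "N u p" "\<And>q. q \<prec> p \<Longrightarrow> \<not> N u q" using least[OF dfn_N] by blast
    have Lp: "L u p" using p unfolding L_def by blast
    have L_unique: "q = p" if "L u q" "ord q" for q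
      using Lp that p(1) WO(3)[of p q] unfolding L_def by blast
    obtain v where v: "mark x v" "sim x v x u" "edge x p v" using p(2) unfolding N_def by blast
    have py: "ins w y" if w: "code w" "nd w x p" for w
    proof -
      \<comment> \<open>The chosen \<open>p\<close> may be a predecessor of another mark
        \<open>v\<close> of the same member; similarity supplies a predecessor of \<open>u\<close>
        that denotes the same element.\<close>
      obtain r where r: "edge x r u" "sim x p x r"
        using sim_edgeD(1)[OF v(2) code_sord[OF x] code_sord[OF x] v(3)] by blast
      have "nd w x r" using sim_nd[OF w(1) x x r(2) w(2)] .
      then have "ins w (nodeset x u)" using r(1) unfolding ins_nodeset[OF x] by blast
      then show ?thesis using ins_congR[OF w(1) nodeset(1)[OF x] y(1) eqs_sym[OF y(1) nodeset(1)[OF x] yu]] by blast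
    qed
    have "ins w c \<and> ins w y \<longleftrightarrow> eqs w (nodeset x p)" if w: "code w" for w
    proof
      assume "eqs w (nodeset x p)"
      then have wp: "nd w x p" using nd_iff_nodeset[OF x] by blast
      then have "ins w c" unfolding ins_def c(3) nd_c P_def using u(1) Lp by blast
      then show "ins w c \<and> ins w y" using py[OF w wp] by blast
    next
      assume a: "ins w c \<and> ins w y"
      then obtain q u' where q: "nd w x q" "mark x u'" "L u' q" unfolding ins_def c(3) nd_c P_def by blast
      obtain v' where v': "mark x v'" "sim x v' x u'" "edge x q v'" using q(3) unfolding L_def N_def by blast
      have "ins w (nodeset x v')" using q(1) v'(3) unfolding ins_nodeset[OF x] by blast
      then have "eqs (nodeset x v') y"
        using disj[OF nodeset(1)[OF x] y(1) nodeset_ins[OF x v'(1)] y(2) _ w] a by blast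
      then have "nd y x v'" using nd_iff_nodeset[OF x] eqs_sym[OF nodeset(1)[OF x] y(1)] by blast
      then have "sim x v' x u" using nd_sim[OF y(1) x x _ u(2)] mark_ord[OF v'(1)] ou by blast
      then have "sim x u' x u" using sim_trans[OF x x x sim_sym[OF x x v'(2)]] by blast
      then have "L u q" using q(3) N_cong unfolding L_def by blast
      then have "q = p" using L_unique edge_ord[OF v'(3)] by blast
      then show "eqs w (nodeset x p)" using q(1) nd_iff_nodeset[OF x] by blast
    qed
    then show "\<exists>z. code z \<and> (\<forall>w. code w \<longrightarrow> (ins w c \<and> ins w y \<longleftrightarrow> eqs w z))" using nodeset(1)[OF x] by blast
  qed
qed

end

section \<open>The interpretation\<close>

instance so_fun :: countable by countable_datatype
instance so_rel :: countable by countable_datatype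

text \<open>Below the limit of INF, dependent choice gives a strictly increasing sequence. Equality
  of \<open>N\<close> need not be identity: if two entries were equal, congruence of
  \<open>LessR\<close> would put one below itself.\<close>

lemma SO_infinite:
  fixes N :: "(so_fun, so_rel, 'a) struc"
  assumes ne: "dom N \<noteq> {}"
    and sat: "\<And>q e. q \<in> SO \<Longrightarrow> range e \<subseteq> dom N \<Longrightarrow> sat N e q"
    and cong: "\<And>r ss ts. set ss \<union> set ts \<subseteq> dom N \<Longrightarrow> list_all2 (eqr N) ss ts \<Longrightarrow>
         rel_arity L_SO r = Some (length ss) \<Longrightarrow> rl N r ss \<Longrightarrow> rl N r ts"
  shows "\<exists>s :: nat \<Rightarrow> 'a. range s \<subseteq> dom N \<and> (\<forall>i j. i < j \<longrightarrow> \<not> eqr N (s i) (s j))"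
proof -
  obtain d where "d \<in> dom N" using ne by blast
  then have e: "range (\<lambda>_::nat. d) \<subseteq> dom N" by blast
  have "ax_WO \<in> SO" "ax_INF \<in> SO" by (simp_all add: SO_def)
  note ax = this[THEN sat, OF e]
  let ?O = "\<lambda>x. rl N OrdR [x]" and ?S = "\<lambda>x. rl N SOrdR [x]" and ?lt = "\<lambda>x y. rl N LessR [x, y]"
    and ?mem = "\<lambda>x y. rl N MemR [x, y]"
  have "sat N (\<lambda>_. d) ax_WO \<longleftrightarrow>
    (\<forall>x\<in>dom N. ?O x \<longrightarrow> (\<forall>y\<in>dom N. ?O y \<longrightarrow> (\<forall>z\<in>dom N. ?O z \<longrightarrow>
      \<not> ?lt x x \<and> (?lt x y \<and> ?lt y z \<longrightarrow> ?lt x z) \<and> (?lt x y \<or> eqr N x y \<or> ?lt y x)))) \<and>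
    (\<forall>c\<in>dom N. ?S c \<longrightarrow> (\<exists>x\<in>dom N. ?O x \<and> ?mem x c) \<longrightarrow>
      (\<exists>x\<in>dom N. ?O x \<and> ?mem x c \<and> (\<forall>y\<in>dom N. ?O y \<longrightarrow> ?lt y x \<longrightarrow> \<not> ?mem y c)))"
    unfolding ax_WO_def Let_def by (intro sat_iffs; simp)
  note WO = this[THEN iffD1, OF ax(1), THEN conjunct1, THEN bspec, THEN mp, THEN bspec, THEN mp, THEN bspec, THEN mp]
  have "sat N (\<lambda>_. d) ax_INF \<longleftrightarrow> (\<exists>l\<in>dom N. ?O l \<and> (\<exists>x\<in>dom N. ?O x \<and> ?lt x l) \<and>
      (\<forall>x\<in>dom N. ?O x \<longrightarrow> ?lt x l \<longrightarrow> (\<exists>y\<in>dom N. ?O y \<and> ?lt x y \<and> ?lt y l)))"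
    unfolding ax_INF_def Let_def by (intro sat_iffs; simp)
  from this[THEN iffD1, OF ax(2)] obtain l x0 where l: "l \<in> dom N" "?O l" "x0 \<in> dom N" "?O x0" "?lt x0 l"
    "\<And>x. x \<in> dom N \<Longrightarrow> ?O x \<Longrightarrow> ?lt x l \<Longrightarrow> \<exists>y\<in>dom N. ?O y \<and> ?lt x y \<and> ?lt y l"
    by auto
  let ?P = "\<lambda>x. x \<in> dom N \<and> ?O x \<and> ?lt x l"
  have "\<exists>s. \<forall>n. ?P (s n) \<and> ?lt (s n) (s (Suc n))"
  proof (rule dependent_nat_choice)
    show "\<exists>x. ?P x" using l(3-5) by blast
    show "\<exists>y. ?P y \<and> ?lt x y" if "?P x" for x n using l(6)[of x] that by blast
  qed
  then obtain s :: "nat \<Rightarrow> 'a" where s: "\<And>n. ?P (s n)" "\<And>n. ?lt (s n) (s (Suc n))" by blast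
  have lt: "?lt (s i) (s j)" if "i < j" for i j
    using that
  proof (induction rule: less_Suc_induct)
    case (2 i j k)
    then show ?case using WO[of "s i" "s j" "s k"] s(1) by blast
  qed (rule s)
  have "\<not> eqr N (s i) (s j)" if "i < j" for i j
  proof
    assume eq: "eqr N (s i) (s j)"
    have irr: "\<not> ?lt (s j) (s j)" and "eqr N (s j) (s j)" using WO[of "s j" "s j" "s j"] s(1) by blast+
    then have "?lt (s j) (s j)"
      using cong[of "[s i, s j]" "[s j, s j]" LessR] eq lt[OF that] s(1) by (simp add: L_SO_def)
    then show False using irr by blast
  qed
  then show ?thesis using s(1) by blast
qed

text \<open>\<open>countermodel\<close> places every countermodel on \<open>nat\<close>, so this one
  type serves all applications.\<close>

theorem SO_complete:
  assumes wf: "wf_fm L_SO p"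
    and valid: "\<And>(N :: (so_fun, so_rel, nat) struc) e. so_model N \<Longrightarrow> sat N e p"
  shows "L_SO, SO \<turnstile> p"
proof (rule ccontr)
  assume np: "\<not> (L_SO, SO \<turnstile> p)"
  obtain N :: "(so_fun, so_rel, nat) struc" and e where
    "dom N = UNIV" "eqr N = (=)" "\<And>q e. q \<in> SO \<Longrightarrow> sat N e q" "\<not> sat N e p"
  proof (rule countermodel[OF _ wf np])
    show "wf_fm L_SO q \<and> fv q = {}" if "q \<in> SO" for q using that wf_SO fv_SO by blast
    show "\<exists>s :: nat \<Rightarrow> so_fun tm. range s \<subseteq> dom N \<and> (\<forall>i j. i < j \<longrightarrow> \<not> eqr N (s i) (s j))"
      if "dom N \<noteq> {}" "\<And>q e. q \<in> SO \<Longrightarrow> range e \<subseteq> dom N \<Longrightarrow> sat N e q"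
        "\<And>r ss ts. set ss \<union> set ts \<subseteq> dom N \<Longrightarrow> list_all2 (eqr N) ss ts \<Longrightarrow>
         rel_arity L_SO r = Some (length ss) \<Longrightarrow> rl N r ss \<Longrightarrow> rl N r ts"
      for N :: "(so_fun, so_rel, so_fun tm) struc"
      using that by (rule SO_infinite)
  qed (rule that)
  moreover from this have "so_model N" by unfold_locales
  ultimately show False using valid by blast
qed

section \<open>The formulas of the interpretation\<close>

definition edge_fm :: "nat \<Rightarrow> nat \<Rightarrow> nat \<Rightarrow> so_fm" where
  "edge_fm c x y = (Ord (Var x) \<^bold>\<and> Ord (Var y) \<^bold>\<and> \<^bold>\<not> Var x \<^bold>= Var y \<^bold>\<and> G (Var x) (Var y) \<^bold>\<in> Var c)"

definition mark_fm :: "nat \<Rightarrow> nat \<Rightarrow> so_fm" where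
  "mark_fm c x = (Ord (Var x) \<^bold>\<and> G (Var x) (Var x) \<^bold>\<in> Var c)"

definition code_fm :: so_fm where
  "code_fm = (SOrd (Var 0) \<^bold>\<and> (\<^bold>\<forall>\<^sub>S1. (\<^bold>\<exists>2. Var 2 \<^bold>\<in> Var 1) \<^bold>\<longrightarrow>
     (\<^bold>\<exists>2. Var 2 \<^bold>\<in> Var 1 \<^bold>\<and> (\<^bold>\<forall>3. Var 3 \<^bold>\<in> Var 1 \<^bold>\<longrightarrow> \<^bold>\<not> edge_fm 0 3 2))))"

text \<open>Bound names start at 10 to avoid capture: in \<open>eqs_fm\<close> and
  \<open>ins_fm\<close> all arguments are below 5.\<close>

definition sim_fm :: "nat \<Rightarrow> nat \<Rightarrow> nat \<Rightarrow> nat \<Rightarrow> so_fm" where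
  "sim_fm c x d y = (let r = 10; u = 11; v = 12; u' = 13; v' = 14 in
     Ord (Var x) \<^bold>\<and> Ord (Var y) \<^bold>\<and> (\<^bold>\<exists>\<^sub>Sr.
       (\<^bold>\<forall>u. \<^bold>\<forall>v. Ord (Var u) \<^bold>\<and> Ord (Var v) \<^bold>\<and> G (Var u) (Var v) \<^bold>\<in> Var r \<^bold>\<longrightarrow>
         (\<^bold>\<forall>u'. edge_fm c u' u \<^bold>\<longrightarrow> (\<^bold>\<exists>v'. edge_fm d v' v \<^bold>\<and> G (Var u') (Var v') \<^bold>\<in> Var r)) \<^bold>\<and>
         (\<^bold>\<forall>v'. edge_fm d v' v \<^bold>\<longrightarrow> (\<^bold>\<exists>u'. edge_fm c u' u \<^bold>\<and> G (Var u') (Var v') \<^bold>\<in> Var r))) \<^bold>\<and>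
       G (Var x) (Var y) \<^bold>\<in> Var r))"

definition eqs_fm :: so_fm where
  "eqs_fm = ((\<^bold>\<forall>2. mark_fm 0 2 \<^bold>\<longrightarrow> (\<^bold>\<exists>3. mark_fm 1 3 \<^bold>\<and> sim_fm 0 2 1 3)) \<^bold>\<and>
     (\<^bold>\<forall>3. mark_fm 1 3 \<^bold>\<longrightarrow> (\<^bold>\<exists>2. mark_fm 0 2 \<^bold>\<and> sim_fm 0 2 1 3)))"

definition ins_fm :: so_fm where
  "ins_fm = (\<^bold>\<exists>2. mark_fm 1 2 \<^bold>\<and>
     (\<^bold>\<forall>3. mark_fm 0 3 \<^bold>\<longrightarrow> (\<^bold>\<exists>4. edge_fm 1 4 2 \<^bold>\<and> sim_fm 0 3 1 4)) \<^bold>\<and>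
     (\<^bold>\<forall>4. edge_fm 1 4 2 \<^bold>\<longrightarrow> (\<^bold>\<exists>3. mark_fm 0 3 \<^bold>\<and> sim_fm 0 3 1 4)))"

definition graph_interp :: "(so_fun, so_rel, unit, set_rel) interp" where
  "graph_interp = \<lparr>univ_fm = code_fm, eq_fm = eqs_fm, rel_fm = (\<lambda>_. ins_fm), fun_fm = (\<lambda>_. Bot)\<rparr>"

lemmas fm_defs = edge_fm_def mark_fm_def code_fm_def sim_fm_def eqs_fm_def ins_fm_def Let_def

lemma graph_interp_simps [simp]: "univ_fm graph_interp = code_fm" "eq_fm graph_interp = eqs_fm" "rel_fm graph_interp r = ins_fm"
  by (simp_all add: graph_interp_def)

lemma wf_fms: "wf_fm L_SO code_fm" "wf_fm L_SO eqs_fm" "wf_fm L_SO ins_fm"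
  by (auto simp: fm_defs L_SO_def intro!: wf_bind)

lemma fv_fms: "fv code_fm = {0}" "fv eqs_fm = {0, 1}" "fv ins_fm = {0, 1}"
  by (auto simp: fm_defs simp del: fv.simps(5))

lemma atom_in_Var: "atom_in I p [Var i, Var j] = app p [i, j]"
  by (simp add: atom_in_def)

text \<open>The set language has no function symbols, so its atoms are translated without any
  unravelling of terms.\<close>

lemma wf_Set_tm: "wf_tm L_Set t \<Longrightarrow> \<exists>i. t = Var i"
  by (cases t) (simp_all add: L_Set_def)

lemma wf_Set_Rel:
  assumes "wf_fm L_Set (Rel r ts)" obtains i j where "ts = [Var i, Var j]"
proof -
  have "length ts = 2" "list_all (wf_tm L_Set) ts" using assms by (simp_all add: L_Set_def)
  then obtain s t where "ts = [s, t]" "wf_tm L_Set s" "wf_tm L_Set t"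
    by (auto simp: length_Suc_conv numeral_2_eq_2)
  then show ?thesis using that wf_Set_tm by blast
qed

lemma wf_translate: "wf_fm L_Set p \<Longrightarrow> wf_fm L_SO (translate graph_interp p)"
proof (induction p)
  case (Eq s t)
  then have "wf_tm L_Set s" "wf_tm L_Set t" by simp_all
  then obtain i j where "s = Var i" "t = Var j" by (blast dest: wf_Set_tm)
  then show ?case by (simp add: atom_in_Var wf_app wf_fms)
next
  case (Rel r ts)
  then obtain i j where "ts = [Var i, Var j]" using wf_Set_Rel by blast
  then show ?case by (simp add: atom_in_Var wf_app wf_fms)
qed (simp_all add: wf_fms)

section \<open>The codes as a structure for set theory\<close>

context so_model
begin

lemma sat_code_fm: "sat M e code_fm \<longleftrightarrow> code (e 0)"
  unfolding fm_defs code_def edge_def by (intro sat_SO_iffs; simp add: folds)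

lemma sat_eqs_fm: "sat M e eqs_fm \<longleftrightarrow> eqs (e 0) (e 1)"
  unfolding fm_defs eqs_def mark_def sim_def bis_def edge_def
  by (intro sat_SO_iffs; simp add: folds)

lemma sat_ins_fm: "sat M e ins_fm \<longleftrightarrow> ins (e 0) (e 1)"
  unfolding fm_defs ins_def nd_def mark_def sim_def bis_def edge_def
  by (intro sat_SO_iffs; simp add: folds)

text \<open>Equality is \<open>eqs\<close>, so that satisfaction here is exactly the truth of the
  translation in \<open>M\<close>; see \<open>sat_translate\<close>.\<close>

definition sets :: "(unit, set_rel, 'a) struc" where
  "sets = \<lparr>dom = {c. code c}, eqr = eqs, fn = (\<lambda>_ _. undefined), rl = (\<lambda>_ xs. ins (xs ! 0) (xs ! 1))\<rparr>"

lemma sets_simps [simp]: "dom sets = {c. code c}" "eqr sets = eqs" "rl sets r xs \<longleftrightarrow> ins (xs ! 0) (xs ! 1)"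
  by (simp_all add: sets_def)

lemma sat_app_fms:
  "sat M e (app eqs_fm [i, j]) \<longleftrightarrow> eqs (e i) (e j)"
  "sat M e (app ins_fm [i, j]) \<longleftrightarrow> ins (e i) (e j)"
  "sat M e (app code_fm [i]) \<longleftrightarrow> code (e i)"
  by (simp_all add: sat_app sat_eqs_fm sat_ins_fm sat_code_fm)

lemma sat_translate: "wf_fm L_Set p \<Longrightarrow> sat M e (translate graph_interp p) \<longleftrightarrow> sat sets e p"
proof (induction p arbitrary: e)
  case (Eq s t)
  then have "wf_tm L_Set s" "wf_tm L_Set t" by simp_all
  then obtain i j where "s = Var i" "t = Var j" by (blast dest: wf_Set_tm)
  then show ?case by (simp add: atom_in_Var sat_app_fms)
next
  case (Rel r ts)
  then obtain i j where "ts = [Var i, Var j]" using wf_Set_Rel by blast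
  then show ?case by (simp add: atom_in_Var sat_app_fms)
qed (simp_all add: sat_code_fm)

text \<open>Formulas of set theory cannot tell equal codes apart. This supplies the congruence
  hypotheses of \<open>separation\<close> and \<open>replacement\<close>.\<close>

lemma sets_cong:
  assumes "wf_fm L_Set p" "\<And>i. code (e i) \<and> code (e' i) \<and> eqs (e i) (e' i)"
  shows "sat sets e p \<longleftrightarrow> sat sets e' p"
  using assms
proof (induction p arbitrary: e e')
  case (Eq s t)
  then have "wf_tm L_Set s" "wf_tm L_Set t" by simp_all
  then obtain i j where "s = Var i" "t = Var j" by (blast dest: wf_Set_tm)
  moreover have "eqs (e i) (e j) \<longleftrightarrow> eqs (e' i) (e' j)"
    using Eq.prems(2)[of i] Eq.prems(2)[of j] eqs_sym eqs_trans by meson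
  ultimately show ?case by simp
next
  case (Rel r ts)
  then obtain i j where "ts = [Var i, Var j]" using wf_Set_Rel by blast
  moreover have "ins (e i) (e j) \<longleftrightarrow> ins (e' i) (e' j)"
    using Rel.prems(2)[of i] Rel.prems(2)[of j] eqs_sym ins_cong by meson
  ultimately show ?case by simp
next
  case (Imp p q)
  have "sat sets e p \<longleftrightarrow> sat sets e' p" by (rule Imp.IH) (use Imp.prems in auto)
  moreover have "sat sets e q \<longleftrightarrow> sat sets e' q" by (rule Imp.IH) (use Imp.prems in auto)
  ultimately show ?case by simp
next
  case (Forall p)
  have "sat sets (case_nat x e) p \<longleftrightarrow> sat sets (case_nat x e') p" if "code x" for x
  proof (rule Forall.IH)
    show "code (case_nat x e i) \<and> code (case_nat x e' i) \<and> eqs (case_nat x e i) (case_nat x e' i)" for i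
      using Forall.prems(2) that eqs_refl by (cases i) auto
  qed (use Forall.prems in simp)
  then show ?case by simp
qed simp

text \<open>Brings schema formulas under \<open>dfn\<close>: the \<open>k\<close> lowest variables
  stay free, and the others go to the odd indices, where \<open>mrg\<close> keeps the parameters
  \<open>q\<close>.\<close>

lemma dfn_sat:
  assumes "wf_fm L_Set p" shows "dfn (\<lambda>e. sat sets (\<lambda>i. if i < k then e i else q i) p)"
proof -
  let ?\<rho> = "\<lambda>i. if i < k then Var (2 * i) else Var (2 * i + 1) :: so_tm"
  have "(\<lambda>i. val M (mrg e q) (?\<rho> i)) = (\<lambda>i. if i < k then e i else q i)" for e
    by (auto simp: mrg_def)
  then have "sat sets (\<lambda>i. if i < k then e i else q i) p \<longleftrightarrow>
      sat M (mrg e q) (subst_fm ?\<rho> (translate graph_interp p))" for e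
    by (simp add: sat_subst sat_translate[OF assms])
  moreover have "wf_fm L_SO (subst_fm ?\<rho> (translate graph_interp p))"
    by (intro wf_subst_fm wf_translate assms) simp
  ultimately show ?thesis unfolding dfn_def by blast
qed

lemma sets_quant_iffs:
  "(\<And>v. code v \<Longrightarrow> sat sets (e(x := v)) p \<longleftrightarrow> R v) \<Longrightarrow> sat sets e (\<^bold>\<forall>x. p) \<longleftrightarrow> (\<forall>v. code v \<longrightarrow> R v)"
  "(\<And>v. code v \<Longrightarrow> sat sets (e(x := v)) p \<longleftrightarrow> R v) \<Longrightarrow> sat sets e (\<^bold>\<exists>x. p) \<longleftrightarrow> (\<exists>v. code v \<and> R v)"
  by auto

lemmas sat_sets_iffs = sat_iffs(1-5) sets_quant_iffs

lemma sets_Extensionality: "sat sets e Extensionality"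
proof -
  have "sat sets e Extensionality \<longleftrightarrow>
    (\<forall>x. code x \<longrightarrow> (\<forall>y. code y \<longrightarrow> (\<forall>z. code z \<longrightarrow> (ins z x \<longleftrightarrow> ins z y)) \<longrightarrow> eqs x y))"
    unfolding Extensionality_def Let_def by (intro sat_sets_iffs; simp)
  then show ?thesis using set_ext by blast
qed

lemma sets_Foundation: "sat sets e Foundation"
proof -
  have "sat sets e Foundation \<longleftrightarrow> (\<forall>x. code x \<longrightarrow> (\<exists>y. code y \<and> ins y x) \<longrightarrow>
      (\<exists>y. code y \<and> ins y x \<and> \<not> (\<exists>z. code z \<and> ins z x \<and> ins z y)))"
    unfolding Foundation_def Let_def by (intro sat_sets_iffs; simp)
  then show ?thesis using foundation by blast
qed

lemma sets_Pairing: "sat sets e Pairing"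
proof -
  have "sat sets e Pairing \<longleftrightarrow> (\<forall>x. code x \<longrightarrow> (\<forall>y. code y \<longrightarrow>
      (\<exists>z. code z \<and> (\<forall>w. code w \<longrightarrow> (ins w z \<longleftrightarrow> eqs w x \<or> eqs w y)))))"
    unfolding Pairing_def Let_def by (intro sat_sets_iffs; simp)
  then show ?thesis using pairing by blast
qed

lemma sets_Unions: "sat sets e Unions"
proof -
  have "sat sets e Unions \<longleftrightarrow> (\<forall>x. code x \<longrightarrow> (\<exists>u. code u \<and>
      (\<forall>z. code z \<longrightarrow> (ins z u \<longleftrightarrow> (\<exists>y. code y \<and> ins y x \<and> ins z y)))))"
    unfolding Unions_def Let_def by (intro sat_sets_iffs; simp)
  then show ?thesis using union by blast
qed

lemma sets_Powerset: "sat sets e Powerset"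
proof -
  have "sat sets e Powerset \<longleftrightarrow> (\<forall>x. code x \<longrightarrow> (\<exists>y. code y \<and>
      (\<forall>z. code z \<longrightarrow> (ins z y \<longleftrightarrow> (\<forall>w. code w \<longrightarrow> ins w z \<longrightarrow> ins w x)))))"
    unfolding Powerset_def Let_def by (intro sat_sets_iffs; simp)
  then show ?thesis using powerset by blast
qed

lemma sets_Infinity: "sat sets e Infinity"
proof -
  have "sat sets e Infinity \<longleftrightarrow> (\<exists>x. code x \<and> (\<exists>y. code y \<and> ins y x \<and> (\<forall>z. code z \<longrightarrow> \<not> ins z y)) \<and>
    (\<forall>y. code y \<longrightarrow> ins y x \<longrightarrow> (\<exists>z. code z \<and> ins z x \<and>
      (\<forall>w. code w \<longrightarrow> (ins w z \<longleftrightarrow> ins w y \<or> eqs w y)))))"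
    unfolding Infinity_def Let_def by (intro sat_sets_iffs; simp)
  then show ?thesis using infinity by (rule iffD2)
qed

lemma sets_Choice: "sat sets e Choice"
proof -
  have "sat sets e Choice \<longleftrightarrow> (\<forall>x. code x \<longrightarrow>
    (\<forall>y. code y \<longrightarrow> ins y x \<longrightarrow> (\<exists>w. code w \<and> ins w y)) \<and>
    (\<forall>y. code y \<longrightarrow> (\<forall>z. code z \<longrightarrow> ins y x \<and> ins z x \<and> \<not> eqs y z \<longrightarrow>
      \<not> (\<exists>w. code w \<and> ins w y \<and> ins w z))) \<longrightarrow>
    (\<exists>c. code c \<and> (\<forall>y. code y \<longrightarrow> ins y x \<longrightarrow>
      (\<exists>z. code z \<and> (\<forall>w. code w \<longrightarrow> (ins w c \<and> ins w y \<longleftrightarrow> eqs w z))))))"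
    unfolding Choice_def Let_def by (intro sat_sets_iffs; simp)
  also have \<dots>
  proof (intro allI impI, elim conjE)
    fix x assume x: "code x" and ne: "\<forall>y. code y \<longrightarrow> ins y x \<longrightarrow> (\<exists>w. code w \<and> ins w y)"
      and disj: "\<forall>y. code y \<longrightarrow> (\<forall>z. code z \<longrightarrow> ins y x \<and> ins z x \<and> \<not> eqs y z \<longrightarrow>
        \<not> (\<exists>w. code w \<and> ins w y \<and> ins w z))"
    show "\<exists>c. code c \<and> (\<forall>y. code y \<longrightarrow> ins y x \<longrightarrow>
      (\<exists>z. code z \<and> (\<forall>w. code w \<longrightarrow> (ins w c \<and> ins w y \<longleftrightarrow> eqs w z))))"
      by (rule choice[OF x]) (use ne disj in blast)+
  qed
  finally show ?thesis by simp
qed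

lemma sets_Separation:
  assumes p: "wf_fm L_Set p" "fv p \<subseteq> {0} \<union> {3..<3 + n}" and e: "\<And>i. code (e i)"
  shows "sat sets e (Separation n p)"
  unfolding Separation_def Let_def sat_alls
proof (intro allI impI, elim conjE)
  fix q assume "\<forall>i. i \<notin> set [3..<3 + n] \<longrightarrow> q i = e i" "\<forall>i\<in>set [3..<3 + n]. q i \<in> dom sets"
  then have q: "code (q i)" for i using e[of i] by (cases "i \<in> set [3..<3 + n]") auto
  \<comment> \<open>The parameter values \<open>q\<close> are frozen and only variable 0
    varies.\<close>
  define P where "P x \<longleftrightarrow> sat sets (\<lambda>i. if i < Suc 0 then x else q i) p" for x
  have "sat sets (q(1 := a, 2 := b, 0 := x)) p \<longleftrightarrow> P x" for a b x
    unfolding P_def by (rule sat_cong) (use p(2) in auto)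
  then have "sat sets q (\<^bold>\<forall>1. \<^bold>\<exists>2. \<^bold>\<forall>0. 0 \<^bold>\<epsilon> 2 \<^bold>\<longleftrightarrow> 0 \<^bold>\<epsilon> 1 \<^bold>\<and> p) \<longleftrightarrow>
      (\<forall>a. code a \<longrightarrow> (\<exists>b. code b \<and> (\<forall>x. code x \<longrightarrow> (ins x b \<longleftrightarrow> ins x a \<and> P x))))"
    by (intro sat_sets_iffs; simp)
  moreover have "\<exists>b. code b \<and> (\<forall>x. code x \<longrightarrow> (ins x b \<longleftrightarrow> ins x a \<and> P x))" if a: "code a" for a
  proof -
    have "P (e 0) \<longleftrightarrow> sat sets (\<lambda>i. if i < Suc 0 then e i else q i) p" for e
      unfolding P_def by (rule sat_cong) auto
    then have D: "dfn (\<lambda>e. P (e 0))" using dfn_sat[OF p(1), of "Suc 0" q] by simp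
    have C: "P d" if "code c" "code d" "eqs c d" "P c" for c d
      using sets_cong[OF p(1), of "\<lambda>i. if i < Suc 0 then c else q i" "\<lambda>i. if i < Suc 0 then d else q i"]
        that q eqs_refl unfolding P_def by auto
    obtain b where "code b" "\<And>w. code w \<Longrightarrow> ins w b \<longleftrightarrow> ins w a \<and> P w"
      by (rule separation[OF a D C]) (assumption+, rule that)
    then show ?thesis by blast
  qed
  ultimately show "sat sets q (\<^bold>\<forall>1. \<^bold>\<exists>2. \<^bold>\<forall>0. 0 \<^bold>\<epsilon> 2 \<^bold>\<longleftrightarrow> 0 \<^bold>\<epsilon> 1 \<^bold>\<and> p)" by blast
qed

lemma sets_Replacement:
  assumes p: "wf_fm L_Set p" "fv p \<subseteq> {0, 1} \<union> {6..<6 + n}" and e: "\<And>i. code (e i)"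
  shows "sat sets e (Replacement n p)"
  unfolding Replacement_def Let_def sat_alls
proof (intro allI impI, elim conjE)
  fix q assume "\<forall>i. i \<notin> set [6..<6 + n] \<longrightarrow> q i = e i" "\<forall>i\<in>set [6..<6 + n]. q i \<in> dom sets"
  then have q: "code (q i)" for i using e[of i] by (cases "i \<in> set [6..<6 + n]") auto
  define P where "P x y \<longleftrightarrow> sat sets (\<lambda>i. if i < 2 then (if i = 0 then x else y) else q i) p" for x y
  \<comment> \<open>\<open>app\<close> places its arguments at variables 0 and 1; beyond these only
    the parameters, from 6 on, can be free in \<open>p\<close>.\<close>
  have app: "sat sets f (app p [i, j]) \<longleftrightarrow> P x y" if "f i = x" "f j = y" "\<And>k. 6 \<le> k \<Longrightarrow> f k = q k" for f i j x y
    unfolding P_def sat_app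
  proof (rule sat_cong)
    fix k assume "k \<in> fv p"
    then consider "k = 0" | "k = 1" | "6 \<le> k" using p(2) by auto
    then show "(if k < length [i, j] then f ([i, j] ! k) else f k) = (if k < 2 then if k = 0 then x else y else q k)"
      by cases (use that in auto)
  qed
  have "sat sets q ((\<^bold>\<forall>0. \<^bold>\<forall>2. \<^bold>\<forall>3. app p [0, 2] \<^bold>\<and> app p [0, 3] \<^bold>\<longrightarrow> 2 \<^bold>\<equiv> 3) \<^bold>\<longrightarrow>
        (\<^bold>\<forall>4. \<^bold>\<exists>5. \<^bold>\<forall>1. 1 \<^bold>\<epsilon> 5 \<^bold>\<longleftrightarrow> (\<^bold>\<exists>0. 0 \<^bold>\<epsilon> 4 \<^bold>\<and> app p [0, 1]))) \<longleftrightarrow>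
      ((\<forall>x. code x \<longrightarrow> (\<forall>y. code y \<longrightarrow> (\<forall>z. code z \<longrightarrow> P x y \<and> P x z \<longrightarrow> eqs y z))) \<longrightarrow>
        (\<forall>a. code a \<longrightarrow> (\<exists>b. code b \<and> (\<forall>y. code y \<longrightarrow> (ins y b \<longleftrightarrow> (\<exists>x. code x \<and> ins x a \<and> P x y))))))"
    by (intro sat_sets_iffs app; simp)
  also have \<dots>
  proof (intro impI allI)
    fix a assume fct: "\<forall>x. code x \<longrightarrow> (\<forall>y. code y \<longrightarrow> (\<forall>z. code z \<longrightarrow> P x y \<and> P x z \<longrightarrow> eqs y z))"
      and a: "code a"
    show "\<exists>b. code b \<and> (\<forall>y. code y \<longrightarrow> (ins y b \<longleftrightarrow> (\<exists>x. code x \<and> ins x a \<and> P x y)))"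
    proof (rule replacement[OF a])
      have "P (e 0) (e 1) \<longleftrightarrow> sat sets (\<lambda>i. if i < 2 then e i else q i) p" for e
        unfolding P_def by (rule sat_cong) (auto simp: less_2_cases_iff)
      then show "dfn (\<lambda>e. P (e 0) (e 1))" using dfn_sat[OF p(1), of 2 q] by simp
      show "P x' y'" if "code x" "code x'" "code y" "code y'" "eqs x x'" "eqs y y'" "P x y" for x x' y y'
        using sets_cong[OF p(1), of "\<lambda>i. if i < 2 then (if i = 0 then x else y) else q i"
            "\<lambda>i. if i < 2 then (if i = 0 then x' else y') else q i"]
          that q eqs_refl unfolding P_def by auto
      show "eqs y z" if "code x" "code y" "code z" "P x y" "P x z" for x y z
        using fct that by blast
    qed
  qed
  finally show "sat sets q ((\<^bold>\<forall>0. \<^bold>\<forall>2. \<^bold>\<forall>3. app p [0, 2] \<^bold>\<and> app p [0, 3] \<^bold>\<longrightarrow> 2 \<^bold>\<equiv> 3) \<^bold>\<longrightarrow>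
        (\<^bold>\<forall>4. \<^bold>\<exists>5. \<^bold>\<forall>1. 1 \<^bold>\<epsilon> 5 \<^bold>\<longleftrightarrow> (\<^bold>\<exists>0. 0 \<^bold>\<epsilon> 4 \<^bold>\<and> app p [0, 1])))" by simp
qed

text \<open>The schemata were verified for environments consisting of codes. The axioms are
  sentences, so the environment can be exchanged for such a one.\<close>

theorem sets_ZFC:
  assumes "p \<in> ZFC" shows "sat sets e p"
proof -
  obtain c where c: "code c" using infinity by blast
  have "sat sets (\<lambda>_. c) p"
    using assms unfolding ZFC_def
  proof (elim UnE)
    assume "p \<in> {Extensionality, Foundation, Pairing, Unions, Powerset, Infinity, Choice}"
    then show ?thesis
      by (auto intro: sets_Extensionality sets_Foundation sets_Pairing sets_Unions sets_Powerset
          sets_Infinity sets_Choice)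
  qed (auto intro!: sets_Separation sets_Replacement c)
  moreover have "sat sets e p \<longleftrightarrow> sat sets (\<lambda>_. c) p"
    by (rule sat_cong) (simp add: fv_ZFC[OF assms])
  ultimately show ?thesis by blast
qed

section \<open>The sentences required of a definable structure\<close>

lemma sat_all_in:
  "(\<And>v. code v \<Longrightarrow> sat M (e(x := v)) p \<longleftrightarrow> R v) \<Longrightarrow> sat M e (all_in graph_interp x p) \<longleftrightarrow> (\<forall>v. code v \<longrightarrow> R v)"
  by (auto simp: all_in_def sat_app_fms)

lemma sat_equiv_in: "sat M e (equiv_in graph_interp)"
proof -
  have "sat M e (equiv_in graph_interp) \<longleftrightarrow> (\<forall>x. code x \<longrightarrow> eqs x x) \<and>
    (\<forall>x. code x \<longrightarrow> (\<forall>y. code y \<longrightarrow> eqs x y \<longrightarrow> eqs y x)) \<and>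
    (\<forall>x. code x \<longrightarrow> (\<forall>y. code y \<longrightarrow> (\<forall>z. code z \<longrightarrow> eqs x y \<and> eqs y z \<longrightarrow> eqs x z)))"
    unfolding equiv_in_def Let_def alls_in_def foldr.simps o_apply id_apply graph_interp_simps
    by (intro sat_iffs(1-5) sat_all_in; simp add: sat_app_fms)
  then show ?thesis using eqs_refl eqs_sym eqs_trans by meson
qed

lemma sat_rel_cong_in: "sat M e (rel_cong_in graph_interp r 2)"
proof -
  have u: "[0..<2] = [0, 1::nat]" "[2..<2*2] = [2, 3::nat]" by (simp_all add: upt_rec)
  \<comment> \<open>\<open>\<not> False\<close> is the empty conjunction that ends
    \<open>Conj\<close>.\<close>
  have "sat M e (rel_cong_in graph_interp r 2) \<longleftrightarrow>
    (\<forall>x. code x \<longrightarrow> (\<forall>y. code y \<longrightarrow> (\<forall>x'. code x' \<longrightarrow> (\<forall>y'. code y' \<longrightarrow>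
      eqs x x' \<and> eqs y y' \<and> \<not> False \<longrightarrow> (ins x y \<longleftrightarrow> ins x' y')))))"
    unfolding rel_cong_in_def Let_def u alls_in_def eqs_in_def Conj_def zip_Cons_Cons zip.simps append.simps
      list.map prod.case foldr.simps o_apply id_apply graph_interp_simps
    by (intro sat_iffs(1-5) sat_all_in; simp add: sat_app_fms)
  also have \<dots> using ins_cong eqs_sym by meson
  finally show ?thesis by simp
qed

end

text \<open>Each derivability condition concerns a well-formed formula, so
  \<open>SO_complete\<close> reduces it to truth in all models over \<open>nat\<close>.\<close>

lemma definable_structure_graph_interp: "definable_structure L_SO SO L_Set graph_interp"
proof -
  have "wf_fm L_SO (equiv_in graph_interp)" "wf_fm L_SO (rel_cong_in graph_interp r 2)" for r
    by (simp_all add: equiv_in_def rel_cong_in_def Let_def alls_in_def eqs_in_def Conj_def all_in_def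
        upt_rec wf_bind wf_app wf_fms)
  moreover have "sat N e (\<^bold>\<exists>0. code_fm)" if "so_model N" for N :: "(so_fun, so_rel, nat) struc" and e
    using so_model.infinity[OF that] so_model.sat_code_fm[OF that] so_model.dom[OF that] by auto
  ultimately show ?thesis
    unfolding definable_structure_def
    by (auto simp: wf_fms fv_fms L_Set_def wf_bind so_model.sat_equiv_in so_model.sat_rel_cong_in
        intro!: SO_complete)
qed

theorem theorem4:
  shows "interprets L_SO SO L_Set ZFC"
  unfolding interprets_def
proof (intro exI[of _ graph_interp] conjI ballI)
  show "definable_structure L_SO SO L_Set graph_interp" by (rule definable_structure_graph_interp)
  fix p assume p: "p \<in> ZFC"
  note wf = wf_ZFC[OF p]
  show "L_SO, SO \<turnstile> translate graph_interp p"
    by (rule SO_complete[OF wf_translate[OF wf]])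
      (simp add: so_model.sat_translate[OF _ wf] so_model.sets_ZFC[OF _ p])
qed

end
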